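(* For every element $x=[L]$ of $P\mathcal X$, where $L$ is an $R_v$-lattice in $K_v^{\,n}$, the following assertions are equivalent: (1) the map $a\mapsto ax$ from $PA$ to $P\mathcal X$ is proper; (2) the map $d\mapsto dx$ from $PD$ to $P\mathcal X$ is proper; (3) there exists $g\in (PA)\,(PGL_n(K))$ such that $[L]=g[R_v^{\,n}]$; (4) the orbit $PA\,x$ contains the homothety class of an integral $R_v$-lattice; (5) the orbit $PA\,x$ contains the homothety class of an axial $R_v$-lattice; (6) every element of the orbit $PA\,x$ is the homothety class of an axial $R_v$-lattice.
   Context: Let $K$ be a function field over a finite field $\mathbb F_q$, $v$ a normalized discrete valuation of $K$, $K_v$ the completion, $\mathcal O_v$ its valuation ring, $\pi_v\in K$ a uniformizer, and $R_v$ the affine function ring associated with $v$ (regular functions on the curve of $K$ minus the closed point corresponding to $v$); $R_v$ is a Dedekind domain with fraction field $K$. Fix $n\ge 2$ and let $(e_1,\dots,e_n)$ be the canonical basis of $K_v^n$. An $R_v$-lattice in $K_v^n$ is a free rank-$n$ $R_v$-submodule spanning $K_v^n$ over $K_v$; it is integral if contained in $R_v^n$ and axial if $L\cap K_ve_i\ne\{0\}$ for every $i$. $PG=PGL_n(K_v)$, $P\Gamma=PGL_n(R_v)$, and $P\mathcal X=PG/P\Gamma$, identified $PG$-equivariantly with the set of homothety classes $[L]=K_v^\times L$ of $R_v$-lattices via $[g]P\Gamma\mapsto [gR_v^n]$, with the quotient topology. $PA$ is the image in $PG$ of the diagonal subgroup of $GL_n(K_v)$, $PD$ the image of $\{\mathrm{diag}(\pi_v^{-k_1},\dots,\pi_v^{-k_n}):k_i\in\mathbb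 Z\}$, and $PGL_n(K)$ the image of $GL_n(K)$. *)

theory Defs
  imports "HOL-Analysis.Analysis" "HOL-Computational_Algebra.Fraction_Field"
begin

section \<open>Function fields, valuations, completions\<close>

definition field_hom :: "('a::field \<Rightarrow> 'b::field) \<Rightarrow> bool" where
  "field_hom f \<longleftrightarrow>
     f 1 = 1 \<and> (\<forall>x y. f (x + y) = f x + f y) \<and> (\<forall>x y. f (x * y) = f x * f y)"

text \<open>The field \<open>'k\<close> is a function field (in one variable) over the finite field \<open>'f\<close>: it is a
  finite extension, via \<open>j\<close>, of the rational function field \<open>'f(T)\<close>.\<close>

definition function_field :: "('f::{field,finite} poly fract \<Rightarrow> 'k::field) \<Rightarrow> bool" where
  "function_field j \<longleftrightarrow>
     field_hom j \<and> (\<exists>B. finite_dimensional_vector_space (\<lambda>c x. j c * x) B)"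

text \<open>Valuations are integer valued on the nonzero elements; the value at \<open>0\<close> (morally \<open>\<infinity>\<close>) is
  irrelevant and never used.\<close>

definition normalized_valuation :: "('a::field \<Rightarrow> int) \<Rightarrow> bool" where
  "normalized_valuation v \<longleftrightarrow>
     (\<forall>x y. x \<noteq> 0 \<and> y \<noteq> 0 \<longrightarrow> v (x * y) = v x + v y) \<and>
     (\<forall>x y. x \<noteq> 0 \<and> y \<noteq> 0 \<and> x + y \<noteq> 0 \<longrightarrow> min (v x) (v y) \<le> v (x + y)) \<and>
     v ` (- {0}) = UNIV"

text \<open>The closed points of the smooth projective curve with function field \<open>'k\<close> are the normalized
  discrete valuations of \<open>'k\<close>, the local ring at a point being the valuation ring. (Valuations are
  trivial on the finite constant field automatically.) Hence the regular functions on the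
  complement of the point \<open>v\<close> are the functions without pole at any \<open>u \<noteq> v\<close>, where \<open>u \<noteq> v\<close> has to
  be tested on nonzero elements.\<close>

definition affine_ring :: "('k::field \<Rightarrow> int) \<Rightarrow> 'k set" where
  "affine_ring v =
     {x. \<forall>u. normalized_valuation u \<and> (\<exists>y. y \<noteq> 0 \<and> u y \<noteq> v y) \<longrightarrow> x = 0 \<or> 0 \<le> u x}"

text \<open>\<open>'c\<close> is, via \<open>\<iota>\<close>, the completion of \<open>'k\<close> at \<open>v\<close>, with extended valuation \<open>w\<close>. Its metric is
  given by the absolute value \<open>\<beta>\<close> to the power \<open>- w\<close>, for an arbitrary base \<open>\<beta> > 1\<close> (usually the order of the
  residue field); completeness is part of the type class.\<close>

definition completion_at ::
  "('k::field \<Rightarrow> int) \<Rightarrow> ('k \<Rightarrow> 'c::{field,complete_space}) \<Rightarrow> ('c \<Rightarrow> int) \<Rightarrow> real \<Rightarrow> bool" where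
  "completion_at v \<iota> w \<beta> \<longleftrightarrow>
     field_hom \<iota> \<and> normalized_valuation w \<and> (\<forall>x. x \<noteq> 0 \<longrightarrow> w (\<iota> x) = v x) \<and>
     1 < \<beta> \<and> (\<forall>x y. dist x y = (if x = y then 0 else \<beta> powi (- w (x - y)))) \<and>
     closure (range \<iota>) = UNIV"

section \<open>Lattices\<close>

text \<open>Throughout, \<open>R\<close> is the subring of scalars.\<close>

definition standard_lattice :: "'c set \<Rightarrow> ('c ^ 'n) set" where
  "standard_lattice R = {x. \<forall>i. x $ i \<in> R}"

definition is_lattice :: "'c::field set \<Rightarrow> ('c ^ 'n) set \<Rightarrow> bool" where
  "is_lattice R L \<longleftrightarrow>
     (\<exists>b :: 'n \<Rightarrow> 'c ^ 'n.
        L = {\<Sum>i\<in>UNIV. r i *s b i | r. range r \<subseteq> R} \<and>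
        (\<forall>r. range r \<subseteq> R \<and> (\<Sum>i\<in>UNIV. r i *s b i) = 0 \<longrightarrow> (\<forall>i. r i = 0))) \<and>
     vec.span L = UNIV"

definition integral_lattice :: "'c::field set \<Rightarrow> ('c ^ 'n) set \<Rightarrow> bool" where
  "integral_lattice R L \<longleftrightarrow> is_lattice R L \<and> L \<subseteq> standard_lattice R"

definition axial_lattice :: "'c::field set \<Rightarrow> ('c ^ 'n) set \<Rightarrow> bool" where
  "axial_lattice R L \<longleftrightarrow>
     is_lattice R L \<and> (\<forall>i. L \<inter> range (\<lambda>c. c *s axis i 1) \<noteq> {0})"

definition homothety_class :: "('c::field ^ 'n) set \<Rightarrow> ('c ^ 'n) set set" where
  "homothety_class L = {(\<lambda>x. c *s x) ` L | c. c \<noteq> 0}"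

section \<open>Projective linear groups\<close>

text \<open>Elements of \<open>PG\<close> are the classes of invertible matrices modulo nonzero scalars.\<close>

type_synonym ('c, 'n) pmat = "('c ^ 'n ^ 'n) set"

definition pclass :: "'c::field ^ 'n ^ 'n \<Rightarrow> ('c, 'n) pmat" where
  "pclass g = {mat c ** g | c. c \<noteq> 0}"

definition PG :: "('c::field, 'n::finite) pmat set" where
  "PG = pclass ` {g. invertible g}"

definition pmult :: "('c::field, 'n::finite) pmat \<Rightarrow> ('c, 'n) pmat \<Rightarrow> ('c, 'n) pmat" where
  "pmult P Q = {g ** h | g h. g \<in> P \<and> h \<in> Q}"

text \<open>The action of \<open>PG\<close> on homothety classes; see \<open>pact_class\<close> below.\<close>

definition pact :: "('c::field, 'n::finite) pmat \<Rightarrow> ('c ^ 'n) set set \<Rightarrow> ('c ^ 'n) set set" where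
  "pact P X = {(\<lambda>x. g *v x) ` L | g L. g \<in> P \<and> L \<in> X}"

definition diag_matrix :: "('n \<Rightarrow> 'c::zero) \<Rightarrow> 'c ^ 'n ^ 'n" where
  "diag_matrix a = (\<chi> i j. if i = j then a i else 0)"

definition PA :: "('c::field, 'n::finite) pmat set" where
  "PA = {pclass (diag_matrix a) | a. \<forall>i. a i \<noteq> 0}"

definition PD :: "'c::field \<Rightarrow> ('c, 'n::finite) pmat set" where
  "PD p = {pclass (diag_matrix (\<lambda>i. p powi (- k i))) | k. True}"

text \<open>The image of \<open>GL\<^sub>n('k)\<close> in \<open>PG\<close>.\<close>

definition PGL_sub :: "('k::field \<Rightarrow> 'c::field) \<Rightarrow> ('c, 'n::finite) pmat set" where
  "PGL_sub \<iota> = {pclass (map_matrix \<iota> h) | h. invertible h}"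

text \<open>The image of \<open>GL\<^sub>n(R)\<close> in \<open>PG\<close>.\<close>

definition PGamma :: "'c::field set \<Rightarrow> ('c, 'n::finite) pmat set" where
  "PGamma R = {pclass g | g h. g ** h = mat 1 \<and> h ** g = mat 1 \<and>
                 (\<forall>i j. g $ i $ j \<in> R) \<and> (\<forall>i j. h $ i $ j \<in> R)}"

section \<open>Topologies\<close>

definition quotient_topology :: "'a topology \<Rightarrow> ('a \<Rightarrow> 'b) \<Rightarrow> 'b topology" where
  "quotient_topology X f =
     topology (\<lambda>U. U \<subseteq> f ` topspace X \<and> openin X {x \<in> topspace X. f x \<in> U})"

definition PG_top :: "('c::{field,metric_space}, 'n::finite) pmat topology" where
  "PG_top = quotient_topology (subtopology euclidean {g. invertible g}) pclass"

text \<open>The space \<open>PG / P\<Gamma>\<close>, as the space of homothety classes of lattices: its topology is the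
  quotient topology for the orbit map of the class of the standard lattice, whose fibres are the
  cosets of \<open>P\<Gamma>\<close>. See \<open>topspace_PX\<close> and \<open>PX_fibres\<close>.\<close>

definition PX_top :: "'c::{field,metric_space} set \<Rightarrow> ('c ^ 'n::finite) set set topology" where
  "PX_top R = quotient_topology PG_top (\<lambda>P. pact P (homothety_class (standard_lattice R)))"

definition PX_orbit :: "('c::field, 'n::finite) pmat set \<Rightarrow> ('c ^ 'n) set set \<Rightarrow> ('c ^ 'n) set set set" where
  "PX_orbit H x = (\<lambda>a. pact a x) ` H"

definition all_equivalent :: "bool list \<Rightarrow> bool" where
  "all_equivalent Ps \<longleftrightarrow> (\<forall>P\<in>set Ps. \<forall>Q\<in>set Ps. P \<longleftrightarrow> Q)"

section \<open>Consistency of the encoding\<close>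

lemma openin_quotient_topology:
  "openin (quotient_topology X f) U \<longleftrightarrow>
     U \<subseteq> f ` topspace X \<and> openin X {x \<in> topspace X. f x \<in> U}"
proof -
  have "istopology (\<lambda>U. U \<subseteq> f ` topspace X \<and> openin X {x \<in> topspace X. f x \<in> U})"
    unfolding istopology_def
  proof (intro conjI allI impI)
    fix S T assume "S \<subseteq> f ` topspace X \<and> openin X {x \<in> topspace X. f x \<in> S}"
      "T \<subseteq> f ` topspace X \<and> openin X {x \<in> topspace X. f x \<in> T}"
    moreover have "{x \<in> topspace X. f x \<in> S \<inter> T} =
        {x \<in> topspace X. f x \<in> S} \<inter> {x \<in> topspace X. f x \<in> T}" by auto
    ultimately show "S \<inter> T \<subseteq> f ` topspace X" "openin X {x \<in> topspace X. f x \<in> S \<inter> T}"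
      by auto
  next
    fix \<K> assume *: "\<forall>K\<in>\<K>. K \<subseteq> f ` topspace X \<and> openin X {x \<in> topspace X. f x \<in> K}"
    have "{x \<in> topspace X. f x \<in> \<Union>\<K>} = (\<Union>K\<in>\<K>. {x \<in> topspace X. f x \<in> K})" by auto
    with * show "\<Union>\<K> \<subseteq> f ` topspace X" "openin X {x \<in> topspace X. f x \<in> \<Union>\<K>}"
      by (auto intro: openin_Union)
  qed
  then show ?thesis
    by (simp add: quotient_topology_def topology_inverse')
qed

lemma topspace_quotient_topology [simp]: "topspace (quotient_topology X f) = f ` topspace X"
proof -
  have "{x \<in> topspace X. f x \<in> f ` topspace X} = topspace X" by auto
  then have "openin (quotient_topology X f) (f ` topspace X)"
    by (simp add: openin_quotient_topology)
  then show ?thesis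
    by (metis openin_quotient_topology openin_subset openin_topspace subset_antisym)
qed

lemma quotient_map_quotient_topology: "quotient_map X (quotient_topology X f) f"
  by (simp add: quotient_map_def openin_quotient_topology)

lemma mat_mult_vec: "mat c *v x = c *s (x :: 'c::field ^ 'n)"
  by (simp add: mat_def matrix_vector_mult_def vec_eq_iff if_distrib if_distribR cong: if_cong)

lemma scaled_mult_vec: "(mat c ** g) *v x = c *s (g *v (x :: 'c::field ^ 'n))"
  by (simp add: mat_mult_vec flip: matrix_vector_mul_assoc)

lemma pact_class:
  fixes g :: "'c::field ^ 'n ^ 'n"
  shows "pact (pclass g) (homothety_class L) = homothety_class ((\<lambda>x. g *v x) ` L)" (is "?l = ?r")
proof
  show "?l \<subseteq> ?r"
  proof
    fix Y assume "Y \<in> ?l"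
    then obtain c d where "c \<noteq> 0" "d \<noteq> 0"
      and Y: "Y = (\<lambda>x. (mat c ** g) *v x) ` (\<lambda>x. d *s x) ` L"
      by (auto simp: pact_def pclass_def homothety_class_def)
    moreover have "Y = (\<lambda>x. (c * d) *s x) ` (\<lambda>x. g *v x) ` L"
      unfolding Y image_image scaled_mult_vec by (simp add: vec.scale)
    ultimately show "Y \<in> ?r"
      by (auto simp: homothety_class_def intro!: exI[of _ "c * d"])
  qed
  show "?r \<subseteq> ?l"
  proof
    fix Y assume "Y \<in> ?r"
    then obtain c where "c \<noteq> 0" and Y: "Y = (\<lambda>x. c *s x) ` (\<lambda>x. g *v x) ` L"
      by (auto simp: homothety_class_def)
    have "Y = (\<lambda>x. (mat c ** g) *v x) ` (\<lambda>x. 1 *s x) ` L"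
      unfolding Y image_image scaled_mult_vec by simp
    moreover have "mat c ** g \<in> pclass g"
      using \<open>c \<noteq> 0\<close> by (auto simp: pclass_def)
    moreover have "(\<lambda>x. 1 *s x) ` L \<in> homothety_class L"
      unfolding homothety_class_def by (rule CollectI, rule exI[of _ 1]) simp
    ultimately show "Y \<in> ?l"
      unfolding pact_def by blast
  qed
qed

lemma mat_mult: "mat c ** g = (\<chi> i j. c * (g :: 'c::field ^ 'n ^ 'm) $ i $ j)"
  and mult_mat: "h ** mat c = (\<chi> i j. c * (h :: 'c ^ 'm ^ 'n) $ i $ j)"
proof -
  have "(if P then c else 0) * a = (if P then c * a else 0)"
    "a * (if P then c else 0) = (if P then c * a else 0)" for P and a :: 'c
    by simp_all
  then show "mat c ** g = (\<chi> i j. c * g $ i $ j)" "h ** mat c = (\<chi> i j. c * h $ i $ j)"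
    by (simp_all add: mat_def matrix_matrix_mult_def)
qed

lemma mat_mult_mat: "mat c ** mat d = (mat (c * d) :: 'c::field ^ 'n ^ 'n)"
  unfolding mat_mult by (simp add: mat_def vec_eq_iff)

lemma mat_commute: "g ** mat c = mat c ** (g :: 'c::field ^ 'n ^ 'n)"
  unfolding mat_mult mult_mat ..

lemma homothety_class_eq_iff:
  fixes L M :: "('c::field ^ 'n) set"
  shows "homothety_class L = homothety_class M \<longleftrightarrow> (\<exists>c. c \<noteq> 0 \<and> L = (\<lambda>x. c *s x) ` M)" (is "?l \<longleftrightarrow> ?r")
proof
  assume ?l
  have "(\<lambda>x. 1 *s x) ` L \<in> homothety_class L"
    unfolding homothety_class_def by (rule CollectI, rule exI[of _ 1]) simp
  then have "L \<in> homothety_class M" using \<open>?l\<close> by simp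
  then show ?r by (auto simp: homothety_class_def)
next
  assume ?r
  then obtain c where c: "c \<noteq> 0" and L: "L = (\<lambda>x. c *s x) ` M" by blast
  have "(\<lambda>x. d *s x) ` L = (\<lambda>x. (d * c) *s x) ` M"
       "(\<lambda>x. d *s x) ` M = (\<lambda>x. (d / c) *s x) ` L" for d
    using c by (simp_all add: L image_image)
  moreover have "d * c \<noteq> 0" "d / c \<noteq> 0" if "d \<noteq> 0" for d
    using c that by simp_all
  ultimately show ?l unfolding homothety_class_def by blast
qed

lemma pmult_class:
  fixes g h :: "'c::field ^ 'n ^ 'n"
  shows "pmult (pclass g) (pclass h) = pclass (g ** h)"
proof -
  have eq: "(mat c ** g) ** (mat d ** h) = mat (c * d) ** (g ** h)" for c d
    by (metis mat_commute mat_mult_mat matrix_mul_assoc)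
  show ?thesis
  proof
    show "pmult (pclass g) (pclass h) \<subseteq> pclass (g ** h)"
      unfolding pmult_def pclass_def using eq by fastforce
    show "pclass (g ** h) \<subseteq> pmult (pclass g) (pclass h)"
    proof
      fix k assume "k \<in> pclass (g ** h)"
      then obtain c where "c \<noteq> 0" "k = (mat c ** g) ** (mat 1 ** h)"
        by (auto simp: pclass_def matrix_mul_assoc)
      moreover from this have "mat c ** g \<in> pclass g" by (auto simp: pclass_def)
      moreover have "mat 1 ** h \<in> pclass h"
        unfolding pclass_def by (rule CollectI, rule exI[of _ 1]) simp
      ultimately show "k \<in> pmult (pclass g) (pclass h)"
        unfolding pmult_def by blast
    qed
  qed
qed

lemma pclass_scale:
  fixes g :: "'c::field ^ 'n ^ 'n"
  assumes "c \<noteq> 0"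
  shows "pclass (mat c ** g) = pclass g"
proof -
  have "mat d ** (mat c ** g) = mat (d * c) ** g" for d
    by (simp add: matrix_mul_assoc mat_mult_mat)
  moreover have "mat d ** g = mat (d / c) ** (mat c ** g)" for d
    using assms by (simp add: matrix_mul_assoc mat_mult_mat)
  moreover have "d * c \<noteq> 0" "d / c \<noteq> 0" if "d \<noteq> 0" for d
    using assms that by simp_all
  ultimately show ?thesis unfolding pclass_def by blast
qed

lemma mult_axis: "k *v axis j 1 = column j (k :: 'c::field ^ 'n ^ 'm)"
  by (simp add: vec_eq_iff matrix_vector_mult_def axis_def column_def if_distrib cong: if_cong)

lemma entries_in_iff:
  fixes k :: "'c::field ^ 'n ^ 'n"
  assumes R: "0 \<in> R" "1 \<in> R" "\<And>x y. x \<in> R \<Longrightarrow> y \<in> R \<Longrightarrow> x + y \<in> R"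
    "\<And>x y. x \<in> R \<Longrightarrow> y \<in> R \<Longrightarrow> x * y \<in> R"
  shows "(\<lambda>x. k *v x) ` standard_lattice R \<subseteq> standard_lattice R \<longleftrightarrow> (\<forall>i j. k $ i $ j \<in> R)"
proof -
  have sum: "(\<Sum>i\<in>A. f i) \<in> R" if "\<And>i. f i \<in> R" for A :: "'n set" and f
    using that by (induction A rule: infinite_finite_induct) (auto intro: R)
  have "axis j 1 \<in> standard_lattice R" for j :: 'n
    using R by (simp add: standard_lattice_def axis_def)
  moreover have "k *v axis j 1 = column j k" for j
    by (rule mult_axis)
  ultimately have "(\<lambda>x. k *v x) ` standard_lattice R \<subseteq> standard_lattice R \<Longrightarrow> column j k \<in> standard_lattice R" for j
    by (metis image_subset_iff)
  moreover have "(\<lambda>x. k *v x) ` standard_lattice R \<subseteq> standard_lattice R" if "\<forall>i j. k $ i $ j \<in> R"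
    using that R(4) by (auto simp: standard_lattice_def matrix_vector_mult_def intro!: sum)
  ultimately show ?thesis
    by (auto simp: column_def standard_lattice_def)
qed

lemma PX_fibres:
  fixes g h :: "'c::field ^ 'n ^ 'n"
  assumes R: "0 \<in> R" "1 \<in> R" "\<And>x y. x \<in> R \<Longrightarrow> y \<in> R \<Longrightarrow> x + y \<in> R"
    "\<And>x y. x \<in> R \<Longrightarrow> y \<in> R \<Longrightarrow> x * y \<in> R"
  assumes "invertible g" "invertible h"
  defines "x0 \<equiv> homothety_class (standard_lattice R)"
  shows "pact (pclass g) x0 = pact (pclass h) x0 \<longleftrightarrow> (\<exists>\<gamma>\<in>PGamma R. pclass h = pmult (pclass g) \<gamma>)"
proof -
  let ?S = "standard_lattice R :: ('c ^ 'n) set"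
  obtain g' where g': "g ** g' = mat 1" "g' ** g = mat 1"
    using \<open>invertible g\<close> by (auto simp: invertible_def)
  obtain h' where h': "h ** h' = mat 1" "h' ** h = mat 1"
    using \<open>invertible h\<close> by (auto simp: invertible_def)
  have comp: "(\<lambda>x. a *v x) ` (\<lambda>x. b *v x) ` M = (\<lambda>x. (a ** b) *v x) ` M"
    for a b :: "'c ^ 'n ^ 'n" and M
    by (simp add: image_image matrix_vector_mul_assoc)
  have stab: "(\<lambda>x. k *v x) ` ?S = ?S \<longleftrightarrow> (\<forall>i j. k $ i $ j \<in> R) \<and> (\<forall>i j. k' $ i $ j \<in> R)"
    if "k ** k' = mat 1" "k' ** k = mat 1" for k k' :: "'c ^ 'n ^ 'n"
  proof -
    have kk: "(\<lambda>x. k *v x) ` (\<lambda>x. k' *v x) ` M = M" "(\<lambda>x. k' *v x) ` (\<lambda>x. k *v x) ` M = M" for M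
      unfolding comp that by simp_all
    have "(\<lambda>x. k *v x) ` ?S = ?S \<longleftrightarrow> (\<lambda>x. k *v x) ` ?S \<subseteq> ?S \<and> (\<lambda>x. k' *v x) ` ?S \<subseteq> ?S"
      using kk by (metis image_mono subset_antisym order_refl)
    then show ?thesis
      by (simp add: entries_in_iff[OF R])
  qed
  have "pact (pclass g) x0 = pact (pclass h) x0 \<longleftrightarrow>
      (\<exists>c. c \<noteq> 0 \<and> (\<lambda>x. g *v x) ` ?S = (\<lambda>x. (mat c ** h) *v x) ` ?S)"
    by (simp add: x0_def pact_class homothety_class_eq_iff image_image scaled_mult_vec)
  also have "\<dots> \<longleftrightarrow> (\<exists>\<gamma>\<in>PGamma R. pclass h = pmult (pclass g) \<gamma>)"
  proof safe
    fix c :: 'c assume c: "c \<noteq> 0" and eq: "(\<lambda>x. g *v x) ` ?S = (\<lambda>x. (mat c ** h) *v x) ` ?S"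
    define k where "k = g' ** (mat c ** h)"
    define k' where "k' = h' ** (mat (inverse c) ** g)"
    have "k ** k' = g' ** (mat c ** (h ** h') ** mat (inverse c)) ** g"
      by (simp add: k_def k'_def matrix_mul_assoc)
    then have 1: "k ** k' = mat 1" using c by (simp add: h' g' mat_mult_mat)
    have "k' ** k = h' ** (mat (inverse c) ** (g ** g') ** mat c) ** h"
      by (simp add: k_def k'_def matrix_mul_assoc)
    then have 2: "k' ** k = mat 1" using c by (simp add: h' g' mat_mult_mat)
    have "(\<lambda>x. k *v x) ` ?S = (\<lambda>x. g' *v x) ` (\<lambda>x. g *v x) ` ?S"
      unfolding eq comp k_def ..
    also have "\<dots> = ?S" unfolding comp g' by simp
    finally have "pclass k \<in> PGamma R"
      using 1 2 stab[OF 1 2] unfolding PGamma_def by blast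
    moreover have "g ** k = mat c ** h"
      by (simp add: k_def matrix_mul_assoc g')
    then have "pclass h = pmult (pclass g) (pclass k)"
      using pclass_scale[OF c, of h] by (simp only: pmult_class)
    ultimately show "\<exists>\<gamma>\<in>PGamma R. pclass h = pmult (pclass g) \<gamma>" by blast
  next
    fix \<gamma> assume "\<gamma> \<in> PGamma R" and eq: "pclass h = pmult (pclass g) \<gamma>"
    then obtain k k' where k: "\<gamma> = pclass k" "k ** k' = mat 1" "k' ** k = mat 1"
      "\<forall>i j. k $ i $ j \<in> R" "\<forall>i j. k' $ i $ j \<in> R" by (auto simp: PGamma_def)
    have "g ** k \<in> pclass h"
      unfolding eq k(1) pmult_class unfolding pclass_def by (rule CollectI, rule exI[of _ 1]) simp
    then obtain c where c: "c \<noteq> 0" "g ** k = mat c ** h" by (auto simp: pclass_def)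
    have "(\<lambda>x. (mat c ** h) *v x) ` ?S = (\<lambda>x. g *v x) ` (\<lambda>x. k *v x) ` ?S"
      unfolding comp c(2) ..
    also have "(\<lambda>x. k *v x) ` ?S = ?S" using k stab by blast
    finally show "\<exists>c. c \<noteq> 0 \<and> (\<lambda>x. g *v x) ` ?S = (\<lambda>x. (mat c ** h) *v x) ` ?S"
      using c(1) by (intro exI[of _ c] conjI) simp_all
  qed
  finally show ?thesis .
qed

lemma is_lattice_iff:
  fixes L :: "('c::field ^ 'n) set"
  assumes R: "0 \<in> R" "1 \<in> R"
  shows "is_lattice R L \<longleftrightarrow> (\<exists>g :: 'c ^ 'n ^ 'n. invertible g \<and> L = (\<lambda>x. g *v x) ` standard_lattice R)"
proof -
  have img: "{\<Sum>i\<in>UNIV. r i *s b i | r. range r \<subseteq> R} = (\<lambda>x. (\<chi> i j. b j $ i) *v x) ` standard_lattice R"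
    for b :: "'n \<Rightarrow> 'c ^ 'n"
  proof -
    have e: "(\<chi> i j. b j $ i) *v x = (\<Sum>i\<in>UNIV. x $ i *s b i)" for x
      by (simp add: vec_eq_iff matrix_vector_mult_def mult.commute)
    show ?thesis
    proof safe
      fix r :: "'n \<Rightarrow> 'c" assume "range r \<subseteq> R"
      then have "(\<chi> i. r i) \<in> standard_lattice R" by (auto simp: standard_lattice_def)
      moreover have "(\<Sum>i\<in>UNIV. r i *s b i) = (\<chi> i j. b j $ i) *v (\<chi> i. r i)" by (simp add: e)
      ultimately show "(\<Sum>i\<in>UNIV. r i *s b i) \<in> (\<lambda>x. (\<chi> i j. b j $ i) *v x) ` standard_lattice R"
        by blast
    next
      fix x :: "'c ^ 'n" assume "x \<in> standard_lattice R"
      then show "\<exists>r. (\<chi> i j. b j $ i) *v x = (\<Sum>i\<in>UNIV. r i *s b i) \<and> range r \<subseteq> R"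
        by (intro exI[of _ "\<lambda>i. x $ i"]) (auto simp: e standard_lattice_def)
    qed
  qed
  show ?thesis
  proof
    assume "is_lattice R L"
    then obtain b :: "'n \<Rightarrow> 'c ^ 'n" where L: "L = (\<lambda>x. (\<chi> i j. b j $ i) *v x) ` standard_lattice R" and "vec.span L = UNIV"
      unfolding is_lattice_def img by auto
    let ?g = "\<chi> i j. b j $ i"
    have "vec.subspace (range (\<lambda>x. ?g *v x))"
      unfolding vec.subspace_def
    proof (intro conjI ballI allI)
      show "0 \<in> range (\<lambda>x. ?g *v x)" by (rule range_eqI[of _ _ 0]) simp
    next
      fix y z assume "y \<in> range (\<lambda>x. ?g *v x)" "z \<in> range (\<lambda>x. ?g *v x)"
      then show "y + z \<in> range (\<lambda>x. ?g *v x)" by (auto simp flip: matrix_vector_right_distrib)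
    next
      fix c y assume "y \<in> range (\<lambda>x. ?g *v x)"
      then show "c *s y \<in> range (\<lambda>x. ?g *v x)" by (auto simp flip: vec.scale)
    qed
    then have "vec.span L \<subseteq> range (\<lambda>x. ?g *v x)"
      unfolding L by (intro vec.span_minimal) auto
    then have "surj (\<lambda>x. ?g *v x)" using \<open>vec.span L = UNIV\<close> by auto
    then have "invertible ?g"
      by (metis invertible_right_inverse matrix_right_invertible_surjective)
    then show "\<exists>g :: 'c ^ 'n ^ 'n. invertible g \<and> L = (\<lambda>x. g *v x) ` standard_lattice R"
      using L by (intro exI[of _ ?g] conjI)
  next
    assume "\<exists>g :: 'c ^ 'n ^ 'n. invertible g \<and> L = (\<lambda>x. g *v x) ` standard_lattice R"
    then obtain g :: "'c ^ 'n ^ 'n" where "invertible g" and L: "L = (\<lambda>x. g *v x) ` standard_lattice R" by blast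
    define b where "b = (\<lambda>j. column j g)"
    have g: "g = (\<chi> i j. b j $ i)" by (simp add: b_def column_def vec_eq_iff)
    have sum: "(\<Sum>i\<in>UNIV. r i *s b i) = g *v (\<chi> i. r i)" for r
      unfolding g by (simp add: vec_eq_iff matrix_vector_mult_def mult.commute)
    obtain g' where g': "g ** g' = mat 1" "g' ** g = mat 1"
      using \<open>invertible g\<close> by (auto simp: invertible_def)
    have free: "r i = 0" if "(\<Sum>i\<in>UNIV. r i *s b i) = 0" for r i
    proof -
      have "(g' ** g) *v (\<chi> i. r i) = 0"
        using that unfolding sum by (simp flip: matrix_vector_mul_assoc)
      then show ?thesis by (simp add: g' vec_eq_iff)
    qed
    have "axis j 1 \<in> standard_lattice R" for j :: 'n
      using R by (simp add: standard_lattice_def axis_def)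
    moreover have "b j = g *v axis j 1" for j by (simp add: b_def mult_axis)
    ultimately have "b j \<in> L" for j unfolding L by blast
    then have "(\<Sum>i\<in>UNIV. r i *s b i) \<in> vec.span L" for r
      by (intro vec.span_sum vec.span_scale vec.span_base)
    moreover have "y = (\<Sum>i\<in>UNIV. (g' *v y) $ i *s b i)" for y
      unfolding sum by (simp add: matrix_vector_mul_assoc g')
    ultimately have "vec.span L = UNIV" by (metis UNIV_eq_I)
    moreover have "L = {\<Sum>i\<in>UNIV. r i *s b i | r. range r \<subseteq> R}"
      unfolding L img g ..
    ultimately show "is_lattice R L" unfolding is_lattice_def using free by blast
  qed
qed

lemma topspace_PX:
  fixes R :: "'c::{field,metric_space} set"
  assumes "0 \<in> R" "1 \<in> R"
  shows "topspace (PX_top R :: ('c ^ 'n::finite) set set topology) = homothety_class ` {L. is_lattice R L}"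
proof -
  have "topspace (PX_top R :: ('c ^ 'n::finite) set set topology) =
      (\<lambda>g :: 'c ^ 'n ^ 'n. homothety_class ((\<lambda>x. g *v x) ` standard_lattice R)) ` {g. invertible g}"
    by (simp add: PX_top_def PG_top_def image_image pact_class)
  also have "\<dots> = homothety_class ` {L. is_lattice R L}"
    using is_lattice_iff[OF assms] by (auto simp: image_iff)
  finally show ?thesis .
qed

lemma affine_ring_closed:
  fixes v :: "'k::field \<Rightarrow> int"
  shows "0 \<in> affine_ring v" "1 \<in> affine_ring v"
    "x \<in> affine_ring v \<Longrightarrow> y \<in> affine_ring v \<Longrightarrow> x + y \<in> affine_ring v"
    "x \<in> affine_ring v \<Longrightarrow> y \<in> affine_ring v \<Longrightarrow> x * y \<in> affine_ring v"
proof -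
  have one: "u 1 = 0" if "normalized_valuation u" for u :: "'k \<Rightarrow> int"
    using that unfolding normalized_valuation_def by (metis add_cancel_right_right mult.right_neutral one_neq_zero)
  show "0 \<in> affine_ring v" "1 \<in> affine_ring v"
    unfolding affine_ring_def using one by (auto, metis order_refl)
  have add: "x + y = 0 \<or> 0 \<le> u (x + y)" "x * y = 0 \<or> 0 \<le> u (x * y)"
    if "normalized_valuation u" "x = 0 \<or> 0 \<le> u x" "y = 0 \<or> 0 \<le> u y" for u :: "'k \<Rightarrow> int" and x y
  proof -
    show "x + y = 0 \<or> 0 \<le> u (x + y)"
    proof (cases "x = 0 \<or> y = 0 \<or> x + y = 0")
      case False
      then have "min (u x) (u y) \<le> u (x + y)" using that(1) by (simp add: normalized_valuation_def)
      then show ?thesis using that False by linarith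
    qed (use that in auto)
    show "x * y = 0 \<or> 0 \<le> u (x * y)"
    proof (cases "x = 0 \<or> y = 0")
      case False
      then have "u (x * y) = u x + u y" using that(1) by (simp add: normalized_valuation_def)
      then show ?thesis using that False by linarith
    qed auto
  qed
  show "x + y \<in> affine_ring v" if "x \<in> affine_ring v" "y \<in> affine_ring v"
    unfolding affine_ring_def
  proof (intro CollectI allI impI, elim conjE)
    fix u :: "'k \<Rightarrow> int" assume u: "normalized_valuation u" "\<exists>y. y \<noteq> 0 \<and> u y \<noteq> v y"
    with that have "x = 0 \<or> 0 \<le> u x" "y = 0 \<or> 0 \<le> u y" by (simp_all add: affine_ring_def)
    with u(1) show "x + y = 0 \<or> 0 \<le> u (x + y)" by (rule add(1))
  qed
  show "x * y \<in> affine_ring v" if "x \<in> affine_ring v" "y \<in> affine_ring v"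
    unfolding affine_ring_def
  proof (intro CollectI allI impI, elim conjE)
    fix u :: "'k \<Rightarrow> int" assume u: "normalized_valuation u" "\<exists>y. y \<noteq> 0 \<and> u y \<noteq> v y"
    with that have "x = 0 \<or> 0 \<le> u x" "y = 0 \<or> 0 \<le> u y" by (simp_all add: affine_ring_def)
    with u(1) show "x * y = 0 \<or> 0 \<le> u (x * y)" by (rule add(2))
  qed
qed

end

theory Submission
  imports Defs
begin

text \<open>All six conditions are compared with (5), axiality. If \<open>L\<close> is axial, a diagonal matrix \<open>a\<close> makes
  \<open>a L\<close> contain \<open>R\<^sup>n\<close>, so \<open>a L = \<rho>\<inverse> R\<^sup>n\<close> with \<open>\<rho>\<close> over \<open>R\<close>; this gives (3) and, by clearing the
  determinant, (4). Properness for axial \<open>L\<close> holds because the lattices in a compact set have no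
  short vectors relative to their covolume, whereas \<open>a L\<close> contains multiples \<open>a\<^sub>i d\<^sub>i e\<^sub>i\<close> of the basis vectors.

  Conversely, if \<open>L\<close> meets the axis \<open>K\<^sub>v e\<^sub>i\<close> trivially, there are boxes, arbitrarily long in the direction
  \<open>e\<^sub>i\<close>, without nonzero points of \<open>L\<close>. Enlarge such a box until each side is blocked by a lattice vector.
  Rescaled by \<open>d \<in> PD\<close> to the unit box, the blocking vectors form a matrix with unit diagonal and small
  off-diagonal entries, hence a matrix \<open>u\<close> in \<open>GL\<^sub>n(O\<^sub>v)\<close> by the ultrametric inequality, and \<open>d L = u N\<close>
  for one of finitely many lattices \<open>N \<supseteq> R\<^sup>n\<close>. So infinitely many \<open>d\<close> map \<open>[L]\<close> into a compact set.

  On the arithmetic side this needs that \<open>R\<close> is discrete and cocompact in \<open>K\<^sub>v\<close> with fraction field \<open>K\<close>,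
  which comes from a nonconstant function whose only pole is \<open>v\<close>, found by a counting argument.\<close>

section \<open>Valuations\<close>

text \<open>Since the constant field is finite, dimension counts become cardinality counts, and the
  same pigeonhole serves repeatedly: for the finiteness of K over \<kappa>(z), for Riemann's
  inequality, and in place of volumes in Minkowski's theorem. The algebraic input is one fact, that
  K is finite over \<kappa>(z) for every transcendental z. Because \<open>affine_ring\<close>
  quantifies over all valuations of K, it says little until enough valuations are known to exist:
  that a nonzero regular function cannot vanish at v, which is the discreteness of R, needs a
  valuation positive at a given transcendental element, hence Chevalley's extension argument. On the
  geometric side all topology is expressed through left multiplication by matrices close to 1. This
  commutes with the quotients by scalars and by GL(R), which act on the right, so neighbourhoods in
  PG and in the space of lattices have the same shape, and the orbits of GL(O) on lattices are open
  and compact. The covolume of a lattice is the absolute value of a determinant, well defined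
  because determinants over GL(R) have absolute value 1.\<close>

definition val_ge :: "('k::field \<Rightarrow> int) \<Rightarrow> int \<Rightarrow> 'k \<Rightarrow> bool" where
  "val_ge u m x \<longleftrightarrow> x = 0 \<or> m \<le> u x"

lemma val_ge_0 [simp]: "val_ge u m 0"
  by (simp add: val_ge_def)

lemma val_ge_mono: "val_ge u m x \<Longrightarrow> l \<le> m \<Longrightarrow> val_ge u l x"
  by (auto simp: val_ge_def)

context
  fixes u :: "'k::field \<Rightarrow> int"
  assumes u: "normalized_valuation u"
begin

lemma val_mult: "x \<noteq> 0 \<Longrightarrow> y \<noteq> 0 \<Longrightarrow> u (x * y) = u x + u y"
  using u by (simp add: normalized_valuation_def)

lemma val_one: "u 1 = 0"
  using val_mult[of 1 1] by simp

lemma val_uminus: "u (- x) = u x"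
proof (cases "x = 0")
  case False
  have "u (-1) + u (-1) = 0"
    using val_mult[of "-1" "-1"] val_one by simp
  then have "u (-1) = 0" by simp
  then show ?thesis using val_mult[of "-1" x] False by simp
qed simp

lemma val_inverse: "x \<noteq> 0 \<Longrightarrow> u (inverse x) = - u x"
  using val_mult[of x "inverse x"] val_one by simp

lemma val_divide: "x \<noteq> 0 \<Longrightarrow> y \<noteq> 0 \<Longrightarrow> u (x / y) = u x - u y"
  using val_mult[of x "inverse y"] val_inverse by (simp add: divide_inverse)

lemma val_power: "x \<noteq> 0 \<Longrightarrow> u (x ^ n) = int n * u x"
  by (induction n) (simp_all add: val_one val_mult algebra_simps)

lemma val_powi: "x \<noteq> 0 \<Longrightarrow> u (x powi n) = n * u x"
  by (cases n rule: int_cases2)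
     (simp_all add: val_power val_inverse power_int_minus)

lemma val_add: "x \<noteq> 0 \<Longrightarrow> y \<noteq> 0 \<Longrightarrow> x + y \<noteq> 0 \<Longrightarrow> min (u x) (u y) \<le> u (x + y)"
  using u by (simp add: normalized_valuation_def)

lemma val_ge_add: "val_ge u m x \<Longrightarrow> val_ge u m y \<Longrightarrow> val_ge u m (x + y)"
  using val_add[of x y] by (fastforce simp: val_ge_def)

lemma val_ge_uminus_iff [simp]: "val_ge u m (- x) \<longleftrightarrow> val_ge u m x"
  by (simp add: val_ge_def val_uminus)

lemma val_ge_diff: "val_ge u m x \<Longrightarrow> val_ge u m y \<Longrightarrow> val_ge u m (x - y)"
  using val_ge_add[of m x "- y"] by simp

lemma val_ge_sum: "(\<And>i. i \<in> I \<Longrightarrow> val_ge u m (f i)) \<Longrightarrow> val_ge u m (sum f I)"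
  by (induction I rule: infinite_finite_induct) (auto intro: val_ge_add)

lemma val_ge_mult: "val_ge u m x \<Longrightarrow> val_ge u l y \<Longrightarrow> val_ge u (m + l) (x * y)"
  by (cases "x = 0 \<or> y = 0") (auto simp: val_ge_def val_mult)

lemma val_ge_mult0: "val_ge u 0 x \<Longrightarrow> val_ge u m y \<Longrightarrow> val_ge u m (x * y)"
  using val_ge_mult[of 0 x m y] by simp

lemma val_ge_power: "val_ge u m x \<Longrightarrow> val_ge u (int n * m) (x ^ n)"
proof (cases "x = 0")
  case True
  then show ?thesis by (cases n) (simp_all add: val_ge_def val_one)
qed (auto simp: val_ge_def val_power mult_left_mono)

lemma val_ge_power0: "val_ge u 0 x \<Longrightarrow> val_ge u 0 (x ^ n)"
  using val_ge_power[of 0 x n] by simp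

lemma val_add_eq:
  assumes "x \<noteq> 0" "val_ge u (u x + 1) y"
  shows "x + y \<noteq> 0" "u (x + y) = u x"
proof -
  show nz: "x + y \<noteq> 0"
    using assms val_uminus[of x] by (auto simp: val_ge_def add_eq_0_iff)
  show "u (x + y) = u x"
  proof (cases "y = 0")
    case False
    then have "u x < u y" using assms by (simp add: val_ge_def)
    moreover have "min (u (x + y)) (u (- y)) \<le> u (x + y + - y)"
      using nz False assms(1) by (intro val_add) auto
    moreover have "min (u x) (u y) \<le> u (x + y)" using nz False assms(1) by (intro val_add)
    ultimately show ?thesis by (simp add: val_uminus)
  qed simp
qed

lemma val_surj: "\<exists>x. x \<noteq> 0 \<and> u x = m"
proof -
  have "m \<in> u ` (- {0})" using u by (simp add: normalized_valuation_def)
  then show ?thesis by auto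
qed

lemma val_torsion:
  assumes "x ^ n = 1" "0 < n" shows "u x = 0"
proof -
  have "x \<noteq> 0" using assms by (metis power_0_left zero_neq_one gr_implies_not0)
  then show ?thesis using val_power[of x n] assms val_one by simp
qed

end

section \<open>Several valuations at once: normalization at 0, separation and approximation\<close>

lemma normalized_valuation_update:
  "normalized_valuation u \<Longrightarrow> normalized_valuation (u(0 := m))"
  unfolding normalized_valuation_def by (auto simp: image_iff set_eq_iff)

text \<open>Discrete valuation rings are maximal subrings. Without such an element the valuation
  ring of \<open>u\<close> would lie in that of \<open>v\<close>, so \<open>v\<close> would vanish
  on the units of \<open>u\<close> and be \<open>v p\<close> times \<open>u\<close>, for a
  uniformizer \<open>p\<close> of \<open>u\<close>; surjectivity of \<open>v\<close> forces the
  factor to be 1.\<close>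

lemma valuation_separation:
  fixes u v :: "'k::field \<Rightarrow> int"
  assumes u: "normalized_valuation u" and v: "normalized_valuation v"
    and ne: "\<exists>y. y \<noteq> 0 \<and> u y \<noteq> v y"
  shows "\<exists>z. z \<noteq> 0 \<and> v z < 0 \<and> 0 \<le> u z"
proof (rule ccontr)
  assume "\<not> ?thesis"
  then have sub: "0 \<le> v z" if "z \<noteq> 0" "0 \<le> u z" for z
    using that by (meson not_le)
  have unit: "v z = 0" if "z \<noteq> 0" "u z = 0" for z
    using sub[of z] sub[of "inverse z"] that val_inverse[OF u] val_inverse[OF v] by simp
  obtain p where p: "p \<noteq> 0" "u p = 1" using val_surj[OF u] by blast
  have eq: "v z = u z * v p" if "z \<noteq> 0" for z
  proof -
    have "v (z / p powi u z) = 0"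
      using that p by (intro unit) (simp_all add: val_divide[OF u] val_powi[OF u])
    then show ?thesis using that p by (simp add: val_divide[OF v] val_powi[OF v])
  qed
  obtain y where "y \<noteq> 0" "v y = 1" using val_surj[OF v] by blast
  then have "u y * v p = 1" using eq by metis
  moreover have "0 \<le> v p" using sub p by simp
  ultimately have "v p = 1" by (auto simp: zmult_eq_1_iff)
  then have "v z = u z" if "z \<noteq> 0" for z using eq[OF that] by simp
  then show False using ne by metis
qed

lemma valuation_approximation1:
  fixes u v :: "'k::field \<Rightarrow> int"
  assumes u: "normalized_valuation u" and v: "normalized_valuation v"
    and ne: "\<exists>y. y \<noteq> 0 \<and> u y \<noteq> v y"
  shows "\<exists>z. z \<noteq> 0 \<and> v z < 0 \<and> 0 < u z"
proof -
  obtain z1 where z1: "z1 \<noteq> 0" "v z1 < 0" "0 \<le> u z1"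
    using valuation_separation[OF u v ne] by blast
  obtain z2 where z2: "z2 \<noteq> 0" "u z2 < 0" "0 \<le> v z2"
    using valuation_separation[OF v u] ne by metis
  show ?thesis
    using z1 z2 by (intro exI[of _ "z1 / z2"]) (auto simp: val_divide[OF u] val_divide[OF v])
qed

text \<open>Induction over \<open>S\<close>: \<open>z\<close> serves the old places,
  \<open>y\<close> the new one. If \<open>z\<close> has no pole at \<open>u\<close>, a large power
  of \<open>z\<close> corrects \<open>y\<close> at the old places. Otherwise
  \<open>z ^ k / (1 + z ^ k)\<close> does so: it is a unit at the poles of \<open>z\<close> and has
  value \<open>k * u' z\<close> at a zero \<open>u'\<close> of \<open>z\<close>.\<close>

lemma valuation_approximation:
  fixes v :: "'k::field \<Rightarrow> int"
  assumes v: "normalized_valuation v" and fin: "finite S"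
    and S: "\<And>u. u \<in> S \<Longrightarrow> normalized_valuation u"
    and ne: "\<And>u. u \<in> S \<Longrightarrow> \<exists>y. y \<noteq> 0 \<and> u y \<noteq> v y"
  shows "\<exists>z. z \<noteq> 0 \<and> v z < 0 \<and> (\<forall>u\<in>S. 0 < u z)"
  using fin S ne
proof (induction S)
  case empty
  obtain z where "z \<noteq> 0" "v z = -1" using val_surj[OF v] by blast
  then show ?case by (intro exI[of _ z]) simp
next
  case (insert u S)
  obtain z where z: "z \<noteq> 0" "v z < 0" "\<forall>u\<in>S. 0 < u z"
    using insert.IH insert.prems by (metis insertI2)
  have u: "normalized_valuation u" using insert.prems(1) by blast
  obtain y where y: "y \<noteq> 0" "v y < 0" "0 < u y"
    using valuation_approximation1[OF u v insert.prems(2)] by blast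
  have "\<exists>k::nat. 0 < k \<and> (\<forall>u\<in>S. 0 < u y + int k * u z)"
  proof -
    define k where "k = Suc (\<Sum>u\<in>S. nat \<bar>u y\<bar>)"
    have "0 < u' y + int k * u' z" if "u' \<in> S" for u'
    proof -
      have "nat \<bar>u' y\<bar> \<le> (\<Sum>u\<in>S. nat \<bar>u y\<bar>)"
        using insert.hyps that by (intro member_le_sum) auto
      then have "\<bar>u' y\<bar> < int k" unfolding k_def by linarith
      moreover have "int k * 1 \<le> int k * u' z"
        using z(3) that by (intro mult_left_mono) auto
      ultimately show ?thesis by linarith
    qed
    moreover have "0 < k" by (simp add: k_def)
    ultimately show ?thesis by blast
  qed
  then obtain k :: nat where k: "0 < k" "\<And>u. u \<in> S \<Longrightarrow> 0 < u y + int k * u z" by blast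
  have nS: "normalized_valuation u'" if "u' \<in> S" for u' using insert.prems(1) that by blast
  show ?case
  proof (cases "0 \<le> u z")
    case True
    show ?thesis
    proof (intro exI[of _ "y * z ^ k"] conjI ballI)
      show "v (y * z ^ k) < 0"
        using y z k(1) by (simp add: val_mult[OF v] val_power[OF v] add_neg_nonpos mult_nonneg_nonpos)
      fix u' assume "u' \<in> insert u S"
      then show "0 < u' (y * z ^ k)"
      proof
        assume "u' = u"
        then show ?thesis using y z True by (simp add: val_mult[OF u] val_power[OF u] add_pos_nonneg)
      next
        assume "u' \<in> S"
        then have "normalized_valuation u'" "0 < u' y + int k * u' z" using nS k(2) by auto
        then show ?thesis using y z(1) by (simp add: val_mult val_power)
      qed
    qed (use y z in auto)
  next
    case False
    let ?d = "1 + z ^ k"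
    have neg: "?d \<noteq> 0 \<and> u' ?d = int k * u' z" if "normalized_valuation u'" "u' z < 0" for u'
    proof -
      have "int k * u' z < 0" using that k(1) by (simp add: mult_pos_neg)
      then have "val_ge u' (u' (z ^ k) + 1) 1"
        using z that by (simp add: val_ge_def val_one val_power)
      moreover have "z ^ k \<noteq> 0" using z(1) by simp
      ultimately have "z ^ k + 1 \<noteq> 0" "u' (z ^ k + 1) = u' (z ^ k)"
        using val_add_eq[OF that(1)] by blast+
      then show ?thesis using val_power[OF that(1) z(1)] by (metis add.commute)
    qed
    have pos: "?d \<noteq> 0 \<and> u' ?d = 0" if "normalized_valuation u'" "u' z > 0" for u'
    proof -
      have "int k * u' z > 0" using that k(1) by simp
      then have "val_ge u' (u' 1 + 1) (z ^ k)"
        using z that by (simp add: val_ge_def val_one val_power)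
      then have "?d \<noteq> 0" "u' ?d = u' 1"
        using val_add_eq[OF that(1), of 1] by (metis zero_neq_one)+
      then show ?thesis by (simp add: val_one[OF that(1)])
    qed
    have d: "?d \<noteq> 0" using neg[OF v z(2)] by simp
    have val: "u' (y * (z ^ k / ?d)) = u' y + int k * u' z - u' ?d" if "normalized_valuation u'" for u'
    proof -
      have "z ^ k \<noteq> 0" "z ^ k / ?d \<noteq> 0" using z(1) d by auto
      then show ?thesis
        using val_mult[OF that y(1), of "z ^ k / ?d"] val_divide[OF that _ d, of "z ^ k"]
          val_power[OF that z(1), of k] by linarith
    qed
    show ?thesis
    proof (intro exI[of _ "y * (z ^ k / ?d)"] conjI ballI)
      show "y * (z ^ k / ?d) \<noteq> 0" using y z d by simp
      show "v (y * (z ^ k / ?d)) < 0" unfolding val[OF v] using neg[OF v z(2)] y(2) by linarith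
      fix u' assume "u' \<in> insert u S"
      then show "0 < u' (y * (z ^ k / ?d))"
      proof
        assume "u' = u"
        have "u z < 0" using False by simp
        then have "0 < u (y * (z ^ k / ?d))" using val[OF u] neg[OF u] y(3) by linarith
        then show ?thesis using \<open>u' = u\<close> by simp
      next
        assume "u' \<in> S"
        then have *: "normalized_valuation u'" "0 < u' y + int k * u' z" "0 < u' z"
          using nS k(2) z(3) by auto
        show ?thesis using val[OF *(1)] pos[OF *(1,3)] *(2) by linarith
      qed
    qed
  qed
qed

section \<open>Polynomials over the constant field, and linear dependence\<close>

locale constant_field =
  fixes \<kappa> :: "'f::{field,finite} \<Rightarrow> 'k::field"
  assumes hom: "field_hom \<kappa>"
begin

lemma \<kappa>_add: "\<kappa> (a + b) = \<kappa> a + \<kappa> b"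
  and \<kappa>_mult: "\<kappa> (a * b) = \<kappa> a * \<kappa> b"
  and \<kappa>_1 [simp]: "\<kappa> 1 = 1"
  using hom by (auto simp: field_hom_def)

lemma \<kappa>_0 [simp]: "\<kappa> 0 = 0"
  using \<kappa>_add[of 0 0] by (metis add_0_right add_left_cancel)

lemma \<kappa>_uminus: "\<kappa> (- a) = - \<kappa> a"
  using \<kappa>_add[of a "- a"] by (simp add: eq_neg_iff_add_eq_0 add.commute)

lemma \<kappa>_eq_0_iff [simp]: "\<kappa> a = 0 \<longleftrightarrow> a = 0"
proof
  assume "\<kappa> a = 0"
  show "a = 0"
  proof (rule ccontr)
    assume "a \<noteq> 0"
    then have "\<kappa> (a * inverse a) = 1" by simp
    then show False using \<open>\<kappa> a = 0\<close> by (simp only: \<kappa>_mult) simp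
  qed
qed simp

text \<open>Nonzero constants are roots of unity, which is why every valuation is trivial on
  them.\<close>

lemma \<kappa>_torsion:
  assumes "a \<noteq> 0" obtains n where "0 < n" "\<kappa> a ^ n = 1"
proof -
  have "\<not> inj (\<lambda>n::nat. a ^ n)"
    using finite_imageD[of "\<lambda>n::nat. a ^ n" UNIV] by (auto simp: infinite_UNIV_nat)
  then obtain m n :: nat where "m < n" "a ^ m = a ^ n"
    by (metis (mono_tags, lifting) injI linorder_neqE_nat)
  then have "a ^ m * a ^ (n - m) = a ^ m"
    by (metis le_add_diff_inverse less_imp_le power_add)
  then have "a ^ (n - m) = 1" using assms by simp
  moreover have "\<kappa> (a ^ l) = \<kappa> a ^ l" for l
    by (induction l) (simp_all add: \<kappa>_mult)
  ultimately show thesis using that[of "n - m"] \<open>m < n\<close> by (metis \<kappa>_1 zero_less_diff)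
qed

lemma val_\<kappa>:
  assumes "normalized_valuation u" "a \<noteq> 0" shows "u (\<kappa> a) = 0"
  using \<kappa>_torsion[OF assms(2)] val_torsion[OF assms(1)] by metis

lemma val_ge_\<kappa>: "normalized_valuation u \<Longrightarrow> val_ge u 0 (\<kappa> a)"
  by (cases "a = 0") (simp_all add: val_ge_def val_\<kappa>)

section \<open>Polynomials with constant coefficients, evaluated in K\<close>

definition ev :: "'k \<Rightarrow> 'f poly \<Rightarrow> 'k" where
  "ev z p = poly (map_poly \<kappa> p) z"

lemma ev_0 [simp]: "ev z 0 = 0" by (simp add: ev_def)

lemma ev_pCons [simp]: "ev z (pCons a p) = \<kappa> a + z * ev z p"
  by (simp add: ev_def map_poly_pCons)

lemma ev_1 [simp]: "ev z 1 = 1"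
  by (simp add: one_pCons)

lemma ev_add: "ev z (p + q) = ev z p + ev z q"
  by (induction p q rule: poly_induct2) (simp_all add: \<kappa>_add algebra_simps)

lemma ev_smult: "ev z (smult a p) = \<kappa> a * ev z p"
  by (induction p) (simp_all add: \<kappa>_mult algebra_simps)

lemma ev_mult: "ev z (p * q) = ev z p * ev z q"
  by (induction p) (simp_all add: ev_add ev_smult algebra_simps)

lemma ev_uminus: "ev z (- p) = - ev z p"
  using ev_add[of z p "- p"] by (simp add: eq_neg_iff_add_eq_0 add.commute)

lemma ev_diff: "ev z (p - q) = ev z p - ev z q"
  using ev_add[of z p "- q"] by (simp add: ev_uminus)

lemma ev_monom: "ev z (monom a n) = \<kappa> a * z ^ n"
  by (induction n) (simp_all add: monom_0 monom_Suc algebra_simps)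

lemma ev_closed:
  assumes "\<And>a. \<kappa> a \<in> W" "\<And>x y. x \<in> W \<Longrightarrow> y \<in> W \<Longrightarrow> x + y \<in> W"
    "\<And>x. x \<in> W \<Longrightarrow> z * x \<in> W"
  shows "ev z p \<in> W"
  using assms(1)[of 0] by (induction p) (auto intro: assms)

lemma val_ge_ev:
  assumes "normalized_valuation u" "val_ge u 0 z" shows "val_ge u 0 (ev z p)"
  using assms by (intro ev_closed[of "{x. val_ge u 0 x}", simplified])
    (auto intro: val_ge_\<kappa> val_ge_add val_ge_mult0)

definition transc :: "'k \<Rightarrow> bool" where
  "transc z \<longleftrightarrow> (\<forall>p. ev z p = 0 \<longrightarrow> p = 0)"

lemma transcD: "transc z \<Longrightarrow> ev z p = 0 \<longleftrightarrow> p = 0"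
  by (auto simp: transc_def)

lemma transc_nonzero: "transc z \<Longrightarrow> z \<noteq> 0"
  using transcD[of z "[:0, 1:]"] by auto

text \<open>At a zero of \<open>z\<close> the constant term decides; at a pole, in
  \<open>val_ev_neg\<close>, the leading term does. All other terms have strictly larger
  valuation.\<close>

lemma val_ev_pos:
  assumes u: "normalized_valuation u" and z: "z \<noteq> 0" "0 < u z" and p: "coeff p 0 \<noteq> 0"
  shows "ev z p \<noteq> 0" "u (ev z p) = 0"
proof -
  obtain a q where pq: "p = pCons a q" by (cases p)
  have "val_ge u 0 (ev z q)" using u z by (intro val_ge_ev) (auto simp: val_ge_def)
  moreover have "val_ge u 1 z" using z by (simp add: val_ge_def)
  ultimately have "val_ge u (u (\<kappa> a) + 1) (z * ev z q)"
    using val_ge_mult[OF u, of 1 z 0] p pq val_\<kappa>[OF u] by simp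
  then show "ev z p \<noteq> 0" "u (ev z p) = 0"
    using val_add_eq[OF u, of "\<kappa> a"] p pq val_\<kappa>[OF u, of a] by simp_all
qed

lemma val_ev_neg:
  assumes u: "normalized_valuation u" and z: "z \<noteq> 0" "u z < 0" and p: "p \<noteq> 0"
  shows "ev z p \<noteq> 0 \<and> u (ev z p) = int (degree p) * u z"
  using p
proof (induction p)
  case (pCons a p)
  show ?case
  proof (cases "p = 0")
    case True
    then show ?thesis using pCons val_\<kappa>[OF u, of a] by simp
  next
    case False
    then have nz: "z * ev z p \<noteq> 0" and eq: "u (z * ev z p) = int (Suc (degree p)) * u z"
      using pCons z by (simp_all add: val_mult[OF u] algebra_simps)
    have "u (z * ev z p) < 0" unfolding eq using z by (intro mult_pos_neg) auto
    then have "val_ge u (u (z * ev z p) + 1) (\<kappa> a)"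
      using val_ge_\<kappa>[OF u] by (rule_tac val_ge_mono) auto
    from val_add_eq[OF u nz this] show ?thesis using eq False by (simp add: add.commute)
  qed
qed simp

lemma transc_if_val:
  assumes u: "normalized_valuation u" and z: "z \<noteq> 0" "u z \<noteq> 0"
  shows "transc z"
proof (cases "u z < 0")
  case True
  then show ?thesis using val_ev_neg[OF u z(1)] by (auto simp: transc_def)
next
  case False
  have "p = 0" if "ev z p = 0" for p
    using that
  proof (induction p)
    case (pCons a p)
    have "a = 0" using val_ev_pos(1)[OF u z(1), of "pCons a p"] False z(2) pCons.prems by fastforce
    then show ?case using pCons z(1) by simp
  qed simp
  then show ?thesis by (auto simp: transc_def)
qed

lemma ev_inverse:
  assumes "z \<noteq> 0" "degree p \<le> N"
  shows "\<exists>q. z ^ N * ev (inverse z) p = ev z q"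
  using assms(2)
proof (induction p arbitrary: N)
  case (pCons a p)
  show ?case
  proof (cases "p = 0")
    case True
    then show ?thesis by (intro exI[of _ "monom a N"]) (simp add: ev_monom mult.commute)
  next
    case False
    then obtain M where N: "N = Suc M" "degree p \<le> M" using pCons.prems by (cases N) auto
    obtain q where "z ^ M * ev (inverse z) p = ev z q" using pCons.IH N by blast
    then have "z ^ N * ev (inverse z) (pCons a p) = ev z (monom a N + q)"
      using assms(1) N by (simp add: ev_add ev_monom algebra_simps)
    then show ?thesis by blast
  qed
qed (auto intro: exI[of _ 0])

text \<open>For transcendental \<open>z\<close> this is linear dependence over the field
  \<kappa>(z), denominators having been cleared. Polynomial coefficients are kept because relations
  are to be reduced modulo \<open>z\<close>, see \<open>dep_constant_coeff\<close>.\<close>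

definition dep :: "'k \<Rightarrow> nat \<Rightarrow> (nat \<Rightarrow> 'k) \<Rightarrow> bool" where
  "dep z m y \<longleftrightarrow> (\<exists>c. (\<exists>i<m. c i \<noteq> 0) \<and> (\<Sum>i<m. ev z (c i) * y i) = 0)"

text \<open>\<kappa>(z) and \<kappa>(1/z) are the same field: a high power of \<open>z\<close> turns
  polynomials in 1/z into polynomials in \<open>z\<close>.\<close>

lemma dep_inverse:
  assumes z: "transc z" "transc (inverse z)" and d: "dep (inverse z) m y"
  shows "dep z m y"
proof -
  obtain c where c: "\<exists>i<m. c i \<noteq> 0" "(\<Sum>i<m. ev (inverse z) (c i) * y i) = 0"
    using d by (auto simp: dep_def)
  define N where "N = (\<Sum>i<m. degree (c i))"
  have "degree (c i) \<le> N" if "i < m" for i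
    unfolding N_def using that by (intro member_le_sum) auto
  then have "\<exists>q. i < m \<longrightarrow> z ^ N * ev (inverse z) (c i) = ev z q" for i
    using ev_inverse[OF transc_nonzero[OF z(1)]] by metis
  then obtain q where q: "\<And>i. i < m \<Longrightarrow> z ^ N * ev (inverse z) (c i) = ev z (q i)" by metis
  have "(\<Sum>i<m. ev z (q i) * y i) = z ^ N * (\<Sum>i<m. ev (inverse z) (c i) * y i)"
    by (simp add: sum_distrib_left mult.assoc flip: q)
  moreover have "\<exists>i<m. q i \<noteq> 0"
  proof -
    obtain i where i: "i < m" "c i \<noteq> 0" using c by blast
    then have "ev z (q i) \<noteq> 0"
      using q[OF i(1)] transcD[OF z(2)] transc_nonzero[OF z(1)] by (metis mult_eq_0_iff power_not_zero)
    then show ?thesis using i by auto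
  qed
  ultimately show ?thesis using c(2) by (auto simp: dep_def)
qed

text \<open>As long as all coefficients are divisible by \<open>z\<close>, the relation can be
  divided by it, and the sum of the degrees drops. The outcome is a relation that stays nontrivial
  modulo \<open>z\<close>.\<close>

lemma dep_constant_coeff:
  assumes z: "z \<noteq> 0" and d: "dep z m y"
  shows "\<exists>c. (\<exists>i<m. coeff (c i) 0 \<noteq> 0) \<and> (\<Sum>i<m. ev z (c i) * y i) = 0"
proof -
  obtain c where "\<exists>i<m. c i \<noteq> 0" "(\<Sum>i<m. ev z (c i) * y i) = 0"
    using d by (auto simp: dep_def)
  then show ?thesis
  proof (induction "\<Sum>i<m. degree (c i)" arbitrary: c rule: less_induct)
    case less
    show ?case
    proof (cases "\<exists>i<m. coeff (c i) 0 \<noteq> 0")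
      case True
      then show ?thesis using less.prems by blast
    next
      case False
      have "\<exists>q. i < m \<longrightarrow> c i = pCons 0 q" for i
        using False by (cases "c i") (metis coeff_pCons_0)
      then obtain q where q: "\<And>i. i < m \<Longrightarrow> c i = pCons 0 (q i)" by metis
      obtain i where i: "i < m" "q i \<noteq> 0" using less.prems(1) q by fastforce
      have "(\<Sum>i<m. degree (q i)) < (\<Sum>i<m. degree (c i))"
        using i q by (intro sum_strict_mono_ex1) (auto simp: degree_pCons_eq_if)
      moreover have "(\<Sum>i<m. ev z (c i) * y i) = z * (\<Sum>i<m. ev z (q i) * y i)"
        by (simp add: sum_distrib_left mult.assoc q)
      then have "(\<Sum>i<m. ev z (q i) * y i) = 0" using less.prems(2) z by simp
      ultimately show ?thesis using less.hyps i by blast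
    qed
  qed
qed

end

lemma degree_le_Suc_eq:
  "{p :: 'f::zero poly. degree p \<le> Suc d} = (\<lambda>(a, p). pCons a p) ` (UNIV \<times> {p. degree p \<le> d})"
proof (intro set_eqI iffI)
  fix p :: "'f poly" assume p: "p \<in> {p. degree p \<le> Suc d}"
  obtain a r where "p = pCons a r" by (cases p)
  then have "degree r \<le> d" using p by (cases "r = 0") auto
  then show "p \<in> (\<lambda>(a, p). pCons a p) ` (UNIV \<times> {p. degree p \<le> d})"
    using \<open>p = pCons a r\<close> by auto
qed (auto simp: degree_pCons_eq_if)

lemma finite_card_degree_le:
  fixes d :: nat
  shows "finite {p :: 'f::{zero,finite} poly. degree p \<le> d}"
    and "card {p :: 'f poly. degree p \<le> d} = CARD('f) ^ Suc d"
proof (induction d)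
  case 0
  have "{p :: 'f poly. degree p \<le> 0} = range (\<lambda>a. [:a:])"
    by (auto elim: degree_eq_zeroE)
  moreover have "inj (\<lambda>a :: 'f. [:a:])" by (auto intro: injI)
  ultimately show "finite {p :: 'f poly. degree p \<le> 0}" "card {p :: 'f poly. degree p \<le> 0} = CARD('f) ^ Suc 0"
    by (simp_all add: card_image)
next
  case (Suc d)
  have "inj_on (\<lambda>(a :: 'f, p). pCons a p) (UNIV \<times> {p. degree p \<le> d})"
    by (auto intro!: inj_onI)
  then show "finite {p :: 'f poly. degree p \<le> Suc d}" "card {p :: 'f poly. degree p \<le> Suc d} = CARD('f) ^ Suc (Suc d)"
    using Suc unfolding degree_le_Suc_eq
    by (auto simp: card_image card_cartesian_product)
qed

lemma card_field_ge_2: "2 \<le> CARD('a::{field,finite})"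
proof -
  have "card {0, 1 :: 'a} \<le> CARD('a)" by (intro card_mono) auto
  then show ?thesis by simp
qed

text \<open>\<open>M\<close> bounds independent families uniformly in \<open>y\<close>, so K has
  finite degree over \<kappa>(z) for each transcendental \<open>z\<close>.
  \<open>function_field\<close> grants this for one generator T;
  \<open>function_field_over_j\<close> passes to all others.\<close>

locale function_field_over = constant_field \<kappa> for \<kappa> :: "'f::{field,finite} \<Rightarrow> 'k::field" +
  assumes ex_dep: "transc z \<Longrightarrow> \<exists>M. \<forall>y. dep z M y"

section \<open>Finiteness over \<kappa>(z) for every transcendental z, by counting\<close>

context
  fixes j :: "'f::{field,finite} poly fract \<Rightarrow> 'k::field"
  assumes j: "function_field j"
begin

definition "jp p = j (Fract p 1)"

lemma j_hom: "j (x + y) = j x + j y" "j (x * y) = j x * j y" "j 1 = 1"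
  using j by (auto simp: function_field_def field_hom_def)

lemma jp_add: "jp (p + q) = jp p + jp q"
  by (simp add: jp_def flip: j_hom)

lemma jp_mult: "jp (p * q) = jp p * jp q"
  by (simp add: jp_def flip: j_hom)

lemma jp_1 [simp]: "jp 1 = 1"
  by (simp add: jp_def fract_collapse j_hom)

lemma jp_0 [simp]: "jp 0 = 0"
  using jp_add[of 0 0] by (metis add_0_right add_left_cancel)

lemma jp_eq_0_iff [simp]: "jp p = 0 \<longleftrightarrow> p = 0"
proof
  assume "jp p = 0"
  show "p = 0"
  proof (rule ccontr)
    assume "p \<noteq> 0"
    then have "Fract p 1 * Fract 1 p = 1" by (simp add: One_fract_def eq_fract)
    then have "j (Fract p 1) * j (Fract 1 p) = 1" by (metis j_hom(2,3))
    with \<open>jp p = 0\<close> show False by (simp add: jp_def)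
  qed
qed simp

lemma j_Fract: "q \<noteq> 0 \<Longrightarrow> j (Fract p q) = jp p / jp q"
proof -
  assume q: "q \<noteq> 0"
  then have "Fract p q * Fract q 1 = Fract p 1" by (simp add: eq_fract)
  then have "j (Fract p q) * jp q = jp p" by (metis j_hom(2) jp_def)
  then show ?thesis using q by (simp add: field_simps)
qed

lemma constant_field_j: "constant_field (\<lambda>a. jp [:a:])"
proof
  have "jp ([:1:]) = 1" by (metis jp_1 one_pCons)
  moreover have "jp [:a + b:] = jp [:a:] + jp [:b:]" for a b by (simp flip: jp_add)
  moreover have "jp [:a * b:] = jp [:a:] * jp [:b:]" for a b by (simp add: mult.commute flip: jp_mult)
  ultimately show "field_hom (\<lambda>a. jp [:a:])" by (simp add: field_hom_def)
qed

text \<open>Counting takes the place of transcendence degree. Elements whose coordinates have degree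
  at most \<open>d\<close> form a finite set \<open>S d\<close>. Up to a fixed denominator
  \<open>D\<close>, multiplication by \<open>z\<close> moves \<open>S d\<close> into
  \<open>S (d + c)\<close>, so combinations with coefficients of degree at most \<open>J\<close> in
  \<open>z\<close> stay in \<open>S (d + c * J)\<close>. With enough vectors there are more
  combinations than values, and the difference of two coinciding ones is a relation.\<close>

lemma ex_dep_j:
  assumes "constant_field.transc (\<lambda>a. jp [:a:]) z"
  shows "\<exists>M. \<forall>y. constant_field.dep (\<lambda>a. jp [:a:]) z M y"
proof -
  interpret constant_field "\<lambda>a. jp [:a:]" by (rule constant_field_j)
  obtain B where B: "finite_dimensional_vector_space (\<lambda>c x. j c * x) B"
    using j by (auto simp: function_field_def)
  interpret fd: finite_dimensional_vector_space "\<lambda>c x. j c * x" B by (rule B)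
  have fin: "finite B" by (rule fd.finite_Basis)
  have span: "\<exists>r. x = (\<Sum>b\<in>B. j (r b) * b)" for x
    using fd.span_Basis fd.span_finite[OF fin] by (auto simp: image_iff set_eq_iff)
  define S where "S d = (\<lambda>p. \<Sum>b\<in>B. jp (p b) * b) ` {p. \<forall>b. degree (p b) \<le> d}" for d
  have S_mono: "S d \<subseteq> S e" if "d \<le> e" for d e
    unfolding S_def using that by (intro image_mono) (auto intro: order_trans)
  have S_add: "x + y \<in> S d" if xy: "x \<in> S d" "y \<in> S d" for x y d
  proof -
    obtain p q where "\<forall>b. degree (p b) \<le> d" "x = (\<Sum>b\<in>B. jp (p b) * b)"
      "\<forall>b. degree (q b) \<le> d" "y = (\<Sum>b\<in>B. jp (q b) * b)"
      using xy by (auto simp: S_def)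
    then show ?thesis unfolding S_def
      by (intro image_eqI[of _ _ "\<lambda>b. p b + q b"])
        (auto simp: jp_add algebra_simps sum.distrib intro: degree_add_le)
  qed
  have S_mult: "jp q * x \<in> S (d + e)" if x: "x \<in> S d" "degree q \<le> e" for x q d e
  proof -
    obtain p where p: "\<forall>b. degree (p b) \<le> d" "x = (\<Sum>b\<in>B. jp (p b) * b)"
      using x by (auto simp: S_def)
    have "degree (q * p b) \<le> d + e" for b
      using degree_mult_le[of q "p b"] spec[OF p(1), of b] x(2) by linarith
    then show ?thesis unfolding S_def
      by (intro image_eqI[of _ _ "\<lambda>b. q * p b"])
        (auto simp: p(2) jp_mult sum_distrib_left mult.assoc)
  qed
  have S_0: "0 \<in> S d" for d
    unfolding S_def by (intro image_eqI[of _ _ "\<lambda>_. 0"]) auto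
  have S_sum: "sum f I \<in> S d" if "\<And>i. i \<in> I \<Longrightarrow> f i \<in> S d" for f :: "'a \<Rightarrow> 'k" and I d
    using that by (induction I rule: infinite_finite_induct) (auto intro: S_0 S_add)
  have S_fin: "finite (S d) \<and> card (S d) \<le> (CARD('f) ^ Suc d) ^ card B" for d
  proof -
    let ?P = "PiE B (\<lambda>_. {p :: 'f poly. degree p \<le> d})"
    have sub: "S d \<subseteq> (\<lambda>p. \<Sum>b\<in>B. jp (p b) * b) ` ?P"
    proof
      fix x assume "x \<in> S d"
      then obtain p where "\<forall>b. degree (p b) \<le> d" "x = (\<Sum>b\<in>B. jp (p b) * b)"
        by (auto simp: S_def)
      then show "x \<in> (\<lambda>p. \<Sum>b\<in>B. jp (p b) * b) ` ?P"
        by (intro image_eqI[of _ _ "restrict p B"]) auto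
    qed
    have P: "finite ?P" using fin finite_card_degree_le(1) by (intro finite_PiE) auto
    have cP: "card ?P = (CARD('f) ^ Suc d) ^ card B"
      using fin by (simp only: card_PiE finite_card_degree_le(2) prod_constant)
    let ?f = "\<lambda>p. \<Sum>b\<in>B. jp (p b) * b"
    have "finite (?f ` ?P)" using P by (rule finite_imageI)
    then have "finite (S d)" "card (S d) \<le> card (?f ` ?P)"
      using sub by (auto intro: finite_subset card_mono)
    then show ?thesis using card_image_le[OF P, of ?f] cP by linarith
  qed
  have denom: "\<exists>D d. D \<noteq> 0 \<and> jp D * x \<in> S d" for x
  proof -
    obtain r where r: "x = (\<Sum>b\<in>B. j (r b) * b)" using span by blast
    have "\<exists>p q. r b = Fract p q \<and> q \<noteq> 0" for b by (cases "r b") auto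
    then obtain p q where pq: "\<And>b. r b = Fract (p b) (q b)" "\<And>b. q b \<noteq> 0" by metis
    let ?D = "\<Prod>b\<in>B. q b"
    let ?p = "\<lambda>b. if b \<in> B then p b * (\<Prod>b'\<in>B - {b}. q b') else 0"
    let ?d = "\<Sum>b\<in>B. degree (?p b)"
    have "jp ?D * (j (r b) * b) = jp (?p b) * b" if "b \<in> B" for b
    proof -
      have "?D = q b * (\<Prod>b'\<in>B - {b}. q b')" using fin that by (rule prod.remove)
      then show ?thesis using pq that by (simp add: j_Fract jp_mult)
    qed
    then have "jp ?D * x = (\<Sum>b\<in>B. jp (?p b) * b)"
      unfolding r sum_distrib_left by (intro sum.cong) simp_all
    moreover have "degree (?p b) \<le> ?d" for b
    proof (cases "b \<in> B")
      case True
      then show ?thesis using fin by (intro member_le_sum) auto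
    qed simp
    ultimately have "jp ?D * x \<in> S ?d" unfolding S_def by (intro image_eqI[of _ _ ?p]) auto
    moreover have "?D \<noteq> 0" using pq fin by simp
    ultimately show ?thesis by blast
  qed
  have denoms: "\<exists>D d. D \<noteq> 0 \<and> (\<forall>x\<in>X. jp D * x \<in> S d)" if "finite X" for X
    using that
  proof (induction X)
    case empty
    then show ?case by (intro exI[of _ 1]) simp
  next
    case (insert x X)
    then obtain D d where D: "D \<noteq> 0" "\<forall>x\<in>X. jp D * x \<in> S d" by blast
    obtain D' d' where D': "D' \<noteq> 0" "jp D' * x \<in> S d'" using denom by blast
    have "jp D * (jp D' * x) \<in> S (d' + (degree D + degree D' + d))"
      using D'(2) by (rule S_mult) simp
    moreover have "jp D' * (jp D * y) \<in> S (d + (degree D + degree D' + d'))" if "y \<in> X" for y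
      using D that by (intro S_mult) auto
    ultimately show ?case using D D'
      by (intro exI[of _ "D * D'"] exI[of _ "degree D + degree D' + d + d'"])
        (auto simp: jp_mult ac_simps)
  qed
  obtain D c0 where D: "D \<noteq> 0" and D_in: "\<And>b. b \<in> B \<Longrightarrow> jp D * (z * b) \<in> S c0"
    using denoms[of "(\<lambda>b. z * b) ` B"] fin by auto
  \<comment> \<open>\<open>c0\<close> is the growth of the basis under \<open>D * z\<close>. Adding
    \<open>degree D\<close> gives \<open>D ^ J\<close> degree at most \<open>c * J\<close>, which
    the constant terms require in \<open>DJ\<close>.\<close>
  define c where "c = c0 + degree D"
  have Dz: "jp D * (z * x) \<in> S (d + c)" if S: "x \<in> S d" for x d
  proof -
    obtain p where p: "\<forall>b. degree (p b) \<le> d" and x: "x = (\<Sum>b\<in>B. jp (p b) * b)"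
      using S by (auto simp: S_def)
    have "jp D * (z * x) = (\<Sum>b\<in>B. jp (p b) * (jp D * (z * b)))"
      unfolding x by (simp add: sum_distrib_left ac_simps)
    also have "\<dots> \<in> S (c0 + d)" using p D_in by (intro S_sum S_mult) auto
    finally show ?thesis using S_mono[of "c0 + d" "d + c"] by (auto simp: c_def)
  qed
  have DJ: "ev z p * (jp (D ^ J) * x) \<in> S (d + c * J)" if "x \<in> S d" "degree p \<le> J" for x d p J
    using that(2)
  proof (induction J arbitrary: p)
    case 0
    then obtain a where "p = [:a:]" by (auto elim: degree_eq_zeroE)
    then show ?case using S_mult[OF that(1), of "[:a:]" 0] by simp
  next
    case (Suc J)
    obtain a r where p: "p = pCons a r" by (cases p)
    then have "degree r \<le> J" using Suc.prems by (cases "r = 0") auto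
    then have "jp D * (z * (ev z r * (jp (D ^ J) * x))) \<in> S (d + c * J + c)"
      by (intro Dz Suc.IH)
    moreover have "jp ([:a:] * D ^ Suc J) * x \<in> S (d + c * Suc J)"
    proof (intro S_mult that(1))
      have "degree ([:a:] * D ^ Suc J) \<le> degree (D ^ Suc J)"
        by (metis add_0 degree_mult_le degree_pCons_0)
      also have "\<dots> \<le> degree D * Suc J" by (rule degree_power_le)
      also have "\<dots> \<le> c * Suc J" by (intro mult_right_mono) (auto simp: c_def)
      finally show "degree ([:a:] * D ^ Suc J) \<le> c * Suc J" .
    qed
    moreover have "ev z p * (jp (D ^ Suc J) * x) =
        jp ([:a:] * D ^ Suc J) * x + jp D * (z * (ev z r * (jp (D ^ J) * x)))"
      unfolding p by (simp add: jp_mult algebra_simps del: mult_pCons_left)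
    moreover have "d + c * J + c = d + c * Suc J" by simp
    ultimately show ?case by (metis S_add)
  qed
  \<comment> \<open>With q constants there are q^((J + 1) M) combinations and at most
    q^(\<open>card B\<close> (d + c J + 1)) values. \<open>M\<close> exceeds the slope
    \<open>card B * c\<close>, and \<open>J\<close> below absorbs the remaining
    \<open>card B * (d + 1)\<close>.\<close>
  define M where "M = card B * c + 1"
  show ?thesis
  proof (intro exI[of _ M] allI)
    fix y :: "nat \<Rightarrow> 'k"
    obtain D' d where D': "D' \<noteq> 0" and D'_in: "\<And>i. i < M \<Longrightarrow> jp D' * y i \<in> S d"
      using denoms[of "y ` {..<M}"] by auto
    define J where "J = card B * (d + 1)"
    define C where "C = PiE {..<M} (\<lambda>_. {p :: 'f poly. degree p \<le> J})"
    define \<Phi> where "\<Phi> a = jp (D ^ J) * jp D' * (\<Sum>i<M. ev z (a i) * y i)" for a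
    have sub: "\<Phi> ` C \<subseteq> S (d + c * J)"
    proof
      fix x assume "x \<in> \<Phi> ` C"
      then obtain a where a: "a \<in> C" "x = \<Phi> a" by blast
      have "x = (\<Sum>i<M. ev z (a i) * (jp (D ^ J) * (jp D' * y i)))"
        unfolding a \<Phi>_def by (simp add: sum_distrib_left ac_simps)
      also have "\<dots> \<in> S (d + c * J)" using a(1) D'_in by (intro S_sum DJ) (auto simp: C_def)
      finally show "x \<in> S (d + c * J)" .
    qed
    have "card B * Suc (d + c * J) < Suc J * M"
      unfolding M_def by (simp add: J_def algebra_simps)
    then have "CARD('f) ^ (Suc (d + c * J) * card B) < CARD('f) ^ (Suc J * M)"
      using card_field_ge_2[where 'a = 'f] by (intro power_strict_increasing) (auto simp: mult.commute)
    moreover have "card C = CARD('f) ^ (Suc J * M)"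
      unfolding C_def by (simp only: card_PiE finite_lessThan finite_card_degree_le(2) prod_constant card_lessThan power_mult)
    moreover have "card (\<Phi> ` C) \<le> CARD('f) ^ (Suc (d + c * J) * card B)"
      unfolding power_mult using S_fin sub by (meson card_mono order_trans)
    ultimately have "card (\<Phi> ` C) < card C" by linarith
    then have "\<not> inj_on \<Phi> C" using card_image by fastforce
    then obtain a a' where a: "a \<in> C" "a' \<in> C" "a \<noteq> a'" "\<Phi> a = \<Phi> a'" by (auto simp: inj_on_def)
    have "jp (D ^ J) * jp D' * (\<Sum>i<M. ev z (a i - a' i) * y i) = \<Phi> a - \<Phi> a'"
      unfolding \<Phi>_def by (simp add: ev_diff algebra_simps sum_subtractf)
    then have "(\<Sum>i<M. ev z (a i - a' i) * y i) = 0" using a(4) D D' by simp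
    moreover have "\<exists>i<M. a i - a' i \<noteq> 0"
    proof (rule ccontr)
      assume "\<not> ?thesis"
      then have "a = a'" using a(1,2) unfolding C_def by (intro PiE_ext) auto
      with a(3) show False by simp
    qed
    ultimately show "dep z M y" unfolding dep_def by (intro exI[of _ "\<lambda>i. a i - a' i"] conjI)
  qed
qed

lemma function_field_over_j: "function_field_over (\<lambda>a. jp [:a:])"
proof -
  interpret constant_field "\<lambda>a. jp [:a:]" by (rule constant_field_j)
  show ?thesis by unfold_locales (rule ex_dep_j)
qed

end

section \<open>Linear dependence over polynomial subrings\<close>

context function_field_over begin

lemma ex_basis:
  assumes "transc z"
  shows "\<exists>n b. \<not> dep z n b \<and> (\<forall>y. dep z (Suc n) y)"
proof -
  obtain M where "\<forall>y. dep z M y" using ex_dep[OF assms] by blast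
  moreover have "\<not> (\<forall>y. dep z 0 y)" by (simp add: dep_def)
  ultimately have "\<exists>n<M. (\<forall>i\<le>n. \<not> (\<forall>y. dep z i y)) \<and> (\<forall>y. dep z (Suc n) y)"
    by (rule ex_least_nat_less)
  then show ?thesis by blast
qed

lemma basis_expansion:
  assumes b: "\<not> dep z n b" and n: "\<And>y. dep z (Suc n) y"
  shows "\<exists>d c. d \<noteq> 0 \<and> ev z d * x = (\<Sum>i<n. ev z (c i) * b i)"
proof -
  obtain c where c: "\<exists>i<Suc n. c i \<noteq> 0" "(\<Sum>i<Suc n. ev z (c i) * (b(n := x)) i) = 0"
    using n[of "b(n := x)"] unfolding dep_def by blast
  then have sum: "(\<Sum>i<n. ev z (c i) * b i) + ev z (c n) * x = 0" by simp
  have "c n \<noteq> 0"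
  proof
    assume "c n = 0"
    then have "(\<Sum>i<n. ev z (c i) * b i) = 0" "\<exists>i<n. c i \<noteq> 0"
      using sum c(1) by (auto simp: less_Suc_eq)
    then show False using b by (auto simp: dep_def)
  qed
  moreover have "ev z (c n) * x = (\<Sum>i<n. ev z (- c i) * b i)"
    using sum by (simp add: ev_uminus sum_negf eq_neg_iff_add_eq_0 add.commute)
  ultimately show ?thesis by (intro exI[of _ "c n"] exI[of _ "\<lambda>i. - c i"]) simp
qed

text \<open>Multiplied by the leading coefficient of an algebraic relation, \<open>x\<close> becomes
  integral over the polynomials in \<open>z\<close>, and integral elements have no poles where
  \<open>z\<close> has none. One \<open>d\<close> serves all valuations, so this produces
  denominators in the affine ring.\<close>

lemma integral_multiple:
  assumes z: "transc z"
  shows "\<exists>d. d \<noteq> 0 \<and> (\<forall>u. normalized_valuation u \<longrightarrow> val_ge u 0 z \<longrightarrow> val_ge u 0 (ev z d * x))"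
proof -
  obtain M where "dep z M (\<lambda>i. x ^ i)" using ex_dep[OF z] by blast
  then obtain c where c: "\<exists>i<M. c i \<noteq> 0" "(\<Sum>i<M. ev z (c i) * x ^ i) = 0" by (auto simp: dep_def)
  define I where "I = {i. i < M \<and> c i \<noteq> 0}"
  define m where "m = Max I"
  have "finite I" "I \<noteq> {}" using c(1) by (auto simp: I_def)
  then have m: "m \<in> I" "\<And>i. i \<in> I \<Longrightarrow> i \<le> m" by (auto simp: m_def)
  have "(\<Sum>i<M. ev z (c i) * x ^ i) = (\<Sum>i<Suc m. ev z (c i) * x ^ i)"
  proof (intro sum.mono_neutral_right ballI)
    show "{..<Suc m} \<subseteq> {..<M}" using m(1) by (auto simp: I_def)
    fix i assume "i \<in> {..<M} - {..<Suc m}"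
    then have "c i = 0" using m(2)[of i] by (auto simp: I_def)
    then show "ev z (c i) * x ^ i = 0" by simp
  qed simp
  then have sum: "(\<Sum>i<m. ev z (c i) * x ^ i) + ev z (c m) * x ^ m = 0"
    using c(2) by simp
  let ?d = "ev z (c m)"
  have d: "?d \<noteq> 0" using m(1) transcD[OF z] by (simp add: I_def)
  have "0 < m"
  proof (rule ccontr)
    assume "\<not> 0 < m"
    then show False using sum d by simp
  qed
  have "val_ge u 0 (?d * x)" if u: "normalized_valuation u" "val_ge u 0 z" for u
  proof (rule ccontr)
    let ?w = "?d * x"
    assume neg: "\<not> val_ge u 0 ?w"
    have tm: "?d ^ (m - 1) * (ev z (c i) * x ^ i) = ev z (c i) * ?d ^ (m - 1 - i) * ?w ^ i" if "i < m" for i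
    proof -
      have "?d ^ (m - 1) = ?d ^ (m - 1 - i) * ?d ^ i" using that by (simp flip: power_add)
      then show ?thesis by (simp add: power_mult_distrib ac_simps)
    qed
    \<comment> \<open>Multiplying the relation by the power \<open>m - 1\<close> of its leading
      coefficient makes it monic in \<open>?w\<close>. At a pole of \<open>?w\<close> the term
      \<open>?w ^ m\<close> would have smaller valuation than all others.\<close>
    have "?w ^ m = ?d ^ (m - 1) * (?d * x ^ m)"
      using \<open>0 < m\<close> by (cases m) (simp_all add: power_mult_distrib ac_simps)
    also have "\<dots> = - (\<Sum>i<m. ?d ^ (m - 1) * (ev z (c i) * x ^ i))"
      using sum by (simp add: eq_neg_iff_add_eq_0 sum_distrib_left[symmetric] distrib_left[symmetric] add.commute)
    also have "\<dots> = - (\<Sum>i<m. ev z (c i) * ?d ^ (m - 1 - i) * ?w ^ i)"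
      by (intro arg_cong[of _ _ uminus] sum.cong refl tm) simp
    finally have eq: "?w ^ m = - (\<Sum>i<m. ev z (c i) * ?d ^ (m - 1 - i) * ?w ^ i)" .
    have w: "?w \<noteq> 0" "u ?w < 0" using neg by (auto simp: val_ge_def)
    have "val_ge u (int (m - 1) * u ?w) (ev z (c i) * ?d ^ (m - 1 - i) * ?w ^ i)" if "i < m" for i
    proof (rule val_ge_mult0[OF u(1)])
      show "val_ge u 0 (ev z (c i) * ?d ^ (m - 1 - i))"
        by (intro val_ge_mult0 val_ge_power0 u val_ge_ev)
      have "int (m - 1) * u ?w \<le> int i * u ?w"
        using w(2) that by (intro mult_right_mono_neg) auto
      then show "val_ge u (int (m - 1) * u ?w) (?w ^ i)"
        by (simp only: val_ge_def val_power[OF u(1) w(1)]) simp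
    qed
    then have "val_ge u (int (m - 1) * u ?w) (?w ^ m)"
      unfolding eq by (simp only: val_ge_uminus_iff[OF u(1)]) (intro val_ge_sum u, auto)
    moreover have "?w ^ m \<noteq> 0" using w(1) by (rule power_not_zero)
    ultimately have "int (m - 1) * u ?w \<le> int m * u ?w"
      unfolding val_ge_def val_power[OF u(1) w(1), of m] by blast
    moreover have "int m * u ?w = int (m - 1) * u ?w + u ?w"
      using \<open>0 < m\<close> by (cases m) (simp_all add: algebra_simps)
    ultimately show False using w(2) by simp
  qed
  then show ?thesis using m(1) by (intro exI[of _ "c m"]) (auto simp: I_def)
qed

text \<open>The degree over \<kappa>(t) bounds the number of zeros. Given one zero too many, choose
  \<open>z i\<close> with a pole at the i-th of them and zeros at the others. A relation between the
  \<open>z i\<close> over \<kappa>[t] can be taken with some \<open>c k\<close> a unit at the zeros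
  of \<open>t\<close>, and then the pole of \<open>z k\<close> does not cancel. The condition
  \<open>u 0 = 0\<close> selects one function per place, the value at 0 being arbitrary.\<close>

lemma finite_zeros:
  assumes t: "transc t"
  shows "finite {u. normalized_valuation u \<and> u 0 = 0 \<and> 0 < u t}" (is "finite ?S")
proof (rule ccontr)
  assume "infinite ?S"
  obtain n where "\<forall>y. dep t (Suc n) y" using ex_basis[OF t] by (elim exE conjE)
  then have n: "dep t (Suc n) y" for y ..
  obtain F where F: "F \<subseteq> ?S" "finite F" "card F = Suc n"
    using infinite_arbitrarily_large[OF \<open>infinite ?S\<close>, of "Suc n"] by (elim exE conjE)
  obtain e where e: "bij_betw e {0..<Suc n} F" using ex_bij_betw_nat_finite[OF F(2)] F(3) by auto
  have eF: "e i \<in> F" if "i < Suc n" for i using e that by (auto simp: bij_betw_def)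
  have einj: "e i \<noteq> e k" if "i < Suc n" "k < Suc n" "i \<noteq> k" for i k
    using e that by (auto simp: bij_betw_def inj_on_def)
  have nv: "normalized_valuation (e i)" "0 < e i t" if "i < Suc n" for i
    using eF[OF that] F(1) by auto
  have "\<exists>z. z \<noteq> 0 \<and> e i z < 0 \<and> (\<forall>u\<in>F - {e i}. 0 < u z)" if "i < Suc n" for i
  proof (rule valuation_approximation)
    fix u assume u: "u \<in> F - {e i}"
    then show "normalized_valuation u" using F(1) by auto
    have "u 0 = 0" "e i 0 = 0" using F(1) u eF[OF that] by blast+
    moreover have "u \<noteq> e i" using u by blast
    ultimately show "\<exists>y. y \<noteq> 0 \<and> u y \<noteq> e i y" by (metis ext)
  qed (use that nv F in auto)
  then obtain z where z: "\<And>i. i < Suc n \<Longrightarrow> z i \<noteq> 0 \<and> e i (z i) < 0 \<and> (\<forall>u\<in>F - {e i}. 0 < u (z i))"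
    by metis
  obtain c k where k: "k < Suc n" "coeff (c k) 0 \<noteq> 0" and sum: "(\<Sum>i<Suc n. ev t (c i) * z i) = 0"
    using dep_constant_coeff[OF transc_nonzero[OF t] n] by blast
  note u = nv(1)[OF k(1)]
  have ck: "ev t (c k) \<noteq> 0" "e k (ev t (c k)) = 0"
    using val_ev_pos[OF u transc_nonzero[OF t] nv(2)[OF k(1)] k(2)] by auto
  have "val_ge (e k) 0 (\<Sum>i\<in>{..<Suc n} - {k}. ev t (c i) * z i)"
  proof (intro val_ge_sum[OF u] val_ge_mult0[OF u] val_ge_ev[OF u])
    show "val_ge (e k) 0 t" using nv(2)[OF k(1)] by (simp add: val_ge_def)
    fix i assume i: "i \<in> {..<Suc n} - {k}"
    then have "e k \<in> F - {e i}" using einj[of k i] eF[OF k(1)] k(1) by auto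
    then show "val_ge (e k) 0 (z i)" using z[of i] i by (auto simp: val_ge_def intro: less_imp_le)
  qed
  moreover have "ev t (c k) * z k \<noteq> 0" "e k (ev t (c k) * z k) < 0"
    using ck z[OF k(1)] by (auto simp: val_mult[OF u])
  ultimately have "ev t (c k) * z k + (\<Sum>i\<in>{..<Suc n} - {k}. ev t (c i) * z i) \<noteq> 0"
    by (intro val_add_eq(1)[OF u]) (auto elim: val_ge_mono)
  moreover have "(\<Sum>i<Suc n. ev t (c i) * z i) = ev t (c k) * z k + (\<Sum>i\<in>{..<Suc n} - {k}. ev t (c i) * z i)"
    using k(1) by (intro sum.remove) auto
  ultimately show False using sum by simp
qed

text \<open>For a \<kappa>[t]-module \<open>W\<close> in K, the space W / t W has dimension at most
  \<open>n\<close> over the constants: a relation between \<open>n + 1\<close> elements over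
  \<kappa>[t], not divisible by \<open>t\<close>, reduces to a relation over the constants modulo t
  W. \<open>E\<close> is the span of a family that is independent modulo t W and cannot be
  enlarged.\<close>

lemma residue_cover:
  assumes t: "t \<noteq> 0" and n: "\<And>y. dep t (Suc n) y"
    and W: "\<And>x y. x \<in> W \<Longrightarrow> y \<in> W \<Longrightarrow> x + y \<in> W" "\<And>a x. x \<in> W \<Longrightarrow> \<kappa> a * x \<in> W"
      "\<And>x. x \<in> W \<Longrightarrow> t * x \<in> W" "0 \<in> W"
  shows "\<exists>E\<subseteq>W. finite E \<and> card E \<le> CARD('f) ^ n \<and> (\<forall>x\<in>W. \<exists>e\<in>E. \<exists>w\<in>W. x = e + t * w)"
proof -
  have sumW: "sum f I \<in> W" if "\<And>i. i \<in> I \<Longrightarrow> f i \<in> W" for f :: "nat \<Rightarrow> 'k" and I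
    using that by (induction I rule: infinite_finite_induct) (auto intro: W)
  have negW: "- x \<in> W" if "x \<in> W" for x
    using W(2)[OF that, of "-1"] by (simp add: \<kappa>_uminus)
  have evW: "ev t p * x \<in> W" if "x \<in> W" for p x
    using that by (induction p) (auto simp: distrib_right mult.assoc intro: W)
  define Q where "Q m \<longleftrightarrow> (\<forall>y. (\<forall>i<m. y i \<in> W) \<longrightarrow>
    (\<exists>\<alpha>. (\<exists>i<m. \<alpha> i \<noteq> 0) \<and> (\<exists>w\<in>W. (\<Sum>i<m. \<kappa> (\<alpha> i) * y i) = t * w)))" for m :: nat
  have "Q (Suc n)"
    unfolding Q_def
  proof (intro allI impI)
    fix y assume y: "\<forall>i<Suc n. y i \<in> W"
    obtain c where c: "\<exists>i<Suc n. coeff (c i) 0 \<noteq> 0" "(\<Sum>i<Suc n. ev t (c i) * y i) = 0"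
      using dep_constant_coeff[OF t n] by blast
    have "\<exists>q. c i = pCons (coeff (c i) 0) q" for i by (cases "c i") auto
    then obtain q where q: "\<And>i. c i = pCons (coeff (c i) 0) (q i)" by metis
    have "ev t (c i) = \<kappa> (coeff (c i) 0) + t * ev t (q i)" for i
      using arg_cong[OF q, of "ev t"] by simp
    then have "(\<Sum>i<Suc n. \<kappa> (coeff (c i) 0) * y i) + t * (\<Sum>i<Suc n. ev t (q i) * y i) = (\<Sum>i<Suc n. ev t (c i) * y i)"
      by (simp add: sum_distrib_left sum.distrib algebra_simps)
    then have "(\<Sum>i<Suc n. \<kappa> (coeff (c i) 0) * y i) = t * (- (\<Sum>i<Suc n. ev t (q i) * y i))"
      using c(2) by (simp only: mult_minus_right eq_neg_iff_add_eq_0)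
    moreover have "- (\<Sum>i<Suc n. ev t (q i) * y i) \<in> W"
      using y by (intro negW sumW evW) auto
    ultimately show "\<exists>\<alpha>. (\<exists>i<Suc n. \<alpha> i \<noteq> 0) \<and> (\<exists>w\<in>W. (\<Sum>i<Suc n. \<kappa> (\<alpha> i) * y i) = t * w)"
      using c(1) by (intro exI[of _ "\<lambda>i. coeff (c i) 0"]) blast
  qed
  moreover have "\<not> Q 0" by (simp add: Q_def)
  ultimately obtain k where k: "k < Suc n" "\<not> Q k" "Q (Suc k)"
    using ex_least_nat_less[of Q "Suc n"] by (auto simp del: not_all)
  then obtain y where y: "\<And>i. i < k \<Longrightarrow> y i \<in> W"
    and indep: "\<And>\<alpha> w. \<exists>i<k. \<alpha> i \<noteq> 0 \<Longrightarrow> w \<in> W \<Longrightarrow> (\<Sum>i<k. \<kappa> (\<alpha> i) * y i) \<noteq> t * w"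
    unfolding Q_def by blast
  define comb where "comb \<alpha> = (\<Sum>i<k. \<kappa> (\<alpha> i) * y i)" for \<alpha>
  let ?P = "PiE {..<k} (\<lambda>_. UNIV :: 'f set)"
  show ?thesis
  proof (intro exI[of _ "comb ` ?P"] conjI ballI)
    show "comb ` ?P \<subseteq> W" unfolding comb_def by (auto intro!: sumW W y)
    have fin: "finite ?P" by (intro finite_PiE) auto
    then show "finite (comb ` ?P)" by simp
    have "CARD('f) ^ k \<le> CARD('f) ^ n" using k(1) by (intro power_increasing) (auto simp: Suc_le_eq)
    moreover have "card ?P = CARD('f) ^ k" by (simp add: card_PiE)
    ultimately show "card (comb ` ?P) \<le> CARD('f) ^ n" using card_image_le[OF fin, of comb] by linarith
    fix x assume x: "x \<in> W"
    have "\<forall>i<Suc k. (y(k := x)) i \<in> W" using y x by auto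
    with spec[OF k(3)[unfolded Q_def], of "y(k := x)"] have "\<exists>\<alpha>. (\<exists>i<Suc k. \<alpha> i \<noteq> 0) \<and> (\<exists>w\<in>W. (\<Sum>i<Suc k. \<kappa> (\<alpha> i) * (y(k := x)) i) = t * w)"
      by (rule mp)
    then obtain \<alpha> w where \<alpha>: "\<exists>i<Suc k. \<alpha> i \<noteq> 0" and w: "w \<in> W" and
      "(\<Sum>i<Suc k. \<kappa> (\<alpha> i) * (y(k := x)) i) = t * w"
      by blast
    then have sum: "(\<Sum>i<k. \<kappa> (\<alpha> i) * y i) + \<kappa> (\<alpha> k) * x = t * w" by simp
    have ak: "\<alpha> k \<noteq> 0"
    proof
      assume "\<alpha> k = 0"
      then have "\<exists>i<k. \<alpha> i \<noteq> 0" "(\<Sum>i<k. \<kappa> (\<alpha> i) * y i) = t * w"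
        using \<alpha> sum by (auto simp: less_Suc_eq)
      then show False using indep w by blast
    qed
    let ?e = "comb (restrict (\<lambda>i. - (inverse (\<alpha> k) * \<alpha> i)) {..<k})"
    have "\<kappa> (inverse (\<alpha> k)) * \<kappa> (\<alpha> k) = 1" using ak by (simp flip: \<kappa>_mult)
    then have "x = \<kappa> (inverse (\<alpha> k)) * (\<kappa> (\<alpha> k) * x)" by (metis mult.assoc mult_1)
    also have "\<kappa> (\<alpha> k) * x = t * w - (\<Sum>i<k. \<kappa> (\<alpha> i) * y i)" using sum by (simp add: algebra_simps)
    also have "\<kappa> (inverse (\<alpha> k)) * \<dots> = ?e + t * (\<kappa> (inverse (\<alpha> k)) * w)"
      by (simp add: comb_def \<kappa>_uminus \<kappa>_mult sum_negf sum_distrib_left algebra_simps)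
    finally have "x = ?e + t * (\<kappa> (inverse (\<alpha> k)) * w)" .
    moreover have "?e \<in> comb ` ?P" by (intro imageI PiE_I) auto
    ultimately show "\<exists>e\<in>comb ` ?P. \<exists>w\<in>W. x = e + t * w"
      using W(2)[OF w] by (intro bexI)
  qed
qed

text \<open>Iterated t-adic expansion: \<open>W\<close> modulo the k-th power of \<open>t\<close>
  has at most q^(n k) classes, q being the number of constants.\<close>

lemma residue_cover_power:
  assumes t: "t \<noteq> 0" and n: "\<And>y. dep t (Suc n) y"
    and W: "\<And>x y. x \<in> W \<Longrightarrow> y \<in> W \<Longrightarrow> x + y \<in> W" "\<And>a x. x \<in> W \<Longrightarrow> \<kappa> a * x \<in> W"
      "\<And>x. x \<in> W \<Longrightarrow> t * x \<in> W" "0 \<in> W"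
  shows "\<exists>E\<subseteq>W. finite E \<and> card E \<le> CARD('f) ^ (n * k) \<and> (\<forall>x\<in>W. \<exists>e\<in>E. \<exists>w\<in>W. x = e + t ^ k * w)"
proof (induction k)
  case 0
  show ?case using W(4) by (intro exI[of _ "{0}"]) auto
next
  case (Suc k)
  obtain E where E: "E \<subseteq> W" "finite E" "card E \<le> CARD('f) ^ n" "\<And>x. x \<in> W \<Longrightarrow> \<exists>e\<in>E. \<exists>w\<in>W. x = e + t * w"
    using residue_cover[OF t n W] by blast
  obtain F where F: "F \<subseteq> W" "finite F" "card F \<le> CARD('f) ^ (n * k)"
    "\<And>x. x \<in> W \<Longrightarrow> \<exists>e\<in>F. \<exists>w\<in>W. x = e + t ^ k * w"
    using Suc.IH by blast
  have tW: "t ^ l * x \<in> W" if "x \<in> W" for l x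
    using that by (induction l) (auto simp: mult.assoc intro: W)
  let ?g = "\<lambda>(f, e). f + t ^ k * e"
  show ?case
  proof (intro exI[of _ "?g ` (F \<times> E)"] conjI ballI)
    have "f + t ^ k * e \<in> W" if "f \<in> F" "e \<in> E" for f e
      using that F(1) E(1) by (intro W(1) tW) auto
    then show "?g ` (F \<times> E) \<subseteq> W" by auto
    show "finite (?g ` (F \<times> E))" using F E by simp
    have "card (?g ` (F \<times> E)) \<le> card F * card E"
      using card_image_le[of "F \<times> E" ?g] F E by (simp add: card_cartesian_product)
    also have "\<dots> \<le> CARD('f) ^ (n * k) * CARD('f) ^ n" using F E by (intro mult_mono) auto
    also have "\<dots> = CARD('f) ^ (n * Suc k)" by (simp add: power_add)
    finally show "card (?g ` (F \<times> E)) \<le> CARD('f) ^ (n * Suc k)" .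
    fix x assume "x \<in> W"
    then obtain f w where f: "f \<in> F" "w \<in> W" "x = f + t ^ k * w" using F(4) by blast
    then obtain e w' where e: "e \<in> E" "w' \<in> W" "w = e + t * w'" using E(4) by blast
    have "x = ?g (f, e) + t ^ Suc k * w'" using f e by (simp add: algebra_simps)
    then show "\<exists>e\<in>?g ` (F \<times> E). \<exists>w\<in>W. x = e + t ^ Suc k * w" using f e by blast
  qed
qed

end

section \<open>Existence of valuations\<close>

context function_field_over begin

definition subalgebra :: "'k \<Rightarrow> 'k set \<Rightarrow> bool" where
  "subalgebra t S \<longleftrightarrow> range \<kappa> \<subseteq> S \<and> t \<in> S \<and> (\<forall>x\<in>S. \<forall>y\<in>S. x + y \<in> S \<and> x * y \<in> S)"

lemma subalgebraD:
  assumes "subalgebra t S"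
  shows "\<kappa> a \<in> S" "t \<in> S" "x \<in> S \<Longrightarrow> y \<in> S \<Longrightarrow> x + y \<in> S" "x \<in> S \<Longrightarrow> y \<in> S \<Longrightarrow> x * y \<in> S"
    "0 \<in> S" "1 \<in> S" "x \<in> S \<Longrightarrow> - x \<in> S" "x \<in> S \<Longrightarrow> x ^ n \<in> S"
proof -
  show \<kappa>: "\<kappa> a \<in> S" for a using assms by (auto simp: subalgebra_def)
  show "t \<in> S" using assms by (simp add: subalgebra_def)
  show "x \<in> S \<Longrightarrow> y \<in> S \<Longrightarrow> x + y \<in> S" using assms by (simp add: subalgebra_def)
  show m: "x \<in> S \<Longrightarrow> y \<in> S \<Longrightarrow> x * y \<in> S" for x y using assms by (simp add: subalgebra_def)
  show "0 \<in> S" "1 \<in> S" using \<kappa>[of 0] \<kappa>[of 1] by simp_all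
  show "x \<in> S \<Longrightarrow> - x \<in> S" using m[OF \<kappa>[of "-1"], of x] by (simp add: \<kappa>_uminus)
  show "x \<in> S \<Longrightarrow> x ^ n \<in> S" using \<kappa>[of 1] by (induction n) (auto intro: m)
qed

lemma subalgebra_sum:
  assumes "subalgebra t S" "\<And>i. i \<in> I \<Longrightarrow> f i \<in> S" shows "sum f I \<in> S"
  using assms(2) by (induction I rule: infinite_finite_induct) (auto intro: subalgebraD[OF assms(1)])

lemma subalgebra_ev: "subalgebra t S \<Longrightarrow> ev t p \<in> S"
  by (rule ev_closed) (auto intro: subalgebraD)

text \<open>A subring that is maximal among those in which \<open>t\<close> is not invertible is a valuation ring.\<close>

lemma ex_maximal_subalgebra:
  assumes t: "transc t"
  shows "\<exists>A. subalgebra t A \<and> inverse t \<notin> A \<and>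
    (\<forall>S. subalgebra t S \<longrightarrow> A \<subseteq> S \<longrightarrow> inverse t \<notin> S \<longrightarrow> S = A)"
proof -
  let ?\<A> = "{S. subalgebra t S \<and> inverse t \<notin> S}"
  have "\<exists>A\<in>?\<A>. \<forall>S\<in>?\<A>. A \<subseteq> S \<longrightarrow> S = A"
  proof (rule subset_Zorn_nonempty)
    have "subalgebra t (range (ev t))"
      unfolding subalgebra_def
    proof (intro conjI ballI subsetI)
      fix x assume "x \<in> range \<kappa>"
      then obtain a where "x = \<kappa> a" by blast
      then have "x = ev t [:a:]" by simp
      then show "x \<in> range (ev t)" by (rule range_eqI)
    next
      have "t = ev t [:0, 1:]" by simp
      then show "t \<in> range (ev t)" by (rule range_eqI)
    next
      fix x y assume "x \<in> range (ev t)" "y \<in> range (ev t)"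
      then show "x + y \<in> range (ev t)" "x * y \<in> range (ev t)"
        by (auto simp flip: ev_add ev_mult)
    qed
    moreover have "inverse t \<notin> range (ev t)"
    proof
      assume "inverse t \<in> range (ev t)"
      then obtain p where "inverse t = ev t p" by blast
      then have "ev t (pCons (-1) p) = 0"
        using transc_nonzero[OF t] by (simp add: \<kappa>_uminus flip: \<open>inverse t = ev t p\<close>)
      then have "pCons (-1) p = 0" by (simp only: transcD[OF t])
      then show False by simp
    qed
    ultimately show "?\<A> \<noteq> {}" by blast
  next
    fix C assume C: "C \<noteq> {}" "subset.chain ?\<A> C"
    then have sub: "\<And>S. S \<in> C \<Longrightarrow> subalgebra t S \<and> inverse t \<notin> S"
      and tot: "\<And>S T. S \<in> C \<Longrightarrow> T \<in> C \<Longrightarrow> S \<subseteq> T \<or> T \<subseteq> S"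
      by (auto simp: subset_chain_def)
    obtain S0 where S0: "S0 \<in> C" using C(1) by blast
    have "subalgebra t (\<Union>C)"
      unfolding subalgebra_def
    proof (intro conjI ballI)
      show "range \<kappa> \<subseteq> \<Union>C" "t \<in> \<Union>C"
        using sub[OF S0] S0 by (auto simp: subalgebra_def)
      fix x y assume "x \<in> \<Union>C" "y \<in> \<Union>C"
      then obtain S T where "S \<in> C" "x \<in> S" "T \<in> C" "y \<in> T" by blast
      then obtain S where S: "S \<in> C" "x \<in> S" "y \<in> S" using tot by blast
      then have "x + y \<in> S" "x * y \<in> S" using sub by (auto intro: subalgebraD)
      then show "x + y \<in> \<Union>C" "x * y \<in> \<Union>C" using S(1) by auto
    qed
    then show "\<Union>C \<in> ?\<A>" using sub by auto
  qed
  then show ?thesis by blast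
qed

section \<open>The maximal subalgebra is a discrete valuation ring\<close>

context
  fixes t A
  assumes t: "transc t" and A: "subalgebra t A" and tA: "inverse t \<notin> A"
    and max: "\<forall>S. subalgebra t S \<longrightarrow> A \<subseteq> S \<longrightarrow> inverse t \<notin> S \<longrightarrow> S = A"
begin

lemmas A_closed = subalgebraD[OF A]

lemma t_nonzero: "t \<noteq> 0"
  by (rule transc_nonzero[OF t])

lemma t_mult_not_1: "x \<in> A \<Longrightarrow> t * x \<noteq> 1"
  using tA inverse_unique by metis

text \<open>Maximality puts t A into the Jacobson radical. The powers of \<open>1 - t * a\<close>
  are congruent to 1 modulo t A, so inverting \<open>1 - t * a\<close> cannot make \<open>t\<close>
  invertible, and the localization equals \<open>A\<close>.\<close>

lemma inverse_one_minus:
  assumes a: "a \<in> A" shows "1 - t * a \<noteq> 0" "inverse (1 - t * a) \<in> A"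
proof -
  define d where "d = 1 - t * a"
  have d0: "d \<noteq> 0" using t_mult_not_1[OF a] by (auto simp: d_def)
  have dA: "d \<in> A" using A_closed(3)[OF A_closed(6) A_closed(7)[OF A_closed(4)[OF A_closed(2) a]]]
    by (simp add: d_def)
  define S where "S = {x. \<exists>k::nat. x * d ^ k \<in> A}"
  have AS: "A \<subseteq> S" unfolding S_def by (auto intro!: exI[of _ 0])
  have "subalgebra t S"
    unfolding subalgebra_def
  proof (intro conjI ballI)
    show "range \<kappa> \<subseteq> S" "t \<in> S" using AS A_closed by auto
    fix x y assume "x \<in> S" "y \<in> S"
    then obtain k l where kl: "x * d ^ k \<in> A" "y * d ^ l \<in> A" by (auto simp: S_def)
    have "(x + y) * d ^ (k + l) = x * d ^ k * d ^ l + y * d ^ l * d ^ k"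
      by (simp add: power_add algebra_simps)
    also have "\<dots> \<in> A" by (intro A_closed(3) A_closed(4)[OF kl(1)] A_closed(4)[OF kl(2)] A_closed(8) dA)
    finally show "x + y \<in> S" unfolding S_def by blast
    have "(x * y) * d ^ (k + l) = x * d ^ k * (y * d ^ l)"
      by (simp add: power_add algebra_simps)
    also have "\<dots> \<in> A" by (rule A_closed(4)[OF kl])
    finally show "x * y \<in> S" unfolding S_def by blast
  qed
  moreover have "inverse t \<notin> S"
  proof
    assume "inverse t \<in> S"
    then obtain k where k: "inverse t * d ^ k \<in> A" by (auto simp: S_def)
    have "\<exists>e\<in>A. d ^ k = 1 - t * e"
    proof (induction k)
      case 0
      show ?case using A_closed(5) by (intro bexI[of _ 0]) auto
    next
      case (Suc k)
      then obtain e where e: "e \<in> A" "d ^ k = 1 - t * e" by blast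
      have "d ^ Suc k = 1 - t * (e + a * d ^ k)" using e by (simp add: d_def algebra_simps)
      moreover have "e + a * d ^ k \<in> A" using e a dA by (intro A_closed)
      ultimately show ?case by blast
    qed
    then obtain e where e: "e \<in> A" "d ^ k = 1 - t * e" by blast
    have "t * (inverse t * d ^ k) = d ^ k" using t_nonzero by simp
    then have "t * (inverse t * d ^ k + e) = 1"
      using e(2) by (simp only: distrib_left) simp
    then show False using t_mult_not_1 A_closed(3)[OF k e(1)] by blast
  qed
  ultimately have "S = A" using max AS by blast
  moreover have "inverse d \<in> S"
    unfolding S_def using d0 A_closed(6) by (intro CollectI exI[of _ 1]) simp
  ultimately show "1 - t * a \<noteq> 0" "inverse (1 - t * a) \<in> A" using d0 by (simp_all add: d_def)
qed

text \<open>A[x] is strictly larger than \<open>A\<close>, so by maximality it contains the inverse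
  of \<open>t\<close>.\<close>

lemma ex_rep:
  assumes "x \<notin> A"
  shows "\<exists>m a. (\<forall>i. a i \<in> A) \<and> t * (\<Sum>i\<le>m. a i * x ^ i) = 1"
proof -
  define S where "S = (\<lambda>p. poly p x) ` {p. \<forall>i. coeff p i \<in> A}"
  have AS: "A \<subseteq> S"
  proof
    fix a assume "a \<in> A"
    then show "a \<in> S" unfolding S_def using A_closed(5)
      by (intro image_eqI[of _ _ "[:a:]"]) (auto simp: coeff_pCons split: nat.split)
  qed
  have "x \<in> S" unfolding S_def using A_closed(5,6)
    by (intro image_eqI[of _ _ "[:0, 1:]"]) (auto simp: coeff_pCons split: nat.split)
  have "subalgebra t S"
    unfolding subalgebra_def
  proof (intro conjI ballI)
    show "range \<kappa> \<subseteq> S" "t \<in> S" using AS A_closed by auto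
    fix y z assume "y \<in> S" "z \<in> S"
    then obtain p q where pq: "\<And>i. coeff p i \<in> A" "y = poly p x" "\<And>i. coeff q i \<in> A" "z = poly q x"
      by (auto simp: S_def)
    show "y + z \<in> S" unfolding S_def using pq
      by (intro image_eqI[of _ _ "p + q"]) (auto intro: A_closed)
    show "y * z \<in> S" unfolding S_def using pq
      by (intro image_eqI[of _ _ "p * q"]) (auto simp: coeff_mult intro!: A_closed subalgebra_sum[OF A])
  qed
  then have "inverse t \<in> S" using max AS \<open>x \<in> S\<close> assms by blast
  then obtain p where p: "\<forall>i. coeff p i \<in> A" "inverse t = poly p x" by (auto simp: S_def)
  have "t * (\<Sum>i\<le>degree p. coeff p i * x ^ i) = 1"
    using t_nonzero by (simp flip: p(2) poly_altdef)
  then show ?thesis using p(1) by blast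
qed

text \<open>Chevalley's degree reduction. As \<open>1 - t * b 0\<close> is a unit, the relation in
  1/x, multiplied by \<open>x ^ Suc m\<close>, expresses this top power through lower ones; the
  bound on \<open>l\<close> keeps the exponents nonnegative.\<close>

lemma rep_reduce:
  assumes a: "\<And>i. a i \<in> A" "t * (\<Sum>i\<le>Suc m. a i * x ^ i) = 1"
    and b: "\<And>i. b i \<in> A" "t * (\<Sum>i\<le>l. b i * inverse x ^ i) = 1"
    and le: "l \<le> Suc m" and x: "x \<noteq> 0"
  shows "\<exists>c. (\<forall>i. c i \<in> A) \<and> t * (\<Sum>i\<le>m. c i * x ^ i) = 1"
proof -
  define e where "e = inverse (1 - t * b 0)"
  have e: "e \<in> A" "e * (1 - t * b 0) = 1" using inverse_one_minus[OF b(1)] by (simp_all add: e_def)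
  define c where "c i = a i + t * a (Suc m) * (e * (if Suc m - i \<le> l then b (Suc m - i) else 0))" for i
  have "(\<Sum>i\<le>l. b i * inverse x ^ i) = b 0 + (\<Sum>i\<in>{1..l}. b i * inverse x ^ i)"
  proof -
    have "{..l} = insert 0 {1..l}" by auto
    then show ?thesis by simp
  qed
  then have "t * (\<Sum>i\<in>{1..l}. b i * inverse x ^ i) = 1 - t * b 0"
    using b(2) by (simp add: algebra_simps)
  then have "x ^ Suc m = e * (t * (\<Sum>i\<in>{1..l}. b i * inverse x ^ i)) * x ^ Suc m"
    using e(2) by simp
  also have "\<dots> = e * t * (\<Sum>i\<in>{1..l}. b i * (inverse x ^ i * x ^ Suc m))"
    by (simp only: sum_distrib_left sum_distrib_right ac_simps)
  also have "(\<Sum>i\<in>{1..l}. b i * (inverse x ^ i * x ^ Suc m)) = (\<Sum>i\<in>{1..l}. b i * x ^ (Suc m - i))"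
  proof (intro sum.cong refl)
    fix i assume "i \<in> {1..l}"
    then have "x ^ Suc m = x ^ i * x ^ (Suc m - i)" using le by (simp flip: power_add)
    moreover have "inverse x ^ i * x ^ i = 1" using x by (simp flip: power_mult_distrib)
    ultimately show "b i * (inverse x ^ i * x ^ Suc m) = b i * x ^ (Suc m - i)"
      by (simp only: mult.assoc[symmetric]) simp
  qed
  also have "\<dots> = (\<Sum>i\<le>m. (if Suc m - i \<le> l then b (Suc m - i) else 0) * x ^ i)"
  proof -
    have "(\<Sum>i\<le>m. (if Suc m - i \<le> l then b (Suc m - i) else 0) * x ^ i) =
        (\<Sum>i\<in>{i. i \<le> m \<and> Suc m - i \<le> l}. b (Suc m - i) * x ^ i)"
      by (intro sum.mono_neutral_cong_right) auto
    also have "\<dots> = (\<Sum>i\<in>{1..l}. b i * x ^ (Suc m - i))"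
      using le by (intro sum.reindex_bij_witness[of _ "\<lambda>i. Suc m - i" "\<lambda>i. Suc m - i"]) auto
    finally show ?thesis ..
  qed
  finally have xm: "x ^ Suc m = e * t * (\<Sum>i\<le>m. (if Suc m - i \<le> l then b (Suc m - i) else 0) * x ^ i)" .
  let ?b = "\<lambda>i. if Suc m - i \<le> l then b (Suc m - i) else 0"
  have "c i * x ^ i = a i * x ^ i + a (Suc m) * (e * t * (?b i * x ^ i))" for i
    unfolding c_def distrib_right by (simp only: ac_simps)
  then have "(\<Sum>i\<le>m. c i * x ^ i) = (\<Sum>i\<le>m. a i * x ^ i) + a (Suc m) * (e * t * (\<Sum>i\<le>m. ?b i * x ^ i))"
    by (simp only: sum_distrib_left sum.distrib)
  also have "\<dots> = (\<Sum>i\<le>Suc m. a i * x ^ i)" unfolding xm[symmetric] by simp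
  finally have "t * (\<Sum>i\<le>m. c i * x ^ i) = 1" using a(2) by simp
  moreover have "c i \<in> A" for i unfolding c_def using a(1) b(1) e(1) by (auto intro!: A_closed)
  ultimately show ?thesis by blast
qed

text \<open>If \<open>x\<close> and 1/x were both outside \<open>A\<close>, each would have a
  representation of least degree, and \<open>rep_reduce\<close> would shorten the one that is not
  the shorter of the two. Degree 0 cannot occur because \<open>t\<close> is not invertible in
  \<open>A\<close>.\<close>

lemma valuation_ring: "x \<in> A \<or> inverse x \<in> A"
proof (rule ccontr)
  assume n: "\<not> ?thesis"
  then have x: "x \<noteq> 0" using A_closed(5) by auto
  define Rep where "Rep y m \<longleftrightarrow> (\<exists>a. (\<forall>i. a i \<in> A) \<and> t * (\<Sum>i\<le>m. a i * y ^ i) = 1)" for y m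
  define mm where "mm y = (LEAST m. Rep y m)" for y
  have ex: "\<exists>m. Rep y m" if "y \<notin> A" for y
    using ex_rep[OF that] by (simp add: Rep_def)
  have R: "Rep y (mm y)" if "y \<notin> A" for y
    unfolding mm_def using ex[OF that] by (rule LeastI_ex)
  have R2: "mm y \<le> m" if "Rep y m" for y m
    unfolding mm_def using that by (rule Least_le)
  have R0: "\<not> Rep y 0" for y using t_mult_not_1 by (auto simp: Rep_def)
  have "\<not> mm (inverse y) \<le> mm y" if y: "y \<notin> A" "inverse y \<notin> A" "y \<noteq> 0" for y
  proof
    assume le: "mm (inverse y) \<le> mm y"
    obtain m where m: "mm y = Suc m" using R[OF y(1)] R0 by (cases "mm y") auto
    obtain a where a: "\<forall>i. a i \<in> A" "t * (\<Sum>i\<le>Suc m. a i * y ^ i) = 1"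
      using R[OF y(1)] unfolding m Rep_def by blast
    obtain b where b: "\<forall>i. b i \<in> A" "t * (\<Sum>i\<le>mm (inverse y). b i * inverse y ^ i) = 1"
      using R[OF y(2)] unfolding Rep_def by blast
    have "Rep y m" unfolding Rep_def
      by (rule rep_reduce[OF _ a(2) _ b(2)]) (use a b le m y in auto)
    then show False using R2 m by fastforce
  qed
  from this[of x] this[of "inverse x"] show False using n x by simp
qed

lemma ev_unit:
  assumes "coeff p 0 \<noteq> 0" shows "ev t p \<noteq> 0" "inverse (ev t p) \<in> A"
proof -
  obtain a q where p: "p = pCons a q" by (cases p)
  then have a: "a \<noteq> 0" using assms by simp
  have \<kappa>a: "\<kappa> (inverse a) * \<kappa> a = 1" using a by (simp flip: \<kappa>_mult)
  define f where "f = - (\<kappa> (inverse a) * ev t q)"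
  have f: "f \<in> A" unfolding f_def by (intro A_closed subalgebra_ev[OF A])
  have "\<kappa> a * (1 - t * f) = \<kappa> a + t * ((\<kappa> (inverse a) * \<kappa> a) * ev t q)"
    by (simp add: f_def algebra_simps)
  then have eq: "ev t p = \<kappa> a * (1 - t * f)" unfolding \<kappa>a p by simp
  show "ev t p \<noteq> 0" unfolding eq using inverse_one_minus(1)[OF f] a by simp
  have "inverse (\<kappa> a) = \<kappa> (inverse a)" using \<kappa>a by (metis inverse_unique mult.commute)
  then show "inverse (ev t p) \<in> A" unfolding eq inverse_mult_distrib
    using inverse_one_minus(2)[OF f] by (simp only:) (intro A_closed)
qed

lemma ev_divides_power:
  assumes "p \<noteq> 0" shows "\<exists>k. t ^ k * inverse (ev t p) \<in> A"
  using assms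
proof (induction p)
  case (pCons a p)
  show ?case
  proof (cases "a = 0")
    case True
    then obtain k where "t ^ k * inverse (ev t p) \<in> A" using pCons by auto
    moreover have "t ^ Suc k * inverse (ev t (pCons a p)) = t ^ k * inverse (ev t p)"
      using True t_nonzero by simp
    ultimately show ?thesis by (intro exI[of _ "Suc k"]) (simp only:)
  next
    case False
    then show ?thesis using ev_unit(2)[of "pCons a p"] by (intro exI[of _ 0]) simp
  qed
qed simp

text \<open>In an algebraic relation for \<open>x\<close> over \<kappa>[t], all terms beyond the
  lowest contain a further factor \<open>x\<close>. Hence \<open>x\<close> divides the lowest
  coefficient, a nonzero polynomial in \<open>t\<close>, which divides a power of \<open>t\<close>
  by \<open>ev_divides_power\<close>. This gives the valuation ring rank one.\<close>

lemma divides_power_t: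
  assumes x: "x \<in> A" "x \<noteq> 0" shows "\<exists>k. t ^ k * inverse x \<in> A"
proof -
  obtain M where "dep t M (\<lambda>i. x ^ i)" using ex_dep[OF t] by blast
  then obtain c where c: "\<exists>i<M. c i \<noteq> 0" "(\<Sum>i<M. ev t (c i) * x ^ i) = 0" by (auto simp: dep_def)
  define m where "m = (LEAST i. i < M \<and> c i \<noteq> 0)"
  have m: "m < M" "c m \<noteq> 0" using LeastI_ex[of "\<lambda>i. i < M \<and> c i \<noteq> 0"] c(1) by (auto simp: m_def)
  have less: "c i = 0" if "i < m" for i
    using not_less_Least[of i "\<lambda>i. i < M \<and> c i \<noteq> 0"] that m(1) by (auto simp: m_def)
  define y where "y = (\<Sum>i\<in>{Suc m..<M}. ev t (c i) * x ^ (i - Suc m))"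
  have yA: "y \<in> A" unfolding y_def by (intro subalgebra_sum[OF A] A_closed subalgebra_ev[OF A] x)
  have "(\<Sum>i<M. ev t (c i) * x ^ i) = (\<Sum>i\<in>{m..<M}. ev t (c i) * x ^ i)"
    using less by (intro sum.mono_neutral_right) (auto simp: not_le)
  also have "\<dots> = ev t (c m) * x ^ m + (\<Sum>i\<in>{Suc m..<M}. ev t (c i) * x ^ i)"
    using m(1) by (simp add: sum.atLeast_Suc_lessThan)
  also have "(\<Sum>i\<in>{Suc m..<M}. ev t (c i) * x ^ i) = x ^ m * (x * y)"
  proof -
    have "x ^ i = x ^ m * (x * x ^ (i - Suc m))" if "Suc m \<le> i" for i
      using that by (metis power_Suc power_add le_add_diff_inverse add_Suc_right add_Suc)
    then show ?thesis unfolding y_def sum_distrib_left by (intro sum.cong refl) (simp add: ac_simps)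
  qed
  finally have "x ^ m * (ev t (c m) + x * y) = 0" using c(2) by (simp add: algebra_simps)
  then have eq: "ev t (c m) = x * (- y)" using x(2) by (simp add: eq_neg_iff_add_eq_0)
  obtain k where k: "t ^ k * inverse (ev t (c m)) \<in> A" using ev_divides_power[OF m(2)] by blast
  have "ev t (c m) \<noteq> 0" using m(2) transcD[OF t] by simp
  then have "t ^ k * inverse x = t ^ k * inverse (ev t (c m)) * (- y)"
    unfolding eq using x(2) by (simp add: field_simps)
  also have "\<dots> \<in> A" using k A_closed(7)[OF yA] by (rule A_closed(4))
  finally show ?thesis by blast
qed

text \<open>A / t A is finite, so a principal ideal between t A and \<open>A\<close> is determined
  by its trace, the set of representatives in \<open>E\<close> that it contains. A nonunit divisor
  of \<open>t\<close> with the largest trace generates the maximal ideal, and the traces of its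
  powers decrease strictly as long as these divide \<open>t\<close>, so this must stop.\<close>

lemma ex_uniformizer:
  "\<exists>p. p \<in> A \<and> p \<noteq> 0 \<and> inverse p \<notin> A \<and>
    (\<forall>y. y \<in> A \<longrightarrow> inverse y \<notin> A \<longrightarrow> y / p \<in> A) \<and> (\<exists>k. t / p ^ k \<notin> A)"
proof -
  obtain n where "\<forall>y. dep t (Suc n) y" using ex_basis[OF t] by (elim exE conjE)
  then have n: "dep t (Suc n) y" for y ..
  have "\<exists>E\<subseteq>A. finite E \<and> card E \<le> CARD('f) ^ n \<and> (\<forall>x\<in>A. \<exists>e\<in>E. \<exists>w\<in>A. x = e + t * w)"
    by (rule residue_cover[OF t_nonzero n]) (auto intro: A_closed)
  then obtain E where E: "finite E" "\<And>x. x \<in> A \<Longrightarrow> \<exists>e\<in>E. \<exists>w\<in>A. x = e + t * w" by blast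
  define tr where "tr x = {e\<in>E. e / x \<in> A}" for x
  define X where "X = {x\<in>A. x \<noteq> 0 \<and> inverse x \<notin> A \<and> t / x \<in> A}"
  have trace: "y / x \<in> A" if xy: "tr y \<subseteq> tr x" "x \<in> A" "t / x \<in> A" "y \<in> A" "t / y \<in> A" "y \<noteq> 0" for x y
  proof -
    obtain e w where e: "e \<in> E" "w \<in> A" "y = e + t * w" using E(2)[OF xy(4)] by blast
    have "e / y = 1 + (- (t / y * w))" using e(3) xy(6) by (simp add: field_simps)
    also have "\<dots> \<in> A" by (intro A_closed(3,6,7) A_closed(4)[OF xy(5) e(2)])
    finally have "e / x \<in> A" using e(1) xy(1) by (auto simp: tr_def)
    have "y / x = e / x + t / x * w" using e(3) by (simp add: add_divide_distrib)
    also have "\<dots> \<in> A" by (intro A_closed(3) \<open>e / x \<in> A\<close> A_closed(4)[OF xy(3) e(2)])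
    finally show ?thesis .
  qed
  have tr_mono: "tr y \<subseteq> tr x" if "y / x \<in> A" "y \<noteq> 0" for x y
  proof
    fix e assume "e \<in> tr y"
    then have e: "e \<in> E" "e / y \<in> A" by (auto simp: tr_def)
    have "e / x = e / y * (y / x)" using that by simp
    also have "\<dots> \<in> A" by (rule A_closed(4)[OF e(2) that(1)])
    finally show "e \<in> tr x" using e by (simp add: tr_def)
  qed
  have "t \<in> X" unfolding X_def using A_closed t_nonzero tA by simp
  have bound: "card (tr x) \<le> card E" for x unfolding tr_def by (intro card_mono E) auto
  have fintr: "finite (tr x)" for x unfolding tr_def using E by simp
  obtain p where p: "p \<in> X" "\<And>x. x \<in> X \<Longrightarrow> card (tr x) \<le> card (tr p)"
    using ex_has_greatest_nat[of "\<lambda>x. x \<in> X" t "\<lambda>x. card (tr x)" "Suc (card E)"] \<open>t \<in> X\<close> bound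
    by (metis le_imp_less_Suc)
  have pX: "p \<in> A" "p \<noteq> 0" "inverse p \<notin> A" "t / p \<in> A" using p(1) by (auto simp: X_def)
  have gen: "y / p \<in> A" if y: "y \<in> A" "inverse y \<notin> A" for y
  proof (cases "y = 0")
    case True
    then show ?thesis using A_closed(5) by simp
  next
    case False
    show ?thesis
    proof (rule ccontr)
      assume n: "y / p \<notin> A"
      then have py: "p / y \<in> A" using valuation_ring[of "y / p"] by simp
      have "t / y = t / p * (p / y)" using pX by simp
      also have "\<dots> \<in> A" by (rule A_closed(4)[OF pX(4) py])
      finally have ty: "t / y \<in> A" .
      then have "y \<in> X" using y False by (simp add: X_def)
      moreover have sub: "tr p \<subseteq> tr y" using tr_mono[OF py pX(2)] .
      ultimately have "tr y = tr p" using p(2) fintr by (metis card_seteq)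
      then have "y / p \<in> A" using trace[of y p] y pX ty False by simp
      then show False using n by simp
    qed
  qed
  have "\<exists>k. t / p ^ k \<notin> A"
  proof (rule ccontr)
    assume "\<not> ?thesis"
    then have all: "t / p ^ k \<in> A" for k by blast
    have "card (tr (p ^ k)) + k \<le> card E" for k
    proof (induction k)
      case 0
      show ?case using bound by simp
    next
      case (Suc k)
      have pp: "p ^ Suc k / p ^ k \<in> A" "\<not> p ^ k / p ^ Suc k \<in> A"
        using pX by (simp_all add: field_simps)
      have sub: "tr (p ^ Suc k) \<subseteq> tr (p ^ k)" using pX by (intro tr_mono pp) simp
      have "tr (p ^ Suc k) \<noteq> tr (p ^ k)"
      proof
        assume eq: "tr (p ^ Suc k) = tr (p ^ k)"
        have "p ^ k / p ^ Suc k \<in> A"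
        proof (rule trace)
          show "tr (p ^ k) \<subseteq> tr (p ^ Suc k)" using eq by simp
        qed (use all pX in \<open>auto intro: A_closed simp del: power_Suc\<close>)
        then show False using pp by simp
      qed
      then have "tr (p ^ Suc k) \<subset> tr (p ^ k)" using sub by blast
      then have "card (tr (p ^ Suc k)) < card (tr (p ^ k))" using fintr by (intro psubset_card_mono)
      then show ?case using Suc by linarith
    qed
    from this[of "Suc (card E)"] show False by simp
  qed
  then show ?thesis using pX gen by (intro exI[of _ p]) simp
qed

end

text \<open>The valuation is the exponent of the uniformizer \<open>p\<close>, every nonzero element
  being a unit times a power of \<open>p\<close>.\<close>

lemma ex_valuation:
  assumes t: "transc t"
  shows "\<exists>u. normalized_valuation u \<and> 0 < u t"
proof -
  obtain A where A: "subalgebra t A" and tA: "inverse t \<notin> A"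
    and max: "\<forall>S. subalgebra t S \<longrightarrow> A \<subseteq> S \<longrightarrow> inverse t \<notin> S \<longrightarrow> S = A"
    using ex_maximal_subalgebra[OF t] by (elim exE conjE)
  note [intro] = subalgebraD[OF A]
  note t0 = transc_nonzero[OF t]
  obtain p where p: "p \<in> A" "p \<noteq> 0" "inverse p \<notin> A"
    and gen: "\<forall>y. y \<in> A \<longrightarrow> inverse y \<notin> A \<longrightarrow> y / p \<in> A" and tp: "\<exists>k. t / p ^ k \<notin> A"
    using ex_uniformizer[OF t A tA max] by blast
  note vr = valuation_ring[OF t A tA max]
  define unit where "unit x \<longleftrightarrow> x \<noteq> 0 \<and> x \<in> A \<and> inverse x \<in> A" for x
  have unit_mult: "unit (x * y)" if "unit x" "unit y" for x y
    using that by (auto simp: unit_def)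
  have unit_inverse: "unit (inverse x)" if "unit x" for x
    using that by (auto simp: unit_def)
  have pow_unit: "k = 0" if k: "unit (p powi k)" for k
  proof -
    have *: "\<not> unit (p powi int (Suc m))" for m
    proof
      assume "unit (p powi int (Suc m))"
      then have "inverse (p ^ Suc m) \<in> A" by (simp only: unit_def power_int_of_nat)
      then have "p ^ m * inverse (p ^ Suc m) \<in> A" using p by blast
      then show False using p by (simp add: field_simps)
    qed
    show ?thesis
    proof (cases k rule: int_cases3)
      case (pos m)
      then obtain l where "m = Suc l" using gr0_implies_Suc by blast
      then show ?thesis using k pos * by blast
    next
      case (neg m)
      then obtain l where "m = Suc l" using gr0_implies_Suc by blast
      moreover have "unit (p powi int m)" using unit_inverse[OF k] neg by (simp add: power_int_minus)
      ultimately show ?thesis using * by blast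
    qed
  qed
  have ex1: "\<exists>k. unit (x / p ^ k)" if x: "x \<in> A" "x \<noteq> 0" for x
  proof -
    \<comment> \<open>Some power of \<open>p\<close> is divisible by \<open>t\<close>, so an
      \<open>x\<close> divisible by all powers of \<open>p\<close> is divisible by all powers of
      \<open>t\<close>. But \<open>x\<close> itself divides a power of \<open>t\<close>, and
      \<open>t\<close> would be a unit.\<close>
    have "\<exists>k. x / p ^ k \<notin> A"
    proof (rule ccontr)
      assume "\<not> ?thesis"
      then have all: "x / p ^ k \<in> A" for k by blast
      obtain k where "t / p ^ k \<notin> A" using tp by blast
      then have k: "p ^ k / t \<in> A" using vr[of "t / p ^ k"] by simp
      obtain l where l: "t ^ l * inverse x \<in> A" using divides_power_t[OF t A tA max x] by blast
      have "inverse t = (p ^ k / t) ^ Suc l * (x / p ^ (k * Suc l)) * (t ^ l * inverse x)"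
        using x p t0 by (simp add: field_simps power_mult power_add)
      also have "\<dots> \<in> A" using k all l by blast
      finally show False using tA by simp
    qed
    then obtain k where k: "\<forall>i<k. x / p ^ i \<in> A" "x / p ^ k \<notin> A"
      using exists_least_iff[of "\<lambda>k. x / p ^ k \<notin> A"] by auto
    have "k \<noteq> 0"
    proof
      assume "k = 0"
      then show False using k(2) x by simp
    qed
    then obtain l where l: "k = Suc l" using not0_implies_Suc by blast
    let ?y = "x / p ^ l"
    have y: "?y \<in> A" using k l by simp
    moreover have "inverse ?y \<in> A"
    proof (rule ccontr)
      assume "inverse ?y \<notin> A"
      then have "?y / p \<in> A" using gen y by blast
      then show False using k(2) l by (simp add: mult.commute)
    qed
    ultimately show ?thesis using x p unfolding unit_def by (intro exI[of _ l]) simp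
  qed
  have ex: "\<exists>k. unit (x * p powi (- k))" if x: "x \<noteq> 0" for x
  proof (cases "x \<in> A")
    case True
    then obtain k where "unit (x / p ^ k)" using ex1 x by blast
    then show ?thesis by (intro exI[of _ "int k"]) (simp add: power_int_minus divide_inverse)
  next
    case False
    then obtain k where k: "unit (inverse x / p ^ k)" using ex1[of "inverse x"] vr x by auto
    have "inverse (inverse x / p ^ k) = x * p powi (- (- int k))" using x p by (simp add: field_simps)
    then show ?thesis using unit_inverse[OF k] by metis
  qed
  define u where "u x = (SOME k. unit (x * p powi (- k)))" for x
  have u: "unit (x * p powi (- u x))" if "x \<noteq> 0" for x
    unfolding u_def using ex[OF that] by (rule someI_ex)
  have u_eq: "u x = k" if "unit (x * p powi (- k))" for x k
  proof -
    have x: "x \<noteq> 0" using that by (auto simp: unit_def)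
    have "unit (x * p powi (- k) * inverse (x * p powi (- u x)))"
      by (rule unit_mult[OF that unit_inverse[OF u[OF x]]])
    moreover have "x * p powi (- k) * inverse (x * p powi (- u x)) = p powi (u x - k)"
      using x p by (simp add: power_int_minus power_int_diff field_simps)
    ultimately show ?thesis using pow_unit by fastforce
  qed
  have u_mult: "u (x * y) = u x + u y" if "x \<noteq> 0" "y \<noteq> 0" for x y
  proof (rule u_eq)
    have "x * y * p powi (- (u x + u y)) = (x * p powi (- u x)) * (y * p powi (- u y))"
      using p by (simp add: power_int_add[OF disjI1] power_int_diff power_int_minus field_simps)
    then show "unit (x * y * p powi (- (u x + u y)))" using u that unit_mult by metis
  qed
  have u_nonneg: "0 \<le> u x \<longleftrightarrow> x \<in> A" if x: "x \<noteq> 0" for x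
  proof
    assume "0 \<le> u x"
    then obtain m where m: "u x = int m" by (rule nonneg_int_cases)
    have "x = x * p powi (- u x) * p ^ m" using p m by (simp add: power_int_minus)
    also have "\<dots> \<in> A" using u[OF x] p by (auto simp: unit_def)
    finally show "x \<in> A" .
  next
    assume "x \<in> A"
    then obtain k where "unit (x / p ^ k)" using ex1 x by blast
    then have "u x = int k" by (intro u_eq) (simp add: power_int_minus divide_inverse)
    then show "0 \<le> u x" by simp
  qed
  have u_div: "u (y / x) = u y - u x" if "x \<noteq> 0" "y \<noteq> 0" for x y
    using u_mult[of "y / x" x] that by simp
  have u_add: "min (u x) (u y) \<le> u (x + y)" if "x \<noteq> 0" "y \<noteq> 0" "x + y \<noteq> 0" "u x \<le> u y" for x y
  proof -
    have "y / x \<in> A" using u_nonneg[of "y / x"] u_div that by simp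
    then have "1 + y / x \<in> A" by blast
    moreover have "1 + y / x = (x + y) / x" using that by (simp add: field_simps)
    ultimately have "0 \<le> u (x + y) - u x" using u_nonneg[of "(x + y) / x"] u_div that by simp
    then show ?thesis using that by simp
  qed
  have "normalized_valuation u"
    unfolding normalized_valuation_def
  proof (intro conjI allI impI)
    fix x y :: 'k
    show "u (x * y) = u x + u y" if "x \<noteq> 0 \<and> y \<noteq> 0" using u_mult that by blast
    show "min (u x) (u y) \<le> u (x + y)" if "x \<noteq> 0 \<and> y \<noteq> 0 \<and> x + y \<noteq> 0"
    proof (cases "u x \<le> u y")
      case True
      then show ?thesis using u_add that by blast
    next
      case False
      then have "min (u y) (u x) \<le> u (y + x)" using that by (intro u_add) (auto simp: add.commute)
      then show ?thesis by (simp add: min.commute add.commute)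
    qed
  next
    have "u (p powi k) = k" for k
      using p by (intro u_eq) (auto simp: unit_def simp flip: power_int_add)
    moreover have "p powi k \<in> - {0}" for k using p by simp
    ultimately show "u ` (- {0}) = UNIV" by (metis UNIV_eq_I image_eqI)
  qed
  moreover have "0 < u t"
  proof -
    have "0 \<le> u t" using u_nonneg t0 by blast
    moreover have "u t \<noteq> 0"
    proof
      assume "u t = 0"
      then have "unit t" using u[OF t0] by simp
      then show False using tA by (simp add: unit_def)
    qed
    ultimately show ?thesis by simp
  qed
  ultimately show ?thesis by blast
qed

end

section \<open>The affine ring of a valuation\<close>

lemma val_ge_update: "val_ge (u(0 := a)) m x \<longleftrightarrow> val_ge u m x"
  by (simp add: val_ge_def)

lemma affine_ring_iff:
  "x \<in> affine_ring v \<longleftrightarrow>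
     (\<forall>u. normalized_valuation u \<longrightarrow> (\<exists>y. y \<noteq> 0 \<and> u y \<noteq> v y) \<longrightarrow> val_ge u 0 x)"
  unfolding affine_ring_def val_ge_def by blast

context function_field_over begin

lemma val_ge_ev_degree:
  assumes u: "normalized_valuation u" and z: "val_ge u (- k) z" "0 \<le> k" and p: "degree p \<le> N"
  shows "val_ge u (- (int N * k)) (ev z p)"
  using p
proof (induction N arbitrary: p)
  case 0
  then obtain a where "p = [:a:]" by (auto elim: degree_eq_zeroE)
  then show ?case using val_ge_\<kappa>[OF u] by simp
next
  case (Suc N)
  obtain a r where p: "p = pCons a r" by (cases p)
  then have "degree r \<le> N" using Suc.prems by (cases "r = 0") auto
  then have "val_ge u (- k + - (int N * k)) (z * ev z r)"
    by (intro val_ge_mult[OF u z(1)] Suc.IH)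
  moreover have "- k + - (int N * k) = - (int (Suc N) * k)" by (simp add: algebra_simps)
  moreover have "val_ge u (- (int (Suc N) * k)) (\<kappa> a)"
    by (rule val_ge_mono[OF val_ge_\<kappa>[OF u]]) (use z in simp)
  ultimately show ?case unfolding p by (auto intro: val_ge_add[OF u])
qed

lemma not_dep_scale:
  assumes z: "transc z" and b: "\<not> dep z n b" and d: "\<And>i. i < n \<Longrightarrow> d i \<noteq> 0"
  shows "\<not> dep z n (\<lambda>i. ev z (d i) * b i)"
proof
  assume "dep z n (\<lambda>i. ev z (d i) * b i)"
  then obtain c where c: "\<exists>i<n. c i \<noteq> 0" "(\<Sum>i<n. ev z (c i) * (ev z (d i) * b i)) = 0"
    by (auto simp: dep_def)
  have "(\<Sum>i<n. ev z (c i * d i) * b i) = 0" using c(2) by (simp add: ev_mult mult.assoc)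
  moreover have "\<exists>i<n. c i * d i \<noteq> 0" using c(1) d by auto
  ultimately have "dep z n b" unfolding dep_def by (intro exI[of _ "\<lambda>i. c i * d i"] conjI)
  then show False using b by simp
qed

context
  fixes v :: "'k \<Rightarrow> int"
  assumes v: "normalized_valuation v"
begin

text \<open>A zero at \<open>v\<close> makes 1/x transcendental, hence positive at some valuation.
  There \<open>x\<close> has a pole, and that valuation differs from \<open>v\<close>, so
  \<open>x\<close> is not regular. This will be the discreteness of R.\<close>

lemma affine_val_nonpos:
  assumes x: "x \<in> affine_ring v" "x \<noteq> 0"
  shows "v x \<le> 0"
proof (rule ccontr)
  assume "\<not> v x \<le> 0"
  then have "v (inverse x) \<noteq> 0" using val_inverse[OF v x(2)] by simp
  then have "transc (inverse x)" using transc_if_val[OF v] x(2) by simp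
  then obtain u where u: "normalized_valuation u" "0 < u (inverse x)" using ex_valuation by blast
  then have "u x < 0" using val_inverse[OF u(1) x(2)] by simp
  moreover have "u x \<noteq> v x" using \<open>u x < 0\<close> \<open>\<not> v x \<le> 0\<close> by simp
  then have "val_ge u 0 x" using x u(1) unfolding affine_ring_iff by blast
  ultimately show False using x(2) by (simp add: val_ge_def)
qed

text \<open>Riemann's inequality in disguise: functions with poles bounded by \<open>r\<close> times the zeros of \<open>t\<close>
  are counted against their polar parts at the zeros of \<open>t\<close>; polar parts supported at \<open>v\<close> make
  the difference.\<close>

lemma ex_pole: "\<exists>f\<in>affine_ring v. f \<noteq> 0 \<and> v f < 0"
proof -
  obtain t where t: "t \<noteq> 0" "v t = 1" using val_surj[OF v] by blast
  define s where "s = inverse t"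
  have s0: "s \<noteq> 0" and vs: "u s = - u t" if "normalized_valuation u" for u
    using t val_inverse that by (simp_all add: s_def)
  have tt: "transc t" using transc_if_val[OF v t(1)] t(2) by simp
  have ts: "transc s" using transc_if_val[OF v, of s] t vs[OF v] by (simp add: s_def)
  obtain n b0 where b0: "\<not> dep t n b0" and "\<forall>y. dep t (Suc n) y" using ex_basis[OF tt] by blast
  then have n: "dep t (Suc n) y" for y by blast
  obtain d where d: "\<And>i. d i \<noteq> 0"
    "\<And>i u. normalized_valuation u \<Longrightarrow> val_ge u 0 s \<Longrightarrow> val_ge u 0 (ev s (d i) * b0 i)"
  proof -
    have "\<forall>i. \<exists>d. d \<noteq> 0 \<and> (\<forall>u. normalized_valuation u \<longrightarrow> val_ge u 0 s \<longrightarrow> val_ge u 0 (ev s d * b0 i))"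
      using integral_multiple[OF ts] by blast
    then obtain d where "\<forall>i. d i \<noteq> 0 \<and> (\<forall>u. normalized_valuation u \<longrightarrow> val_ge u 0 s \<longrightarrow> val_ge u 0 (ev s (d i) * b0 i))"
      by (rule choice[THEN exE])
    then show thesis by (intro that[of d]) blast+
  qed
  \<comment> \<open>The \<open>b i\<close> are independent and regular wherever \<open>s\<close> is,
    that is, outside the zeros of \<open>t\<close>. Their poles at these zeros will be bounded by
    \<open>m0\<close> times \<open>t\<close>.\<close>
  define b where "b i = ev s (d i) * b0 i" for i
  have b: "\<not> dep s n b"
    unfolding b_def using dep_inverse[OF tt] ts b0 d(1) by (intro not_dep_scale ts) (auto simp: s_def)
  define U0 where "U0 = {u. normalized_valuation u \<and> u 0 = 0 \<and> 0 < u t}"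
  have finU0: "finite U0" unfolding U0_def by (rule finite_zeros[OF tt])
  have inU0: "u(0 := 0) \<in> U0" if "normalized_valuation u" "0 < u t" for u
    using that t(1) by (simp add: U0_def normalized_valuation_update)
  define m0 where "m0 = (\<Sum>u\<in>U0. \<Sum>i<n. nat \<bar>u (b i)\<bar>)"
  have m0: "val_ge u (- (int m0 * u t)) (b i)" if u: "normalized_valuation u" "0 < u t" and i: "i < n" for u i
  proof -
    let ?u = "u(0 := 0)"
    have "nat \<bar>?u (b i)\<bar> \<le> (\<Sum>i<n. nat \<bar>?u (b i)\<bar>)" using i by (intro member_le_sum) auto
    also have "\<dots> \<le> m0" unfolding m0_def using inU0[OF u] finU0
      by (intro member_le_sum[of ?u U0 "\<lambda>u. \<Sum>i<n. nat \<bar>u (b i)\<bar>"]) auto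
    finally have "- int m0 \<le> ?u (b i)" by linarith
    moreover have "int m0 * 1 \<le> int m0 * u t" using u(2) by (intro mult_left_mono) auto
    ultimately have "val_ge ?u (- (int m0 * u t)) (b i)" by (simp add: val_ge_def)
    then show ?thesis by (simp only: val_ge_update)
  qed
  \<comment> \<open>Among the zeros of \<open>t\<close> the function \<open>z\<close> has a pole at
    \<open>v\<close> only; polynomials in \<open>z\<close> supply the polar parts supported at
    \<open>v\<close>.\<close>
  define S where "S = U0 - {v(0 := 0)}"
  have "\<exists>z. z \<noteq> 0 \<and> v z < 0 \<and> (\<forall>u\<in>S. 0 < u z)"
  proof (rule valuation_approximation[OF v])
    show "finite S" using finU0 by (simp add: S_def)
    fix u assume u: "u \<in> S"
    then show "normalized_valuation u" by (simp add: S_def U0_def)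
    have "u 0 = 0" "u \<noteq> v(0 := 0)" using u by (simp_all add: S_def U0_def)
    show "\<exists>y. y \<noteq> 0 \<and> u y \<noteq> v y"
    proof (rule ccontr)
      assume "\<not> ?thesis"
      then have "u y = (v(0 := 0)) y" for y using \<open>u 0 = 0\<close> by auto
      then show False using \<open>u \<noteq> v(0 := 0)\<close> by blast
    qed
  qed
  then obtain z where z: "z \<noteq> 0" "v z < 0" "\<And>u. u \<in> S \<Longrightarrow> 0 < u z" by blast
  have z_other: "val_ge u 0 z" if u: "normalized_valuation u" "0 < u t" "\<exists>y. y \<noteq> 0 \<and> u y \<noteq> v y" for u
  proof -
    obtain y where y: "y \<noteq> 0" "u y \<noteq> v y" using u(3) by blast
    then have "(u(0 := 0)) y \<noteq> (v(0 := 0)) y" by simp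
    then have "u(0 := 0) \<noteq> v(0 := 0)" by metis
    then have "u(0 := 0) \<in> S" using inU0[OF u(1,2)] by (simp add: S_def)
    from z(3)[OF this] show ?thesis using z(1) by (simp add: val_ge_def)
  qed
  define a where "a = nat (- v z)"
  have a: "int a = - v z" "0 < a" using z(2) by (simp_all add: a_def)
  \<comment> \<open>The count rests on \<open>J > n * m0\<close>: there are q^(n (N + 1) + J) pairs
    in \<open>C\<close> against q^(n (r + 1)) classes, with \<open>r = N + m0\<close>. The choice
    \<open>N = a * J\<close> lets polynomials of degree \<open>J\<close> in \<open>z\<close>, with
    poles of order at most \<open>a * J\<close> at \<open>v\<close>, fit under the bound
    \<open>r\<close>.\<close>
  define J where "J = n * m0 + 1"
  define N where "N = a * J"
  define r where "r = N + m0"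
  define W where "W = {x. \<forall>u. normalized_valuation u \<longrightarrow> 0 < u t \<longrightarrow> val_ge u 0 x}"
  have WD: "val_ge u 0 x" if "x \<in> W" "normalized_valuation u" "0 < u t" for x u
    using that by (simp add: W_def)
  have "\<exists>E\<subseteq>W. finite E \<and> card E \<le> CARD('f) ^ (n * Suc r) \<and> (\<forall>x\<in>W. \<exists>e\<in>E. \<exists>w\<in>W. x = e + t ^ Suc r * w)"
  proof (rule residue_cover_power[OF t(1) n])
    show "x + y \<in> W" if "x \<in> W" "y \<in> W" for x y
      using that by (simp add: W_def val_ge_add)
    show "\<kappa> c * x \<in> W" if "x \<in> W" for c x
      using that by (simp add: W_def val_ge_mult0 val_ge_\<kappa>)
    show "t * x \<in> W" if "x \<in> W" for x
      using that by (auto simp: W_def intro!: val_ge_mult0) (simp add: val_ge_def)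
  qed (simp add: W_def)
  then obtain E where E: "finite E" "card E \<le> CARD('f) ^ (n * Suc r)"
    "\<And>x. x \<in> W \<Longrightarrow> \<exists>e\<in>E. \<exists>w\<in>W. x = e + t ^ Suc r * w" by blast
  define C where "C = PiE {..<n} (\<lambda>_. {p :: 'f poly. degree p \<le> N}) \<times> {p :: 'f poly. degree p \<le> J - 1}"
  define F where "F c = (\<Sum>i<n. ev s (c i) * b i)" for c
  \<comment> \<open>\<open>pCons 0\<close> removes the constant term, so a nonzero difference of the
    second components yields a true pole at \<open>v\<close>. After multiplication by
    \<open>t ^ r\<close>, classes modulo \<open>t ^ Suc r\<close> record the polar parts and the
    values at the zeros of \<open>t\<close>.\<close>
  define \<Phi> where "\<Phi> = (\<lambda>(c, \<epsilon>). t ^ r * (F c - ev z (pCons 0 \<epsilon>)))"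
  have \<Phi>W: "\<Phi> x \<in> W" if x: "x \<in> C" for x
  proof -
    obtain c \<epsilon> where x_eq: "x = (c, \<epsilon>)" by (cases x)
    then have c: "\<And>i. i < n \<Longrightarrow> degree (c i) \<le> N" and \<epsilon>: "degree \<epsilon> \<le> J - 1" using x by (auto simp: C_def)
    have \<epsilon>': "degree (pCons 0 \<epsilon>) \<le> J" using \<epsilon> by (auto simp: degree_pCons_eq_if J_def)
    have "val_ge u 0 (t ^ r * (F c - ev z (pCons 0 \<epsilon>)))" if u: "normalized_valuation u" "0 < u t" for u
    proof -
      have tr: "val_ge u (int r * u t) (t ^ r)"
        using t(1) u(1) by (intro val_ge_power u(1)) (simp add: val_ge_def)
      have "val_ge u (- (int N * u t) + - (int m0 * u t)) (ev s (c i) * b i)" if i: "i < n" for i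
        using u c[OF i] m0[OF u i] by (intro val_ge_mult val_ge_ev_degree) (auto simp: val_ge_def vs)
      then have "val_ge u (- (int r * u t)) (F c)"
        unfolding F_def r_def by (intro val_ge_sum u(1)) (simp add: algebra_simps)
      moreover have "val_ge u (- (int r * u t)) (ev z (pCons 0 \<epsilon>))"
      proof (cases "\<exists>y. y \<noteq> 0 \<and> u y \<noteq> v y")
        case True
        then have "val_ge u 0 (ev z (pCons 0 \<epsilon>))" using u by (intro val_ge_ev z_other)
        then show ?thesis using u(2) by (rule_tac val_ge_mono) auto
      next
        case False
        then have eq: "u z = v z" "u t = 1" using z(1) t by auto
        have "val_ge u (- (int J * int a)) (ev z (pCons 0 \<epsilon>))"
          using u(1) \<epsilon>' eq a(1) by (intro val_ge_ev_degree) (auto simp: val_ge_def)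
        moreover have "int J * int a \<le> int r" by (simp add: r_def N_def mult.commute)
        ultimately show ?thesis using eq by (rule_tac val_ge_mono) auto
      qed
      ultimately have "val_ge u (- (int r * u t)) (F c - ev z (pCons 0 \<epsilon>))" by (rule val_ge_diff[OF u(1)])
      from val_ge_mult[OF u(1) tr this] show ?thesis by simp
    qed
    then show ?thesis by (simp add: W_def \<Phi>_def x_eq)
  qed
  have "\<forall>x\<in>C. \<exists>e. e \<in> E \<and> (\<exists>w\<in>W. \<Phi> x = e + t ^ Suc r * w)"
    using E(3)[OF \<Phi>W] by blast
  then obtain g where g: "\<And>x. x \<in> C \<Longrightarrow> g x \<in> E" "\<And>x. x \<in> C \<Longrightarrow> \<exists>w\<in>W. \<Phi> x = g x + t ^ Suc r * w"
    by metis
  have "card C = CARD('f) ^ (Suc N * n) * CARD('f) ^ J"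
    unfolding C_def by (simp only: card_cartesian_product card_PiE finite_lessThan finite_card_degree_le(2)
        prod_constant card_lessThan power_mult) (simp add: J_def)
  also have "\<dots> = CARD('f) ^ (Suc N * n + J)" by (simp only: power_add)
  also have "\<dots> > CARD('f) ^ (n * Suc r)"
    using card_field_ge_2[where 'a = 'f] by (intro power_strict_increasing) (auto simp: J_def r_def algebra_simps)
  finally have "card E < card C" using E(2) by linarith
  moreover have "g ` C \<subseteq> E" using g(1) by blast
  ultimately have "\<not> inj_on g C" using E(1) card_inj_on_le by (metis not_le)
  then obtain x x' where xx: "x \<in> C" "x' \<in> C" "x \<noteq> x'" "g x = g x'" by (auto simp: inj_on_def)
  obtain c \<epsilon> c' \<epsilon>' where eqs: "x = (c, \<epsilon>)" "x' = (c', \<epsilon>')" by (cases x, cases x')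
  obtain w w' where w: "w \<in> W" "w' \<in> W" "\<Phi> x = g x + t ^ Suc r * w" "\<Phi> x' = g x' + t ^ Suc r * w'"
    using g(2) xx by metis
  define f where "f = F (\<lambda>i. c i - c' i)"
  define \<delta> where "\<delta> = \<epsilon> - \<epsilon>'"
  have wW: "w - w' \<in> W" using w(1,2) by (simp add: W_def val_ge_diff)
  have f_eq: "f = ev z (pCons 0 \<delta>) + t * (w - w')"
  proof -
    have "f = F c - F c'" unfolding f_def F_def by (simp add: ev_diff left_diff_distrib sum_subtractf)
    moreover have "ev z (pCons 0 \<delta>) = ev z (pCons 0 \<epsilon>) - ev z (pCons 0 \<epsilon>')"
      by (simp add: \<delta>_def ev_diff right_diff_distrib)
    ultimately have "t ^ r * (f - ev z (pCons 0 \<delta>)) = \<Phi> x - \<Phi> x'"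
      by (simp add: \<Phi>_def eqs right_diff_distrib)
    also have "\<dots> = t ^ r * (t * (w - w'))" using w xx(4) by (simp add: algebra_simps)
    finally have "f - ev z (pCons 0 \<delta>) = t * (w - w')" using t(1) by simp
    then show ?thesis by (simp add: algebra_simps)
  qed
  have tw: "val_ge u 1 (t * (w - w'))" if u: "normalized_valuation u" "0 < u t" for u
  proof -
    have "val_ge u 1 t" using u(2) by (simp add: val_ge_def)
    from val_ge_mult[OF u(1) this WD[OF wW u]] show ?thesis by simp
  qed
  have f_affine: "f \<in> affine_ring v"
    unfolding affine_ring_iff
  proof (intro allI impI)
    fix u assume u: "normalized_valuation u" "\<exists>y. y \<noteq> 0 \<and> u y \<noteq> v y"
    show "val_ge u 0 f"
    proof (cases "0 < u t")
      case True
      have "val_ge u 0 (t * (w - w'))" using tw[OF u(1) True] by (rule val_ge_mono) simp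
      then show ?thesis unfolding f_eq using u True by (intro val_ge_add val_ge_ev z_other)
    next
      case False
      then have s: "val_ge u 0 s" using vs[OF u(1)] by (simp add: val_ge_def)
      have "val_ge u 0 (b i)" for i unfolding b_def by (rule d(2)[OF u(1) s])
      then show ?thesis unfolding f_def F_def by (intro val_ge_sum val_ge_mult0 val_ge_ev u(1) s)
    qed
  qed
  \<comment> \<open>If \<delta> were 0, the coefficients \<open>c\<close> and \<open>c'\<close>
    would differ, and \<open>f\<close> would be a nonzero regular function vanishing at
    \<open>v\<close>.\<close>
  have "\<delta> \<noteq> 0"
  proof
    assume \<delta>: "\<delta> = 0"
    then have "c \<noteq> c'" using xx(3) eqs by (auto simp: \<delta>_def)
    have "\<exists>i<n. c i - c' i \<noteq> 0"
    proof (rule ccontr)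
      assume "\<not> ?thesis"
      then have "c = c'" using xx(1,2) unfolding C_def eqs by (intro PiE_ext[of c "{..<n}"]) auto
      with \<open>c \<noteq> c'\<close> show False by simp
    qed
    then have "f \<noteq> 0"
      using b spec[of "\<lambda>c. \<not> ((\<exists>i<n. c i \<noteq> 0) \<and> (\<Sum>i<n. ev s (c i) * b i) = 0)" "\<lambda>i. c i - c' i"]
      unfolding f_def F_def dep_def by simp
    moreover have "val_ge v 1 f" unfolding f_eq using tw[OF v] t(2) \<delta> by simp
    ultimately show False using affine_val_nonpos[OF f_affine] by (simp add: val_ge_def)
  qed
  then have "pCons 0 \<delta> \<noteq> 0" "degree (pCons 0 \<delta>) = Suc (degree \<delta>)" by simp_all
  then have nz: "ev z (pCons 0 \<delta>) \<noteq> 0" and "v (ev z (pCons 0 \<delta>)) = int (Suc (degree \<delta>)) * v z"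
    using val_ev_neg[OF v z(1,2), of "pCons 0 \<delta>"] by (simp_all del: ev_pCons)
  then have neg: "v (ev z (pCons 0 \<delta>)) < 0" using z(2) by (simp only: mult_pos_neg)
  have "val_ge v (v (ev z (pCons 0 \<delta>)) + 1) (t * (w - w'))"
    using tw[OF v] t(2) neg by (rule_tac val_ge_mono[of v 1]) auto
  from val_add_eq[OF v nz this] have "f \<noteq> 0" "v f < 0" using neg f_eq by simp_all
  then show ?thesis using f_affine by blast
qed

section \<open>Fraction field, cocompactness and finite residue field\<close>

lemma affine_ring_ev: "f \<in> affine_ring v \<Longrightarrow> ev f p \<in> affine_ring v"
  unfolding affine_ring_iff using val_ge_ev by blast

text \<open>K is the field of fractions of R: with \<open>f\<close> regular outside
  \<open>v\<close>, the integral multiples over \<kappa>[f] are regular there too.\<close>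

lemma affine_clear_denominator:
  "\<exists>d\<in>affine_ring v. d \<noteq> 0 \<and> d * y \<in> affine_ring v"
proof -
  obtain f where f: "f \<in> affine_ring v" "f \<noteq> 0" "v f < 0" using ex_pole by blast
  have tf: "transc f" using transc_if_val[OF v f(2)] f(3) by simp
  obtain d where d: "d \<noteq> 0" "\<forall>u. normalized_valuation u \<longrightarrow> val_ge u 0 f \<longrightarrow> val_ge u 0 (ev f d * y)"
    using integral_multiple[OF tf] by blast
  have "ev f d * y \<in> affine_ring v" using f(1) d(2) unfolding affine_ring_iff by blast
  then show ?thesis using d(1) transcD[OF tf] affine_ring_ev[OF f(1)] by (intro bexI[of _ "ev f d"]) auto
qed

lemma affine_common_denominator:
  assumes "finite Y"
  shows "\<exists>d. d \<noteq> 0 \<and> d \<in> affine_ring v \<and> (\<forall>y\<in>Y. d * y \<in> affine_ring v)"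
  using assms
proof (induction Y)
  case empty
  show ?case by (intro exI[of _ 1]) (simp add: affine_ring_closed)
next
  case (insert y Y)
  then obtain d where d: "d \<noteq> 0" "d \<in> affine_ring v" "\<forall>y\<in>Y. d * y \<in> affine_ring v" by blast
  obtain e where e: "e \<in> affine_ring v" "e \<noteq> 0" "e * y \<in> affine_ring v" using affine_clear_denominator by blast
  have "d * e * y \<in> affine_ring v" using affine_ring_closed(4)[OF d(2) e(3)] by (simp add: mult.assoc)
  moreover have "d * e * z \<in> affine_ring v" if "z \<in> Y" for z
    using affine_ring_closed(4)[OF e(1) d(3)[rule_format, OF that]] by (simp add: ac_simps)
  ultimately show ?case using d e affine_ring_closed(4)[OF d(2) e(1)]
    by (intro exI[of _ "d * e"]) auto
qed

text \<open>Expand \<open>y\<close> over a basis \<open>b\<close> from R with coefficients in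
  \<kappa>(f), and divide each numerator by the common denominator \<open>e\<close> with remainder.
  The quotients contribute an element of R. As \<open>f\<close> has a pole at \<open>v\<close>, the
  fractions left over are integral at \<open>v\<close>, so it suffices that \<open>m\<close> bounds
  the valuations of the \<open>b i\<close> from below.\<close>

lemma affine_cocompact: "\<exists>m. \<forall>y. \<exists>r\<in>affine_ring v. val_ge v m (y - r)"
proof -
  obtain f where f: "f \<in> affine_ring v" "f \<noteq> 0" "v f < 0" using ex_pole by blast
  have tf: "transc f" using transc_if_val[OF v f(2)] f(3) by simp
  obtain n b0 where b0: "\<not> dep f n b0" and n: "\<forall>y. dep f (Suc n) y" using ex_basis[OF tf] by blast
  have "\<forall>i. \<exists>d. d \<noteq> 0 \<and> (\<forall>u. normalized_valuation u \<longrightarrow> val_ge u 0 f \<longrightarrow> val_ge u 0 (ev f d * b0 i))"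
    using integral_multiple[OF tf] by blast
  then obtain d where d: "\<forall>i. d i \<noteq> 0 \<and> (\<forall>u. normalized_valuation u \<longrightarrow> val_ge u 0 f \<longrightarrow> val_ge u 0 (ev f (d i) * b0 i))"
    by (rule choice[THEN exE])
  define b where "b i = ev f (d i) * b0 i" for i
  have b: "\<not> dep f n b" unfolding b_def using d by (intro not_dep_scale tf b0) auto
  have b_affine: "b i \<in> affine_ring v" for i
    unfolding b_def using f(1) d unfolding affine_ring_iff by blast
  define m where "m = - (\<Sum>i<n. \<bar>v (b i)\<bar>)"
  have m: "val_ge v m (b i)" if "i < n" for i
  proof -
    have "\<bar>v (b i)\<bar> \<le> (\<Sum>i<n. \<bar>v (b i)\<bar>)" using that by (intro member_le_sum) auto
    then have "m \<le> v (b i)" unfolding m_def by linarith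
    then show ?thesis by (simp add: val_ge_def)
  qed
  have sum_affine: "sum g I \<in> affine_ring v" if "\<And>i. i \<in> I \<Longrightarrow> g i \<in> affine_ring v" for g :: "nat \<Rightarrow> 'k" and I
    using that by (induction I rule: infinite_finite_induct) (auto intro: affine_ring_closed)
  show ?thesis
  proof (intro exI[of _ m] allI)
    fix y
    obtain e c where e: "e \<noteq> 0" "ev f e * y = (\<Sum>i<n. ev f (c i) * b i)"
      using basis_expansion[OF b] n by blast
    have e0: "ev f e \<noteq> 0" using e(1) transcD[OF tf] by simp
    define r where "r = (\<Sum>i<n. ev f (c i div e) * b i)"
    have "ev f (c i) = ev f (c i div e) * ev f e + ev f (c i mod e)" for i
      by (simp flip: ev_mult ev_add)
    then have "ev f e * (y - r) = (\<Sum>i<n. ev f (c i mod e) * b i)"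
      unfolding right_diff_distrib e(2) r_def by (simp add: sum_distrib_left algebra_simps flip: sum_subtractf)
    then have "y - r = (\<Sum>i<n. ev f (c i mod e) * b i) / ev f e" using e0 by (simp add: field_simps)
    also have "\<dots> = (\<Sum>i<n. ev f (c i mod e) / ev f e * b i)" by (simp add: sum_divide_distrib)
    finally have eq: "y - r = (\<Sum>i<n. ev f (c i mod e) / ev f e * b i)" .
    have "val_ge v 0 (ev f (c i mod e) / ev f e)" for i
    proof (cases "c i mod e = 0")
      case False
      then have "degree (c i mod e) \<le> degree e" using e(1) degree_mod_less[of e "c i"] by auto
      then have "int (degree e) * v f \<le> int (degree (c i mod e)) * v f"
        using f(3) by (intro mult_right_mono_neg) auto
      then show ?thesis
        using val_ev_neg[OF v f(2,3) False] val_ev_neg[OF v f(2,3) e(1)]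
        by (simp add: val_ge_def val_divide[OF v])
    qed simp
    then have "val_ge v m (y - r)" unfolding eq by (intro val_ge_sum v val_ge_mult0 m) auto
    moreover have "r \<in> affine_ring v"
      unfolding r_def by (intro sum_affine affine_ring_closed affine_ring_ev f b_affine)
    ultimately show "\<exists>r\<in>affine_ring v. val_ge v m (y - r)" by blast
  qed
qed

lemma finite_residues:
  assumes p: "p \<noteq> 0" "v p = 1"
  shows "\<exists>E. finite E \<and> (\<forall>x. val_ge v 0 x \<longrightarrow> (\<exists>e\<in>E. \<exists>w. val_ge v 0 w \<and> x = e + p * w))"
proof -
  have tp: "transc p" using transc_if_val[OF v p(1)] p(2) by simp
  obtain n where "\<forall>y. dep p (Suc n) y" using ex_basis[OF tp] by blast
  then have n: "dep p (Suc n) y" for y ..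
  have "val_ge v 0 p" using p by (simp add: val_ge_def)
  then have "\<exists>E\<subseteq>{x. val_ge v 0 x}. finite E \<and> card E \<le> CARD('f) ^ n \<and>
      (\<forall>x\<in>{x. val_ge v 0 x}. \<exists>e\<in>E. \<exists>w\<in>{x. val_ge v 0 x}. x = e + p * w)"
    using v by (intro residue_cover[OF p(1) n]) (auto intro: val_ge_add val_ge_mult0 val_ge_\<kappa>)
  then obtain E where "finite E" "\<forall>x\<in>{x. val_ge v 0 x}. \<exists>e\<in>E. \<exists>w\<in>{x. val_ge v 0 x}. x = e + p * w"
    by blast
  then show ?thesis by (intro exI[of _ E]) blast
qed

end

end

section \<open>Matrices over a field with a discrete subring\<close>

lemma finite_vec_in:
  fixes F :: "'a set" assumes "finite F"
  shows "finite {x :: 'a ^ 'n::finite. \<forall>i. x $ i \<in> F}"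
proof -
  have "finite (PiE UNIV (\<lambda>_ :: 'n. F))" using assms by (intro finite_PiE) auto
  moreover have "{x :: 'a ^ 'n. \<forall>i. x $ i \<in> F} \<subseteq> vec_lambda ` PiE UNIV (\<lambda>_. F)"
  proof
    fix x :: "'a ^ 'n" assume "x \<in> {x. \<forall>i. x $ i \<in> F}"
    then have "vec_nth x \<in> PiE UNIV (\<lambda>_. F)" by auto
    then show "x \<in> vec_lambda ` PiE UNIV (\<lambda>_. F)" by (metis image_eqI vec_nth_inverse)
  qed
  ultimately show ?thesis using finite_surj by blast
qed

lemma finite_matrix_in:
  fixes F :: "'a set" assumes "finite F"
  shows "finite {x :: 'a ^ 'n::finite ^ 'm::finite. \<forall>i j. x $ i $ j \<in> F}"
  using finite_vec_in[OF finite_vec_in[OF assms, where 'n='n], where 'n='m] by simp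

lemma subring_sum:
  fixes S :: "'a::comm_ring_1 set"
  assumes "0 \<in> S" "\<And>x y. x \<in> S \<Longrightarrow> y \<in> S \<Longrightarrow> x + y \<in> S" "\<And>i. i \<in> I \<Longrightarrow> f i \<in> S"
  shows "sum f I \<in> S"
  using assms(3) by (induction I rule: infinite_finite_induct) (auto intro: assms(1,2))

lemma subring_prod:
  fixes S :: "'a::comm_ring_1 set"
  assumes "1 \<in> S" "\<And>x y. x \<in> S \<Longrightarrow> y \<in> S \<Longrightarrow> x * y \<in> S" "\<And>i. i \<in> I \<Longrightarrow> f i \<in> S"
  shows "prod f I \<in> S"
  using assms(3) by (induction I rule: infinite_finite_induct) (auto intro: assms(1,2))

lemma subring_det:
  fixes A :: "'a::comm_ring_1 ^ 'n ^ 'n"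
  assumes S: "0 \<in> S" "1 \<in> S" "\<And>x y. x \<in> S \<Longrightarrow> y \<in> S \<Longrightarrow> x + y \<in> S"
    "\<And>x y. x \<in> S \<Longrightarrow> y \<in> S \<Longrightarrow> x * y \<in> S" "\<And>x. x \<in> S \<Longrightarrow> - x \<in> S"
    and A: "\<And>i j. A $ i $ j \<in> S"
  shows "det A \<in> S"
  unfolding det_def
proof (intro subring_sum S(1,3) S(4) subring_prod S(2) A)
  show "of_int (sign p) \<in> S" for p :: "'n \<Rightarrow> 'n"
    using S(2) S(5)[OF S(2)] by (simp add: sign_def)
qed

text \<open>The adjugate, read off from Cramer's rule so that its entries visibly stay in the
  subring. It is applied to R and to the unit ball of K_v.\<close>

lemma subring_adjugate:
  fixes A :: "'a::field ^ 'n ^ 'n"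
  assumes S: "0 \<in> S" "1 \<in> S" "\<And>x y. x \<in> S \<Longrightarrow> y \<in> S \<Longrightarrow> x + y \<in> S"
    "\<And>x y. x \<in> S \<Longrightarrow> y \<in> S \<Longrightarrow> x * y \<in> S" "\<And>x. x \<in> S \<Longrightarrow> - x \<in> S"
    and A: "\<And>i j. A $ i $ j \<in> S" and d: "det A \<noteq> 0"
  shows "\<exists>B. (\<forall>i j. B $ i $ j \<in> S) \<and> A ** B = mat (det A) \<and> B ** A = mat (det A)"
proof -
  define B :: "'a ^ 'n ^ 'n" where
    "B = (\<chi> k j. det (\<chi> i l. if l = k then axis j 1 $ i else A $ i $ l))"
  have "B $ k $ j \<in> S" for k j
    unfolding B_def vec_lambda_beta
    by (rule subring_det) (use S A in \<open>auto simp: axis_def\<close>)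
  moreover have AB: "A ** B = mat (det A)"
  proof -
    have col: "A *v column j B = det A *s axis j 1" for j
    proof -
      define x where "x = (\<chi> k. det (\<chi> i l. if l = k then (axis j 1 :: 'a ^ 'n) $ i else A $ i $ l) / det A)"
      have "A *v x = axis j 1" using cramer[OF d, of x "axis j 1"] by (simp add: x_def)
      moreover have "column j B = det A *s x"
        using d by (simp add: B_def x_def column_def vec_eq_iff)
      ultimately show ?thesis by (simp add: vec.scale)
    qed
    have "(A ** B) $ i $ j = mat (det A) $ i $ j" for i j
    proof -
      have "(A ** B) $ i $ j = (A *v column j B) $ i"
        by (simp add: matrix_matrix_mult_def matrix_vector_mult_def column_def)
      then show ?thesis unfolding col by (simp add: mat_def axis_def)
    qed
    then show ?thesis by (simp add: vec_eq_iff)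
  qed
  moreover have "B ** A = mat (det A)"
  proof -
    let ?C = "mat (inverse (det A)) ** B"
    have "A ** ?C = mat (inverse (det A)) ** (A ** B)"
      by (metis mat_commute matrix_mul_assoc)
    also have "\<dots> = mat 1" unfolding AB using d by (simp add: mat_mult_mat)
    finally have "?C ** A = mat 1" by (rule matrix_left_right_inverse[THEN iffD1])
    then have "mat (det A) ** (?C ** A) = mat (det A)" by simp
    moreover have "mat (det A) ** (?C ** A) = (mat (det A) ** mat (inverse (det A))) ** B ** A"
      by (simp only: matrix_mul_assoc)
    ultimately show ?thesis using d by (simp add: mat_mult_mat)
  qed
  ultimately show ?thesis by blast
qed

lemma matrix_diff_mult: "(A - B) ** C = A ** C - B ** (C :: 'a::comm_ring_1 ^ 'n ^ 'm)"
  and matrix_mult_diff: "D ** (A - B) = D ** A - D ** (B :: 'a ^ 'm ^ 'l)"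
  by (simp_all add: matrix_matrix_mult_def vec_eq_iff algebra_simps sum_subtractf)

lemma invertible_imp_det: "invertible (A :: 'a::field ^ 'n ^ 'n) \<Longrightarrow> det A \<noteq> 0"
  by (simp add: invertible_det_nz)

lemma det_mat: "det (mat c :: 'a::comm_ring_1 ^ 'n ^ 'n) = c ^ CARD('n)"
proof -
  have "det (mat c :: 'a ^ 'n ^ 'n) = (\<Prod>i\<in>UNIV. (mat c :: 'a ^ 'n ^ 'n) $ i $ i)"
    by (intro det_diagonal) (simp add: mat_def)
  then show ?thesis by (simp add: mat_def)
qed

text \<open>What the geometry of lattices takes from arithmetic: an ultrametric field with value
  group generated by |p| and totally bounded balls, and a discrete cocompact subring. Discreteness
  has the sharp form |r| >= 1, so that a vector over R with all entries below 1 is zero.\<close>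

locale valued_lattice =
  fixes R :: "'c::{field,complete_space} set" and p :: 'c
  assumes dist_mult_0: "dist (x * y) 0 = dist x 0 * dist y (0 :: 'c)"
    and dist_diff: "dist x y = dist (x - y) (0 :: 'c)"
    and dist_add_0: "dist (x + y) 0 \<le> max (dist x 0) (dist y (0 :: 'c))"
    and p: "0 < dist p 0" "dist p 0 < 1"
    and value_group: "x \<noteq> 0 \<Longrightarrow> \<exists>k. dist x 0 = dist p 0 powi k"
    and R_0: "0 \<in> R" and R_1: "1 \<in> R"
    and R_add: "x \<in> R \<Longrightarrow> y \<in> R \<Longrightarrow> x + y \<in> R"
    and R_mult: "x \<in> R \<Longrightarrow> y \<in> R \<Longrightarrow> x * y \<in> R"
    and R_uminus: "x \<in> R \<Longrightarrow> - x \<in> R"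
    and R_discrete: "x \<in> R \<Longrightarrow> x \<noteq> 0 \<Longrightarrow> 1 \<le> dist x 0"
    and R_cocompact: "\<exists>C. \<forall>x. \<exists>r\<in>R. dist x r \<le> C"
    and balls_totally_bounded:
      "0 < e \<Longrightarrow> \<exists>F :: 'c set. finite F \<and> (\<forall>x. dist x 0 \<le> \<rho> \<longrightarrow> (\<exists>y\<in>F. dist x y < e))"
begin

definition av :: "'c \<Rightarrow> real" where "av x = dist x 0"

lemma dist_av: "dist x y = av (x - y)"
  using dist_diff by (simp add: av_def)

lemma av_nonneg [simp]: "0 \<le> av x"
  by (simp add: av_def)

lemma av_eq_0 [simp]: "av x = 0 \<longleftrightarrow> x = 0"
  by (simp add: av_def)

lemma av_0 [simp]: "av 0 = 0" by (simp add: av_def)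

lemma av_pos: "x \<noteq> 0 \<Longrightarrow> 0 < av x"
  by (simp add: av_def)

lemma av_mult: "av (x * y) = av x * av y"
  by (simp add: av_def dist_mult_0)

lemma av_1 [simp]: "av 1 = 1"
  using av_mult[of 1 1] av_pos[of 1] by simp

lemma av_add: "av (x + y) \<le> max (av x) (av y)"
  by (simp add: av_def dist_add_0)

lemma av_uminus [simp]: "av (- x) = av x"
proof -
  have "av (-1) * av (-1) = 1" using av_mult[of "-1" "-1"] by simp
  then have "av (-1) = 1" using av_nonneg[of "-1"] by (metis abs_of_nonneg real_sqrt_abs2 real_sqrt_one)
  then show ?thesis using av_mult[of "-1" x] by simp
qed

lemma av_diff: "av (x - y) \<le> max (av x) (av y)"
  using av_add[of x "- y"] by simp

lemma av_inverse: "av (inverse x) = inverse (av x)"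
proof (cases "x = 0")
  case False
  then have "av x * av (inverse x) = 1" by (simp flip: av_mult)
  then show ?thesis by (rule inverse_unique[symmetric])
qed simp

lemma av_divide: "av (x / y) = av x / av y"
  by (simp add: divide_inverse av_mult av_inverse)

lemma av_power: "av (x ^ n) = av x ^ n"
  by (induction n) (simp_all add: av_mult)

lemma av_powi: "av (x powi k) = av x powi k"
  by (cases k rule: int_cases2) (simp_all add: av_power av_inverse power_int_minus)

lemma av_prod: "av (prod f I) = (\<Prod>i\<in>I. av (f i))"
  by (induction I rule: infinite_finite_induct) (simp_all add: av_mult)

lemma av_sum_le: "(\<And>i. i \<in> I \<Longrightarrow> av (f i) \<le> \<rho>) \<Longrightarrow> 0 \<le> \<rho> \<Longrightarrow> av (sum f I) \<le> \<rho>"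
proof (induction I rule: infinite_finite_induct)
  case (insert i I)
  then show ?case using av_add[of "f i" "sum f I"] by (auto intro: order_trans)
qed auto

lemma av_sum_less: "(\<And>i. i \<in> I \<Longrightarrow> av (f i) < \<rho>) \<Longrightarrow> 0 < \<rho> \<Longrightarrow> av (sum f I) < \<rho>"
proof (induction I rule: infinite_finite_induct)
  case (insert i I)
  then show ?case using av_add[of "f i" "sum f I"] by (auto intro: order_le_less_trans)
qed auto

lemma av_add_eq: assumes "av y < av x" shows "av (x + y) = av x"
proof (rule antisym)
  show "av (x + y) \<le> av x" using av_add[of x y] assms by simp
  show "av x \<le> av (x + y)" using av_diff[of "x + y" y] assms by (simp add: max_def split: if_splits)
qed

lemma av_p: "0 < av p" "av p < 1" "p \<noteq> 0"
  using p by (auto simp: av_def)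

lemma av_eq_powi: "x \<noteq> 0 \<Longrightarrow> \<exists>k. av x = av p powi k"
  using value_group by (simp add: av_def)

lemma av_powi_less_iff: "av p powi k < av p powi l \<longleftrightarrow> l < k"
proof -
  have *: "av p powi k < av p powi l" if "l < k" for k l
    using power_int_strict_decreasing[OF that, of "av p"] av_p by blast
  show ?thesis using *[of l k] *[of k l] by (metis less_irrefl less_trans linorder_neqE)
qed

lemma av_powi_le_iff: "av p powi k \<le> av p powi l \<longleftrightarrow> l \<le> k"
  using av_powi_less_iff[of l k] by linarith

lemma av_powi_pos: "0 < av p powi k"
  using av_p by simp

lemma av_powi_small: assumes "0 < e" shows "\<exists>k. 0 \<le> k \<and> av p powi k < e"
proof -
  obtain n where "av p ^ n < e" using real_arch_pow_inv[OF assms av_p(2)] by blast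
  then show ?thesis by (intro exI[of _ "int n"]) simp
qed

lemma av_powi_large: "\<exists>k. 0 \<le> k \<and> \<rho> < av p powi (- k)"
proof -
  have "0 < inverse (max \<rho> 1)" by (simp add: less_max_iff_disj)
  then obtain k where k: "0 \<le> k" "av p powi k < inverse (max \<rho> 1)" using av_powi_small by blast
  then have "max \<rho> 1 < inverse (av p powi k)"
    using av_powi_pos[of k] by (metis inverse_inverse_eq less_imp_inverse_less)
  then show ?thesis using k by (intro exI[of _ k]) (simp add: power_int_minus)
qed

section \<open>Ultrametric bounds for matrices and the group GL(O)\<close>

definition bnd :: "real \<Rightarrow> 'c ^ 'n ^ 'm \<Rightarrow> bool" where
  "bnd \<rho> A \<longleftrightarrow> (\<forall>i j. av (A $ i $ j) \<le> \<rho>)"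

lemma bndD: "bnd \<rho> A \<Longrightarrow> av (A $ i $ j) \<le> \<rho>"
  by (simp add: bnd_def)

lemma bnd_mono: "bnd \<rho> A \<Longrightarrow> \<rho> \<le> \<sigma> \<Longrightarrow> bnd \<sigma> A"
  unfolding bnd_def using order_trans by blast

lemma ex_bnd:
  fixes A :: "'c ^ 'n::finite ^ 'm::finite"
  shows "\<exists>\<rho>>0. bnd \<rho> A"
proof -
  define \<rho> where "\<rho> = 1 + (\<Sum>i\<in>UNIV. \<Sum>j\<in>UNIV. av (A $ i $ j))"
  have "av (A $ i $ j) \<le> \<rho>" for i j
  proof -
    have "av (A $ i $ j) \<le> (\<Sum>j\<in>UNIV. av (A $ i $ j))" by (intro member_le_sum) auto
    also have "\<dots> \<le> (\<Sum>i\<in>UNIV. \<Sum>j\<in>UNIV. av (A $ i $ j))"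
      by (intro member_le_sum[of i UNIV "\<lambda>i. \<Sum>j\<in>UNIV. av (A $ i $ j)"]) (auto intro: sum_nonneg)
    finally show ?thesis by (simp add: \<rho>_def)
  qed
  moreover have "0 < \<rho>" unfolding \<rho>_def by (intro add_pos_nonneg sum_nonneg) auto
  ultimately show ?thesis by (auto simp: bnd_def)
qed

lemma bnd_nonneg: "bnd \<rho> A \<Longrightarrow> 0 \<le> \<rho>"
  using bndD av_nonneg order_trans by blast

lemma bnd_mult: "bnd \<rho> A \<Longrightarrow> bnd \<sigma> B \<Longrightarrow> bnd (\<rho> * \<sigma>) (A ** B)"
  using bnd_nonneg[of \<rho> A] bnd_nonneg[of \<sigma> B]
  by (auto simp: bnd_def matrix_matrix_mult_def av_mult intro!: av_sum_le mult_mono)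

lemma bnd_uminus [simp]: "bnd \<rho> (- A) \<longleftrightarrow> bnd \<rho> A"
  by (simp add: bnd_def)

lemma bnd_add: "bnd \<rho> A \<Longrightarrow> bnd \<rho> B \<Longrightarrow> bnd \<rho> (A + B)"
  unfolding bnd_def vector_add_component using order_trans[OF av_add] by (metis max.boundedI)

lemma bnd_diff_commute: "bnd \<rho> (A - B) \<longleftrightarrow> bnd \<rho> (B - A)"
  using bnd_uminus[of \<rho> "A - B"] by simp

lemma bnd_mat_1: "bnd 1 (mat 1)"
  by (simp add: bnd_def mat_def)

text \<open>In the expansion of the determinant every permutation other than the identity meets an
  off-diagonal entry, so the identity term dominates.\<close>

lemma av_det_dominant:
  fixes A :: "'c ^ 'n ^ 'n"
  assumes diag: "\<And>i. av (A $ i $ i) = 1" and off: "\<And>i j. i \<noteq> j \<Longrightarrow> av (A $ i $ j) < 1"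
  shows "av (det A) = 1"
proof -
  let ?f = "\<lambda>q. of_int (sign q) * (\<Prod>i\<in>UNIV. A $ i $ q i)"
  let ?P = "{q. q permutes (UNIV :: 'n set)}"
  have le: "av (A $ i $ j) \<le> 1" for i j using diag[of i] off[of i j] by (cases "i = j") auto
  have "av (?f q) < 1" if "q \<in> ?P - {id}" for q
  proof -
    obtain i where i: "q i \<noteq> i" using \<open>q \<in> ?P - {id}\<close> by (auto simp: fun_eq_iff)
    have "av (?f q) = (\<Prod>i\<in>UNIV. av (A $ i $ q i))" by (simp add: av_mult av_prod sign_def)
    also have "\<dots> = av (A $ i $ q i) * (\<Prod>i\<in>UNIV - {i}. av (A $ i $ q i))"
      by (intro prod.remove) auto
    also have "\<dots> \<le> av (A $ i $ q i) * 1"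
      using le by (intro mult_left_mono prod_le_1) auto
    also have "\<dots> < 1" using off[of i "q i"] i by simp
    finally show ?thesis .
  qed
  then have "av (sum ?f (?P - {id})) < 1" by (intro av_sum_less) auto
  moreover have "av (?f id) = 1" by (simp add: av_mult av_prod diag sign_id)
  moreover have "det A = ?f id + sum ?f (?P - {id})"
    unfolding det_def by (intro sum.remove) (auto simp: finite_permutations permutes_id)
  ultimately show ?thesis using av_add_eq[of "sum ?f (?P - {id})" "?f id"] by simp
qed

text \<open>This is GL(O): by the adjugate, integral entries and a unit determinant provide an
  integral inverse, see \<open>GLO_inverse\<close>.\<close>

definition GLO :: "('c ^ 'n ^ 'n) set" where
  "GLO = {k. bnd 1 k \<and> av (det k) = 1}"

text \<open>For 0 <= e < 1 these are subgroups of \<open>GLO\<close>. They play the part of a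
  neighbourhood basis of 1 in a multiplicative form that passes to quotients.\<close>

definition GLQ :: "real \<Rightarrow> ('c ^ 'n ^ 'n) set" where
  "GLQ e = {k. bnd e (k - mat 1)}"

lemma GLQ_subset_GLO: "e < 1 \<Longrightarrow> GLQ e \<subseteq> GLO"
proof
  fix k :: "'c ^ 'n ^ 'n" assume e: "e < 1" and "k \<in> GLQ e"
  then have k: "bnd e (k - mat 1)" by (simp add: GLQ_def)
  have "av (k $ i $ i) = 1" for i
    using av_add_eq[of "(k - mat 1) $ i $ i" 1] bndD[OF k, of i i] e by (simp add: mat_def)
  moreover have "av (k $ i $ j) < 1" if "i \<noteq> j" for i j
    using bndD[OF k, of i j] e that by (simp add: mat_def)
  ultimately have "av (det k) = 1" by (rule av_det_dominant)
  moreover have "bnd 1 ((k - mat 1) + mat 1)"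
    by (rule bnd_add[OF bnd_mono[OF k] bnd_mat_1]) (use e in simp)
  ultimately show "k \<in> GLO" by (simp add: GLO_def)
qed

lemma GLO_mult: "k \<in> GLO \<Longrightarrow> l \<in> GLO \<Longrightarrow> k ** l \<in> GLO"
  using bnd_mult[of 1 k 1 l] by (simp add: GLO_def det_mul av_mult)

lemma GLO_inverse:
  assumes "k \<in> GLO" shows "\<exists>l\<in>GLO. k ** l = mat 1 \<and> l ** k = mat 1"
proof -
  have k: "bnd 1 k" "av (det k) = 1" using assms by (auto simp: GLO_def)
  have d: "det k \<noteq> 0" using k(2) by auto
  let ?S = "{x. av x \<le> 1}"
  have "\<exists>B. (\<forall>i j. B $ i $ j \<in> ?S) \<and> k ** B = mat (det k) \<and> B ** k = mat (det k)"
  proof (rule subring_adjugate)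
    show "x + y \<in> ?S" if "x \<in> ?S" "y \<in> ?S" for x y using av_add[of x y] that by simp
    show "x * y \<in> ?S" if "x \<in> ?S" "y \<in> ?S" for x y using that by (simp add: av_mult mult_le_one)
  qed (use k d in \<open>auto simp: bnd_def\<close>)
  then obtain B where B: "\<forall>i j. B $ i $ j \<in> ?S" "k ** B = mat (det k)" "B ** k = mat (det k)" by blast
  define l where "l = mat (inverse (det k)) ** B"
  have 1: "l ** k = mat 1" unfolding l_def using d by (simp add: B mat_mult_mat flip: matrix_mul_assoc)
  have 2: "k ** l = mat 1" by (rule matrix_left_right_inverse[THEN iffD1, OF 1])
  have "bnd 1 l" using B(1) k(2) by (simp add: l_def mat_mult bnd_def av_mult av_inverse)
  moreover have "av (det l) * av (det k) = 1"
    using 1 by (metis av_1 av_mult det_I det_mul)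
  ultimately show ?thesis using 1 2 k(2) by (intro bexI[of _ l]) (auto simp: GLO_def)
qed

lemma invertible_GLO: "k \<in> GLO \<Longrightarrow> invertible k"
  using GLO_inverse unfolding invertible_def by blast

lemma GLQ_mult:
  assumes "e \<le> 1" "k \<in> GLQ e" "l \<in> GLQ e" shows "k ** l \<in> GLQ e"
proof -
  have kl: "bnd e (k - mat 1)" "bnd e (l - mat 1)" using assms by (auto simp: GLQ_def)
  have "bnd 1 ((l - mat 1) + mat 1)"
    by (rule bnd_add[OF bnd_mono[OF kl(2) assms(1)] bnd_mat_1])
  then have "bnd 1 l" by simp
  from bnd_add[OF bnd_mult[OF kl(1) this, simplified] kl(2)]
  have "bnd e ((k - mat 1) ** l + (l - mat 1))" .
  moreover have "(k - mat 1) ** l + (l - mat 1) = k ** l - mat 1"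
    by (simp add: matrix_diff_mult)
  ultimately show ?thesis by (simp add: GLQ_def)
qed

lemma GLQ_inverse:
  assumes "e < 1" "k \<in> GLQ e" shows "\<exists>l\<in>GLQ e. k ** l = mat 1 \<and> l ** k = mat 1"
proof -
  obtain l where l: "l \<in> GLO" "k ** l = mat 1" "l ** k = mat 1"
    using GLO_inverse GLQ_subset_GLO[OF assms(1)] assms(2) by blast
  have "bnd (1 * e) (l ** (k - mat 1))"
    using l(1) assms(2) by (intro bnd_mult) (auto simp: GLO_def GLQ_def)
  moreover have "l ** (k - mat 1) = mat 1 - l" by (simp add: matrix_mult_diff l)
  ultimately have "l \<in> GLQ e" using bnd_diff_commute[of e l "mat 1"] by (simp add: GLQ_def)
  then show ?thesis using l by blast
qed

lemma mat_1_in_GLQ: "0 \<le> e \<Longrightarrow> mat 1 \<in> GLQ e"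
  by (simp add: GLQ_def bnd_def)

text \<open>Elements of R near the same point of a net of mesh 1 differ by less than 1, hence
  coincide.\<close>

lemma finite_R_ball: "finite {r\<in>R. av r \<le> \<rho>}"
proof -
  obtain F :: "'c set" where F1: "finite F" and "\<forall>x. dist x 0 \<le> \<rho> \<longrightarrow> (\<exists>y\<in>F. dist x y < 1)"
    using balls_totally_bounded[of 1 \<rho>] by auto
  then have F2: "\<exists>y\<in>F. av (x - y) < 1" if "av x \<le> \<rho>" for x
    using that unfolding dist_av by simp
  define g where "g r = (SOME y. y \<in> F \<and> av (r - y) < 1)" for r
  have g: "g r \<in> F \<and> av (r - g r) < 1" if "av r \<le> \<rho>" for r
    unfolding g_def by (rule someI_ex) (use F2[OF that] in blast)
  have "inj_on g {r\<in>R. av r \<le> \<rho>}"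
  proof (rule inj_onI)
    fix r s assume rs: "r \<in> {r\<in>R. av r \<le> \<rho>}" "s \<in> {r\<in>R. av r \<le> \<rho>}" "g r = g s"
    then have "av ((r - g r) - (s - g s)) < 1"
      using g[of r] g[of s] order_le_less_trans[OF av_diff, of "r - g r" "s - g s" 1] by simp
    then have "av (r + - s) < 1" using rs(3) by simp
    moreover have "r + - s \<in> R" using rs by (intro R_add R_uminus) auto
    ultimately show "r = s" using R_discrete[of "r + - s"] by (auto simp: av_def)
  qed
  moreover have "g ` {r\<in>R. av r \<le> \<rho>} \<subseteq> F" using g by auto
  ultimately show ?thesis using F1 by (metis finite_imageD finite_subset)
qed

lemma R_av_ge_1: "r \<in> R \<Longrightarrow> r \<noteq> 0 \<Longrightarrow> 1 \<le> av r"
  using R_discrete by (simp add: av_def)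

lemma R_diff: "x \<in> R \<Longrightarrow> y \<in> R \<Longrightarrow> x - y \<in> R"
  using R_add[OF _ R_uminus, of x y] by simp

lemma R_sum: "(\<And>i. i \<in> I \<Longrightarrow> f i \<in> R) \<Longrightarrow> sum f I \<in> R"
  by (rule subring_sum[OF R_0 R_add])

lemma R_det: "(\<And>i j. A $ i $ j \<in> R) \<Longrightarrow> det A \<in> R"
  by (rule subring_det[OF R_0 R_1 R_add R_mult R_uminus])

lemma R_adjugate:
  "(\<And>i j. A $ i $ j \<in> R) \<Longrightarrow> det A \<noteq> 0 \<Longrightarrow>
     \<exists>B. (\<forall>i j. B $ i $ j \<in> R) \<and> A ** B = mat (det A) \<and> B ** A = mat (det A)"
  by (rule subring_adjugate[OF R_0 R_1 R_add R_mult R_uminus])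

end

section \<open>The topologies on \<open>PG\<close> and \<open>PG / P\<Gamma>\<close>\<close>

context valued_lattice begin

section \<open>Neighbourhoods by left multiplication in GL, in PG and in the space of
  lattices\<close>

lemma bnd_if_dist:
  fixes A B :: "'c ^ 'n::finite ^ 'm::finite"
  assumes "dist A B \<le> e" shows "bnd e (A - B)"
  unfolding bnd_def
proof (intro allI)
  fix i j
  have "dist (A $ i $ j) (B $ i $ j) \<le> dist (A $ i) (B $ i)" by (rule dist_vec_nth_le)
  also have "\<dots> \<le> dist A B" by (rule dist_vec_nth_le)
  finally show "av ((A - B) $ i $ j) \<le> e" using assms by (simp add: dist_av)
qed

lemma dist_if_bnd:
  fixes A B :: "'c ^ 'n::finite ^ 'm::finite"
  assumes "bnd e (A - B)" shows "dist A B \<le> real CARD('m) * (real CARD('n) * e)"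
proof -
  have le: "dist x y \<le> (\<Sum>i\<in>UNIV. dist (x $ i) (y $ i))" for x y :: "'a::metric_space ^ 'l::finite"
    unfolding dist_vec_def by (rule L2_set_le_sum) simp
  have "dist (A $ i) (B $ i) \<le> real CARD('n) * e" for i
  proof -
    have "(\<Sum>j\<in>UNIV. dist (A $ i $ j) (B $ i $ j)) \<le> (\<Sum>j\<in>(UNIV :: 'n set). e)"
      using assms by (intro sum_mono) (simp add: bnd_def dist_av)
    then show ?thesis using le[of "A $ i" "B $ i"] by simp
  qed
  then have "(\<Sum>i\<in>UNIV. dist (A $ i) (B $ i)) \<le> (\<Sum>i\<in>(UNIV :: 'm set). real CARD('n) * e)"
    by (intro sum_mono)
  then show ?thesis using le[of A B] by simp
qed

lemma ex_bnd_scaled: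
  fixes A :: "'c ^ 'n::finite ^ 'm::finite"
  assumes "0 < d"
  shows "\<exists>e>0. e < 1 \<and> (\<forall>B :: 'c ^ 'm ^ 'l::finite. bnd e B \<longrightarrow> bnd d (B ** A))"
proof -
  obtain \<rho> where \<rho>: "0 < \<rho>" "bnd \<rho> A" using ex_bnd by blast
  define e where "e = min (d / \<rho>) (1 / 2)"
  have "bnd d (B ** A)" if "bnd e B" for B :: "'c ^ 'm ^ 'l"
  proof (rule bnd_mono[OF bnd_mult[OF that \<rho>(2)]])
    have "e * \<rho> \<le> d / \<rho> * \<rho>" using \<rho>(1) by (intro mult_right_mono) (auto simp: e_def)
    then show "e * \<rho> \<le> d" using \<rho>(1) by simp
  qed
  moreover have "0 < e" "e < 1" using assms \<rho>(1) by (auto simp: e_def)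
  ultimately show ?thesis by blast
qed

lemma invertible_mult_GLO: "k \<in> GLO \<Longrightarrow> invertible g \<Longrightarrow> invertible (k ** g)"
  using invertible_GLO invertible_mult by blast

text \<open>Multiplication by a fixed matrix scales bounds by a constant, so closeness of
  \<open>h\<close> to \<open>g\<close> and closeness of their quotient to 1 control each other. The
  multiplicative form is the one that commutes with the quotients.\<close>

lemma openin_GL_iff:
  fixes S :: "('c ^ 'n ^ 'n) set"
  shows "openin (top_of_set {g. invertible g}) S \<longleftrightarrow>
    S \<subseteq> {g. invertible g} \<and> (\<forall>g\<in>S. \<exists>e>0. e < 1 \<and> (\<forall>k\<in>GLQ e. k ** g \<in> S))"
proof (intro iffI conjI ballI)
  assume S: "openin (top_of_set {g. invertible g}) S"
  then show "S \<subseteq> {g. invertible g}" using openin_subset by fastforce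
  fix g assume g: "g \<in> S"
  then obtain d where d: "0 < d" "\<And>h. invertible h \<Longrightarrow> dist h g < d \<Longrightarrow> h \<in> S"
    using S unfolding openin_euclidean_subtopology_iff by blast
  have inv_g: "invertible g" using g \<open>S \<subseteq> {g. invertible g}\<close> by blast
  define d' where "d' = d / (2 * (real CARD('n) * real CARD('n)))"
  have n0: "0 < real CARD('n)" by simp
  have d': "0 < d'" "real CARD('n) * (real CARD('n) * d') < d"
    using d(1) n0 by (auto simp: d'_def field_simps)
  obtain e where e: "0 < e" "e < 1" "\<And>B :: 'c ^ 'n ^ 'n. bnd e B \<Longrightarrow> bnd d' (B ** g)"
    using ex_bnd_scaled[OF d'(1), of g] by blast
  show "\<exists>e>0. e < 1 \<and> (\<forall>k\<in>GLQ e. k ** g \<in> S)"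
  proof (intro exI[of _ e] conjI ballI e(1,2))
    fix k :: "'c ^ 'n ^ 'n" assume k: "k \<in> GLQ e"
    then have "bnd d' ((k - mat 1) ** g)" by (intro e(3)) (simp add: GLQ_def)
    then have "bnd d' (k ** g - g)" by (simp add: matrix_diff_mult)
    from dist_if_bnd[OF this] have "dist (k ** g) g < d" using d'(2) by simp
    moreover have "invertible (k ** g)"
      using k GLQ_subset_GLO[OF e(2)] inv_g by (intro invertible_mult_GLO) auto
    ultimately show "k ** g \<in> S" using d(2) by blast
  qed
next
  assume S: "S \<subseteq> {g. invertible g} \<and> (\<forall>g\<in>S. \<exists>e>0. e < 1 \<and> (\<forall>k\<in>GLQ e. k ** g \<in> S))"
  have "open S"
    unfolding open_dist
  proof
    fix g assume "g \<in> S"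
    then obtain e where e: "0 < e" "\<And>k. k \<in> GLQ e \<Longrightarrow> k ** g \<in> S" and "invertible g" using S by blast
    then obtain g' where g': "g ** g' = mat 1" "g' ** g = mat 1" by (auto simp: invertible_def)
    obtain d where d: "0 < d" "\<And>B :: 'c ^ 'n ^ 'n. bnd d B \<Longrightarrow> bnd e (B ** g')"
      using ex_bnd_scaled[OF e(1), of g'] by blast
    show "\<exists>d>0. \<forall>h. dist h g < d \<longrightarrow> h \<in> S"
    proof (intro exI[of _ d] conjI allI impI d(1))
      fix h assume "dist h g < d"
      then have "bnd e ((h - g) ** g')" by (intro d(2) bnd_if_dist) simp
      then have "h ** g' \<in> GLQ e" by (simp add: GLQ_def matrix_diff_mult g')
      then have "(h ** g') ** g \<in> S" by (rule e(2))
      then show "h \<in> S" by (simp add: g' flip: matrix_mul_assoc)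
    qed
  qed
  then show "openin (top_of_set {g. invertible g}) S"
    using S by (auto simp: openin_open)
qed

lemma openin_PG_iff:
  fixes V :: "('c, 'n::finite) pmat set"
  shows "openin PG_top V \<longleftrightarrow> V \<subseteq> PG \<and>
    (\<forall>g. invertible g \<longrightarrow> pclass g \<in> V \<longrightarrow> (\<exists>e>0. e < 1 \<and> (\<forall>k\<in>GLQ e. pclass (k ** g) \<in> V)))"
    (is "?l \<longleftrightarrow> ?r")
proof -
  let ?S = "{g. invertible g \<and> pclass g \<in> V}"
  have "?l \<longleftrightarrow> V \<subseteq> PG \<and> openin (top_of_set {g. invertible g}) ?S"
    by (simp add: PG_top_def openin_quotient_topology PG_def)
  also have "\<dots> \<longleftrightarrow> ?r"
  proof -
    have "(\<forall>k\<in>GLQ e. k ** g \<in> ?S) \<longleftrightarrow> (\<forall>k\<in>GLQ e. pclass (k ** g) \<in> V)"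
      if "invertible g" "e < 1" for g e
      using invertible_mult_GLO[OF _ that(1)] GLQ_subset_GLO[OF that(2)] by auto
    then have *: "(\<exists>e>0. e < 1 \<and> (\<forall>k\<in>GLQ e. k ** g \<in> ?S)) \<longleftrightarrow>
        (\<exists>e>0. e < 1 \<and> (\<forall>k\<in>GLQ e. pclass (k ** g) \<in> V))" if "invertible g" for g
      using that by meson
    have "openin (top_of_set {g. invertible g}) ?S \<longleftrightarrow> (\<forall>g. invertible g \<longrightarrow> pclass g \<in> V \<longrightarrow>
        (\<exists>e>0. e < 1 \<and> (\<forall>k\<in>GLQ e. k ** g \<in> ?S)))"
      unfolding openin_GL_iff by blast
    then show ?thesis by (simp only: * cong: imp_cong)
  qed
  finally show ?thesis .
qed

lemma topspace_PG [simp]: "topspace PG_top = (PG :: ('c, 'n::finite) pmat set)"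
  by (simp add: PG_top_def PG_def)

definition lat :: "'c ^ 'n ^ 'n \<Rightarrow> ('c ^ 'n) set set" where
  "lat g = homothety_class ((\<lambda>x. g *v x) ` standard_lattice R)"

lemma pact_lat: "pact (pclass g) (lat h) = lat (g ** h)"
  by (simp add: lat_def pact_class image_image matrix_vector_mul_assoc)

lemma pact_standard: "pact (pclass g) (homothety_class (standard_lattice R)) = lat g"
  by (simp add: lat_def pact_class)

lemma topspace_PX_lat: "topspace (PX_top R) = (lat :: 'c ^ 'n::finite ^ 'n \<Rightarrow> _) ` {g. invertible g}"
  by (simp add: PX_top_def PG_top_def image_image pact_standard)

lemma openin_PX_iff:
  fixes V :: "('c ^ 'n::finite) set set set"
  shows "openin (PX_top R) V \<longleftrightarrow> V \<subseteq> lat ` {g. invertible g} \<and>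
    (\<forall>g. invertible g \<longrightarrow> lat g \<in> V \<longrightarrow> (\<exists>e>0. e < 1 \<and> (\<forall>k\<in>GLQ e. lat (k ** g) \<in> V)))"
    (is "?l \<longleftrightarrow> ?r")
proof -
  let ?S = "{P\<in>PG. pact P (homothety_class (standard_lattice R)) \<in> V}"
  have mem: "pclass g \<in> ?S \<longleftrightarrow> lat g \<in> V" if "invertible g" for g :: "'c ^ 'n ^ 'n"
    using that by (auto simp: PG_def pact_standard)
  have "?l \<longleftrightarrow> V \<subseteq> lat ` {g. invertible g} \<and> openin PG_top ?S"
  proof -
    have "(\<lambda>P. pact P (homothety_class (standard_lattice R))) ` PG = lat ` {g :: 'c ^ 'n ^ 'n. invertible g}"
      by (simp add: PG_def image_image pact_standard)
    then show ?thesis by (simp only: PX_top_def openin_quotient_topology topspace_PG)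
  qed
  also have "\<dots> \<longleftrightarrow> ?r"
  proof -
    have "(\<forall>k\<in>GLQ e. pclass (k ** g) \<in> ?S) \<longleftrightarrow> (\<forall>k\<in>GLQ e. lat (k ** g) \<in> V)"
      if "invertible g" "e < 1" for g :: "'c ^ 'n ^ 'n" and e
      using mem invertible_mult_GLO[OF _ that(1)] GLQ_subset_GLO[OF that(2)] by (auto 4 3)
    then have *: "(\<exists>e>0. e < 1 \<and> (\<forall>k\<in>GLQ e. pclass (k ** g) \<in> ?S)) \<longleftrightarrow>
        (\<exists>e>0. e < 1 \<and> (\<forall>k\<in>GLQ e. lat (k ** g) \<in> V))" if "invertible g" for g :: "'c ^ 'n ^ 'n"
      using that by meson
    have "?S \<subseteq> PG" by blast
    then have "openin PG_top ?S \<longleftrightarrow> (\<forall>g. invertible g \<longrightarrow> lat g \<in> V \<longrightarrow> (\<exists>e>0. e < 1 \<and> (\<forall>k\<in>GLQ e. lat (k ** g) \<in> V)))"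
      unfolding openin_PG_iff by (simp only: * mem simp_thms cong: imp_cong)
    then show ?thesis by simp
  qed
  finally show ?thesis .
qed

lemma openin_PG_orbit:
  assumes g: "invertible (g :: 'c ^ 'n::finite ^ 'n)"
  shows "openin PG_top ((\<lambda>k. pclass (k ** g)) ` GLO)"
  unfolding openin_PG_iff
proof (intro conjI allI impI)
  show "(\<lambda>k. pclass (k ** g)) ` GLO \<subseteq> PG" using g by (auto simp: PG_def intro: invertible_mult_GLO)
  fix h assume "pclass h \<in> (\<lambda>k. pclass (k ** g)) ` GLO"
  then obtain k where k: "k \<in> GLO" "pclass h = pclass (k ** g)" by blast
  have "pclass (q ** h) \<in> (\<lambda>k. pclass (k ** g)) ` GLO" if "q \<in> GLQ (1/2)" for q
  proof -
    have "q ** k \<in> GLO" using that GLQ_subset_GLO[of "1/2"] k(1) by (auto intro: GLO_mult)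
    moreover have "pclass (q ** h) = pclass ((q ** k) ** g)"
      using k(2) by (metis pmult_class matrix_mul_assoc)
    ultimately show ?thesis by blast
  qed
  then show "\<exists>e>0. e < 1 \<and> (\<forall>q\<in>GLQ e. pclass (q ** h) \<in> (\<lambda>k. pclass (k ** g)) ` GLO)"
    by (intro exI[of _ "1/2"]) simp
qed

text \<open>\<open>H\<close> will be \<open>GLO\<close> or some \<open>GLQ e\<close>. Closure under
  products makes the orbit a neighbourhood of each of its points, not just of
  \<open>lat g\<close>.\<close>

lemma openin_PX_orbit:
  fixes g :: "'c ^ 'n::finite ^ 'n"
  assumes g: "invertible g" and H: "H \<subseteq> GLO" "\<And>k l. k \<in> H \<Longrightarrow> l \<in> H \<Longrightarrow> k ** l \<in> H"
    "0 < e" "e < 1" "GLQ e \<subseteq> H"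
  shows "openin (PX_top R) ((\<lambda>k. lat (k ** g)) ` H)"
  unfolding openin_PX_iff
proof (intro conjI allI impI)
  show "(\<lambda>k. lat (k ** g)) ` H \<subseteq> lat ` {g. invertible g}" using g H(1) by (auto intro: invertible_mult_GLO)
  fix h assume "lat h \<in> (\<lambda>k. lat (k ** g)) ` H"
  then obtain k where k: "k \<in> H" "lat h = lat (k ** g)" by blast
  have "lat (q ** h) \<in> (\<lambda>k. lat (k ** g)) ` H" if "q \<in> GLQ e" for q
  proof -
    have "q ** k \<in> H" using that H k(1) by blast
    moreover have "lat (q ** h) = lat ((q ** k) ** g)"
      using k(2) by (metis pact_lat matrix_mul_assoc)
    ultimately show ?thesis by blast
  qed
  then show "\<exists>e>0. e < 1 \<and> (\<forall>q\<in>GLQ e. lat (q ** h) \<in> (\<lambda>k. lat (k ** g)) ` H)"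
    using H(3,4) by (intro exI[of _ e]) simp
qed

text \<open>Closed, because a matrix within 1/2 of a member \<open>l\<close> is the product of
  \<open>l\<close> with an element of \<open>GLQ (1/2)\<close> and so is a member; totally bounded,
  because all entries lie in the unit ball.\<close>

lemma compact_GLO: "compact (GLO :: ('c ^ 'n::finite ^ 'n) set)"
  unfolding compact_eq_totally_bounded complete_eq_closed
proof (intro conjI allI impI)
  have "open (- (GLO :: ('c ^ 'n ^ 'n) set))"
    unfolding open_dist
  proof
    fix k :: "'c ^ 'n ^ 'n" assume k: "k \<in> - GLO"
    have "l \<notin> GLO" if "dist l k < 1/2" for l
    proof
      assume l: "l \<in> GLO"
      then obtain m where m: "m \<in> GLO" "l ** m = mat 1" "m ** l = mat 1" using GLO_inverse by blast
      have "dist k l \<le> 1/2" using that by (simp add: dist_commute)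
      then have "bnd (1/2) (k - l)" by (rule bnd_if_dist)
      then have "bnd (1/2 * 1) ((k - l) ** m)" by (rule bnd_mult) (use m in \<open>simp add: GLO_def\<close>)
      then have "k ** m \<in> GLQ (1/2)" by (simp add: GLQ_def matrix_diff_mult m)
      then have "k ** m \<in> GLO" using GLQ_subset_GLO[of "1/2"] by auto
      then have "k ** m ** l \<in> GLO" using l by (rule GLO_mult)
      then show False using k m by (simp flip: matrix_mul_assoc)
    qed
    then show "\<exists>e>0. \<forall>l. dist l k < e \<longrightarrow> l \<in> - GLO" by (intro exI[of _ "1/2"]) auto
  qed
  then show "closed (GLO :: ('c ^ 'n ^ 'n) set)" by (simp add: closed_open)
next
  fix \<epsilon> :: real assume \<epsilon>: "0 < \<epsilon>"
  define e where "e = \<epsilon> / (2 * (real CARD('n) * real CARD('n)))"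
  have n0: "0 < real CARD('n)" by simp
  have e: "0 < e" "real CARD('n) * (real CARD('n) * e) < \<epsilon>" using \<epsilon> n0 by (auto simp: e_def field_simps)
  obtain F :: "'c set" where F: "finite F" "\<forall>x. dist x 0 \<le> 1 \<longrightarrow> (\<exists>y\<in>F. dist x y < e)"
    using balls_totally_bounded[OF e(1), of 1] by blast
  let ?F = "{k :: 'c ^ 'n ^ 'n. \<forall>i j. k $ i $ j \<in> F}"
  have "GLO \<subseteq> (\<Union>x\<in>?F. ball x \<epsilon>)"
  proof
    fix k :: "'c ^ 'n ^ 'n" assume "k \<in> GLO"
    then have "dist (k $ i $ j) 0 \<le> 1" for i j using bndD[of 1 k] by (simp add: GLO_def av_def)
    then have "\<forall>i j. \<exists>y. y \<in> F \<and> dist (k $ i $ j) y < e" using F(2) by blast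
    then obtain y where y: "\<And>i j. y i j \<in> F" "\<And>i j. dist (k $ i $ j) (y i j) < e" by metis
    define l where "l = (\<chi> i j. y i j)"
    have "bnd e (l - k)" using y(2) by (auto simp: bnd_def l_def dist_commute intro: less_imp_le simp flip: dist_av)
    from dist_if_bnd[OF this] have "dist l k < \<epsilon>" using e(2) by simp
    moreover have "l \<in> ?F" using y(1) by (simp add: l_def)
    ultimately show "k \<in> (\<Union>x\<in>?F. ball x \<epsilon>)" by auto
  qed
  then show "\<exists>F :: ('c ^ 'n ^ 'n) set. finite F \<and> GLO \<subseteq> (\<Union>x\<in>F. ball x \<epsilon>)"
    by (intro exI[of _ ?F] conjI finite_matrix_in F(1))
qed

text \<open>Near a point \<open>k\<close> of \<open>GLO\<close> every matrix has the form
  \<open>q ** k\<close> with \<open>q\<close> in \<open>GLQ e\<close>, so \<open>loc\<close> amounts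
  to continuity of \<open>f\<close> on \<open>C\<close>.\<close>

lemma compactin_GLO_image:
  fixes C :: "('c ^ 'n::finite ^ 'n) set" and f :: "'c ^ 'n ^ 'n \<Rightarrow> 'b"
  assumes C: "closed C" "C \<subseteq> GLO" and f: "f ` C \<subseteq> topspace Y"
    and loc: "\<And>V k. openin Y V \<Longrightarrow> k \<in> C \<Longrightarrow> f k \<in> V \<Longrightarrow> \<exists>e>0. \<forall>q\<in>GLQ e. f (q ** k) \<in> V"
  shows "compactin Y (f ` C)"
proof (rule image_compactin)
  have "compact (GLO \<inter> C)" using compact_GLO C(1) by (rule compact_Int_closed)
  then have "compact C" using C(2) by (simp add: Int_absorb1)
  then show "compactin (top_of_set C) C" by (simp add: compactin_subtopology)
  show "continuous_map (top_of_set C) Y f"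
    unfolding continuous_map_def
  proof (intro conjI allI impI)
    show "f \<in> topspace (top_of_set C) \<rightarrow> topspace Y" using f by auto
    fix V assume V: "openin Y V"
    show "openin (top_of_set C) {x \<in> topspace (top_of_set C). f x \<in> V}"
      unfolding openin_euclidean_subtopology_iff
    proof (intro conjI ballI)
      fix k assume "k \<in> {x \<in> topspace (top_of_set C). f x \<in> V}"
      then have k: "k \<in> C" "f k \<in> V" by auto
      obtain m where m: "m \<in> GLO" "k ** m = mat 1" "m ** k = mat 1" using GLO_inverse k(1) C(2) by blast
      obtain e where e: "0 < e" "\<And>q. q \<in> GLQ e \<Longrightarrow> f (q ** k) \<in> V" using loc[OF V k] by blast
      have "f l \<in> V" if "dist l k < e" for l
      proof -
        have "bnd (e * 1) ((l - k) ** m)"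
          using that m(1) by (intro bnd_mult bnd_if_dist) (auto simp: GLO_def)
        then have "l ** m \<in> GLQ e" by (simp add: GLQ_def matrix_diff_mult m)
        from e(2)[OF this] show ?thesis by (simp add: m flip: matrix_mul_assoc)
      qed
      then show "\<exists>e>0. \<forall>l\<in>C. dist l k < e \<longrightarrow> l \<in> {x \<in> topspace (top_of_set C). f x \<in> V}"
        using e(1) by (intro exI[of _ e]) simp
    qed auto
  qed
qed

lemma compactin_PX_orbit:
  assumes g: "invertible (g :: 'c ^ 'n::finite ^ 'n)"
  shows "compactin (PX_top R) ((\<lambda>k. lat (k ** g)) ` GLO)"
proof (rule compactin_GLO_image)
  show "closed (GLO :: ('c ^ 'n ^ 'n) set)" by (rule compact_imp_closed[OF compact_GLO])
  show "(\<lambda>k. lat (k ** g)) ` GLO \<subseteq> topspace (PX_top R)"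
    unfolding topspace_PX_lat using g by (auto intro: invertible_mult_GLO)
  fix V and k :: "'c ^ 'n ^ 'n" assume V: "openin (PX_top R) V" "k \<in> GLO" "lat (k ** g) \<in> V"
  have "invertible (k ** g)" using g V(2) by (rule_tac invertible_mult_GLO)
  then obtain e where "0 < e" "\<forall>q\<in>GLQ e. lat (q ** (k ** g)) \<in> V"
    using V(1,3) unfolding openin_PX_iff by blast
  then show "\<exists>e>0. \<forall>q\<in>GLQ e. lat ((q ** k) ** g) \<in> V" by (auto simp: matrix_mul_assoc)
qed simp

lemma diag_matrix_mult: "diag_matrix a ** diag_matrix b = diag_matrix (\<lambda>i. a i * (b i :: 'c))"
proof -
  have "(\<Sum>k\<in>UNIV. (if i = k then a i else 0) * (if k = j then b k else 0)) = (if i = j then a i * b i else 0)" for i j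
  proof -
    have "(\<Sum>k\<in>UNIV. (if i = k then a i else 0) * (if k = j then b k else 0)) =
        (\<Sum>k\<in>UNIV. if k = i then (if i = j then a i * b i else 0) else 0)"
      by (intro sum.cong) auto
    then show ?thesis by simp
  qed
  then show ?thesis by (simp add: diag_matrix_def matrix_matrix_mult_def vec_eq_iff)
qed

lemma det_diag_matrix: "det (diag_matrix a) = prod a UNIV" for a :: "'n::finite \<Rightarrow> 'c"
  using det_diagonal[of "diag_matrix a"] by (simp add: diag_matrix_def)

lemma invertible_diag_matrix: "(\<And>i. a i \<noteq> 0) \<Longrightarrow> invertible (diag_matrix a)" for a :: "'n::finite \<Rightarrow> 'c"
  by (simp add: invertible_det_nz det_diag_matrix)

lemma diag_matrix_in_GLO_iff: "diag_matrix a \<in> GLO \<longleftrightarrow> (\<forall>i. av (a i) = 1)" for a :: "'n::finite \<Rightarrow> 'c"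
proof
  assume "diag_matrix a \<in> GLO"
  then have b: "bnd 1 (diag_matrix a)" and d: "(\<Prod>i\<in>UNIV. av (a i)) = 1"
    by (auto simp: GLO_def det_diag_matrix av_prod)
  have le: "av (a i) \<le> 1" for i using bndD[OF b, of i i] by (simp add: diag_matrix_def)
  show "\<forall>i. av (a i) = 1"
  proof
    fix i
    have "1 = av (a i) * (\<Prod>j\<in>UNIV - {i}. av (a j))" unfolding d[symmetric] by (intro prod.remove) auto
    also have "\<dots> \<le> av (a i) * 1" using le by (intro mult_left_mono prod_le_1) auto
    finally show "av (a i) = 1" using le[of i] by simp
  qed
next
  assume "\<forall>i. av (a i) = 1"
  then have "av (det (diag_matrix a)) = 1" "bnd 1 (diag_matrix a)"
    by (simp_all add: det_diag_matrix av_prod) (auto simp: bnd_def diag_matrix_def)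
  then show "diag_matrix a \<in> GLO" by (simp add: GLO_def)
qed

lemma closed_diag: "closed {k :: 'c ^ 'n::finite ^ 'n. \<forall>i j. i \<noteq> j \<longrightarrow> k $ i $ j = 0}"
  by (intro closed_Collect_all closed_Collect_imp open_Collect_const closed_Collect_eq continuous_intros)

lemma compactin_PG_diag_orbit:
  assumes g: "invertible (g :: 'c ^ 'n::finite ^ 'n)"
  shows "compactin PG_top ((\<lambda>u. pclass (diag_matrix u ** g)) ` {u. \<forall>i. av (u i) = 1})"
proof -
  let ?C = "GLO \<inter> {k :: 'c ^ 'n ^ 'n. \<forall>i j. i \<noteq> j \<longrightarrow> k $ i $ j = 0}"
  have C: "?C = diag_matrix ` {u. \<forall>i. av (u i) = 1}"
  proof (intro set_eqI iffI)
    fix k :: "'c ^ 'n ^ 'n" assume k: "k \<in> ?C"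
    then have eq: "k = diag_matrix (\<lambda>i. k $ i $ i)" by (auto simp: diag_matrix_def vec_eq_iff)
    then have "\<forall>i. av (k $ i $ i) = 1" using k diag_matrix_in_GLO_iff[of "\<lambda>i. k $ i $ i"] by auto
    then show "k \<in> diag_matrix ` {u. \<forall>i. av (u i) = 1}" using eq by blast
  next
    fix k :: "'c ^ 'n ^ 'n" assume "k \<in> diag_matrix ` {u. \<forall>i. av (u i) = 1}"
    then obtain u where u: "\<forall>i. av (u i) = 1" "k = diag_matrix u" by blast
    then have "k \<in> GLO" using diag_matrix_in_GLO_iff by blast
    then show "k \<in> ?C" using u(2) by (simp add: diag_matrix_def)
  qed
  have "compactin PG_top ((\<lambda>k. pclass (k ** g)) ` ?C)"
  proof (rule compactin_GLO_image)
    show "closed ?C" by (intro closed_Int closed_diag compact_imp_closed[OF compact_GLO])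
    show "(\<lambda>k. pclass (k ** g)) ` ?C \<subseteq> topspace PG_top"
      using g by (auto simp: PG_def intro: invertible_mult_GLO)
    fix V and k :: "'c ^ 'n ^ 'n" assume V: "openin PG_top V" "k \<in> ?C" "pclass (k ** g) \<in> V"
    have "invertible (k ** g)" using g V(2) by (intro invertible_mult_GLO) auto
    then obtain e where "0 < e" "\<forall>q\<in>GLQ e. pclass (q ** (k ** g)) \<in> V"
      using V(1,3) unfolding openin_PG_iff by blast
    then show "\<exists>e>0. \<forall>q\<in>GLQ e. pclass ((q ** k) ** g) \<in> V" by (auto simp: matrix_mul_assoc)
  qed auto
  then show ?thesis unfolding C by (simp add: image_image)
qed

section \<open>GL(R), equality of lattice classes and the Hausdorff property\<close>

definition GLR :: "('c ^ 'n ^ 'n) set" where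
  "GLR = {\<gamma>. (\<forall>i j. \<gamma> $ i $ j \<in> R) \<and> (\<exists>\<gamma>'. (\<forall>i j. \<gamma>' $ i $ j \<in> R) \<and> \<gamma> ** \<gamma>' = mat 1 \<and> \<gamma>' ** \<gamma> = mat 1)}"

text \<open>The determinant and its inverse are nonzero elements of R, so both have absolute value
  at least 1. Thus |det g| depends on the lattice of \<open>g\<close> alone.\<close>

lemma av_det_GLR: "\<gamma> \<in> GLR \<Longrightarrow> av (det \<gamma>) = 1"
proof -
  assume "\<gamma> \<in> GLR"
  then obtain \<gamma>' where \<gamma>: "\<forall>i j. \<gamma> $ i $ j \<in> R" "\<forall>i j. \<gamma>' $ i $ j \<in> R" "\<gamma> ** \<gamma>' = mat 1"
    by (auto simp: GLR_def)
  have 1: "det \<gamma> * det \<gamma>' = 1" using \<gamma>(3) by (metis det_mul det_I)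
  then have "1 \<le> av (det \<gamma>)" "1 \<le> av (det \<gamma>')"
    using \<gamma> by (auto intro!: R_av_ge_1 R_det)
  moreover have "av (det \<gamma>) * av (det \<gamma>') = 1" using 1 by (simp flip: av_mult)
  ultimately show ?thesis
    by (metis antisym mult_left_mono mult.right_neutral av_nonneg)
qed

lemma lat_eq_imp:
  assumes "invertible g" "invertible h" "lat g = lat (h :: 'c ^ 'n::finite ^ 'n)"
  shows "\<exists>c \<gamma>. c \<noteq> 0 \<and> \<gamma> \<in> GLR \<and> g = mat c ** (h ** \<gamma>)"
proof -
  have "pact (pclass h) (homothety_class (standard_lattice R)) = pact (pclass g) (homothety_class (standard_lattice R))"
    using assms(3) by (simp add: pact_standard)
  then obtain P where P: "P \<in> PGamma R" "pclass g = pmult (pclass h) P"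
    using PX_fibres[OF R_0 R_1 R_add R_mult assms(2,1)] by blast
  then obtain \<gamma> \<gamma>' where \<gamma>: "P = pclass \<gamma>" "\<gamma> ** \<gamma>' = mat 1" "\<gamma>' ** \<gamma> = mat 1"
    "\<forall>i j. \<gamma> $ i $ j \<in> R" "\<forall>i j. \<gamma>' $ i $ j \<in> R" by (auto simp: PGamma_def)
  have "pclass g = pclass (h ** \<gamma>)" using P(2) \<gamma>(1) by (simp add: pmult_class)
  moreover have "g \<in> pclass g" unfolding pclass_def by (rule CollectI, rule exI[of _ 1]) simp
  ultimately obtain c where "c \<noteq> 0" "g = mat c ** (h ** \<gamma>)" by (auto simp: pclass_def)
  moreover have "\<gamma> \<in> GLR" using \<gamma> by (auto simp: GLR_def)
  ultimately show ?thesis by blast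
qed

lemma lat_mult_GLR:
  assumes "c \<noteq> 0" "\<gamma> \<in> GLR" shows "lat (mat c ** (h ** \<gamma>)) = lat (h :: 'c ^ 'n::finite ^ 'n)"
proof -
  obtain \<gamma>' where \<gamma>: "\<forall>i j. \<gamma> $ i $ j \<in> R" "\<forall>i j. \<gamma>' $ i $ j \<in> R" "\<gamma> ** \<gamma>' = mat 1"
    using assms(2) by (auto simp: GLR_def)
  let ?S = "standard_lattice R :: ('c ^ 'n) set"
  have sub: "(\<lambda>x. \<gamma> *v x) ` ?S \<subseteq> ?S" "(\<lambda>x. \<gamma>' *v x) ` ?S \<subseteq> ?S"
    using \<gamma> entries_in_iff[OF R_0 R_1 R_add R_mult] by blast+
  have "x \<in> (\<lambda>x. \<gamma> *v x) ` ?S" if "x \<in> ?S" for x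
  proof -
    have "x = \<gamma> *v (\<gamma>' *v x)" by (simp add: matrix_vector_mul_assoc \<gamma>)
    then show ?thesis using sub(2) that by blast
  qed
  then have eq: "(\<lambda>x. \<gamma> *v x) ` ?S = ?S" using sub(1) by blast
  have "(\<lambda>x. (mat c ** (h ** \<gamma>)) *v x) ` ?S = (\<lambda>x. c *s x) ` (\<lambda>x. h *v x) ` (\<lambda>x. \<gamma> *v x) ` ?S"
    unfolding image_image scaled_mult_vec by (simp add: matrix_vector_mul_assoc)
  then show ?thesis
    unfolding lat_def eq using assms(1) homothety_class_eq_iff by metis
qed

text \<open>Proportionality means that all 2 by 2 minors formed from corresponding entries of
  \<open>g\<close> and \<open>b\<close> vanish; a minor of size \<delta> survives small
  perturbations of \<open>g\<close>.\<close>

lemma not_proportional_locally: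
  fixes g b :: "'c ^ 'n::finite ^ 'n"
  assumes b: "invertible b" and g: "invertible g" and ne: "\<And>c. c \<noteq> 0 \<Longrightarrow> g \<noteq> mat c ** b"
  shows "\<exists>e>0. \<forall>k\<in>GLQ e. \<forall>c. k ** g \<noteq> mat c ** b"
proof -
  have mat_0: "mat 0 = (0 :: 'c ^ 'n ^ 'n)" by (simp add: mat_def vec_eq_iff)
  have det_zero: "det (0 :: 'c ^ 'n ^ 'n) = 0" unfolding mat_0[symmetric] by (rule det_0)
  have "b \<noteq> 0" using b det_zero unfolding invertible_det_nz by metis
  then obtain i j where ij: "b $ i $ j \<noteq> 0" by (auto simp: vec_eq_iff)
  have "\<exists>k l. g $ k $ l * b $ i $ j \<noteq> g $ i $ j * b $ k $ l"
  proof (rule ccontr)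
    assume n: "\<not> ?thesis"
    define c where "c = g $ i $ j / b $ i $ j"
    have gc: "g $ k $ l = c * b $ k $ l" for k l
    proof -
      have "g $ k $ l * b $ i $ j = g $ i $ j * b $ k $ l" using n by blast
      then show ?thesis using ij by (simp add: c_def eq_divide_eq)
    qed
    have eq: "g = mat c ** b" unfolding mat_mult vec_eq_iff by (simp add: gc)
    have "c \<noteq> 0"
    proof
      assume "c = 0"
      then have "g = 0" unfolding vec_eq_iff by (simp add: gc)
      then show False using g det_zero unfolding invertible_det_nz by metis
    qed
    then show False using ne eq by blast
  qed
  then obtain k l where kl: "g $ k $ l * b $ i $ j \<noteq> g $ i $ j * b $ k $ l" by blast
  define \<delta> where "\<delta> = av (g $ k $ l * b $ i $ j - g $ i $ j * b $ k $ l)"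
  have \<delta>: "0 < \<delta>" using kl by (simp add: \<delta>_def av_pos)
  obtain \<rho> where \<rho>: "0 < \<rho>" "bnd \<rho> b" using ex_bnd by blast
  have "0 < \<delta> / (2 * \<rho>)" using \<delta> \<rho> by simp
  then obtain e where e: "0 < e" "\<And>B :: 'c ^ 'n ^ 'n. bnd e B \<Longrightarrow> bnd (\<delta> / (2 * \<rho>)) (B ** g)"
    using ex_bnd_scaled[of "\<delta> / (2 * \<rho>)" g] by blast
  show ?thesis
  proof (intro exI[of _ e] conjI ballI allI notI e(1))
    fix q c assume q: "q \<in> GLQ e" and eq: "q ** g = mat c ** b"
    have "bnd (\<delta> / (2 * \<rho>)) ((q - mat 1) ** g)" using q by (intro e(2)) (simp add: GLQ_def)
    then have d: "bnd (\<delta> / (2 * \<rho>)) (g - q ** g)"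
      using bnd_diff_commute[of _ "q ** g" g] by (simp add: matrix_diff_mult)
    have "(q ** g) $ k $ l * b $ i $ j = (q ** g) $ i $ j * b $ k $ l"
      unfolding eq by (simp add: mat_mult)
    then have "g $ k $ l * b $ i $ j - g $ i $ j * b $ k $ l =
        (g - q ** g) $ k $ l * b $ i $ j - (g - q ** g) $ i $ j * b $ k $ l"
      by (simp add: algebra_simps)
    then have "\<delta> \<le> max (av ((g - q ** g) $ k $ l * b $ i $ j)) (av ((g - q ** g) $ i $ j * b $ k $ l))"
      unfolding \<delta>_def using av_diff by simp
    also have "\<dots> \<le> \<delta> / (2 * \<rho>) * \<rho>"
      unfolding av_mult using bndD[OF d] bndD[OF \<rho>(2)] \<delta> \<rho>(1)
      by (intro max.boundedI mult_mono) (auto simp del: vector_minus_component)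
    also have "\<dots> < \<delta>" using \<delta> \<rho>(1) by simp
    finally show False by simp
  qed
qed

text \<open>If \<open>k ** g\<close> equals c h \<gamma> with \<open>k\<close> in \<open>GLO\<close>
  and \<gamma> in \<open>GLR\<close>, then determinants bound c from below, so \<gamma> is bounded
  and hence one of finitely many. Each of them is avoided for \<open>k\<close> close to 1, and
  \<open>e\<close> is the least of the radii.\<close>

lemma Hausdorff_PX: "Hausdorff_space (PX_top R :: ('c ^ 'n::finite) set set topology)"
  unfolding Hausdorff_space_def
proof (intro allI impI)
  fix x y :: "('c ^ 'n) set set"
  assume xy: "x \<in> topspace (PX_top R) \<and> y \<in> topspace (PX_top R) \<and> x \<noteq> y"
  then obtain g h :: "'c ^ 'n ^ 'n" where g: "invertible g" "x = lat g" and h: "invertible h" "y = lat h"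
    by (auto simp: topspace_PX_lat)
  have ne: "lat g \<noteq> lat h" using xy g h by simp
  obtain h' where h': "h ** h' = mat 1" "h' ** h = mat 1" using h(1) by (auto simp: invertible_def)
  obtain \<rho> where \<rho>: "0 < \<rho>" "bnd \<rho> g" using ex_bnd by blast
  obtain \<sigma> where \<sigma>: "0 < \<sigma>" "bnd \<sigma> h'" using ex_bnd by blast
  define r where "r = av (det g) / av (det h)"
  have dg: "det g \<noteq> 0" and dh: "det h \<noteq> 0" using g h invertible_imp_det by auto
  have r: "0 < r" using dg dh by (simp add: r_def av_pos)
  \<comment> \<open>Comparing determinants gives \<open>av c ^ CARD('n) = r\<close>, and this
    entails \<open>av c\<close> at least \<open>min 1 r\<close>, without extracting roots.\<close>
  define c0 where "c0 = min 1 r"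
  have c0: "0 < c0" using r by (simp add: c0_def)
  define \<Gamma> where "\<Gamma> = {\<gamma> \<in> GLR. bnd (inverse c0 * (\<sigma> * \<rho>)) (\<gamma> :: 'c ^ 'n ^ 'n)}"
  have "\<Gamma> \<subseteq> {\<gamma>. \<forall>i j. \<gamma> $ i $ j \<in> {r\<in>R. av r \<le> inverse c0 * (\<sigma> * \<rho>)}}"
    by (auto simp: \<Gamma>_def GLR_def bnd_def)
  then have fin: "finite \<Gamma>" using finite_matrix_in[OF finite_R_ball] by (rule finite_subset)
  have "\<exists>e>0. \<forall>k\<in>GLQ e. \<forall>c. k ** g \<noteq> mat c ** (h ** \<gamma>)" if \<gamma>: "\<gamma> \<in> \<Gamma>" for \<gamma>
  proof (rule not_proportional_locally)
    have "\<gamma> \<in> GLR" using \<gamma> by (simp add: \<Gamma>_def)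
    then have "invertible \<gamma>" by (auto simp: GLR_def invertible_def)
    then show "invertible (h ** \<gamma>)" using h(1) by (rule_tac invertible_mult)
    show "g \<noteq> mat c ** (h ** \<gamma>)" if "c \<noteq> 0" for c
      using lat_mult_GLR[OF that \<open>\<gamma> \<in> GLR\<close>, of h] ne by metis
  qed (rule g)
  then have "\<forall>\<gamma>\<in>\<Gamma>. \<exists>e. 0 < e \<and> (\<forall>k\<in>GLQ e. \<forall>c. k ** g \<noteq> mat c ** (h ** \<gamma>))" by blast
  then obtain \<epsilon> where \<epsilon>: "\<And>\<gamma>. \<gamma> \<in> \<Gamma> \<Longrightarrow> 0 < \<epsilon> \<gamma>"
    "\<And>\<gamma> k c. \<gamma> \<in> \<Gamma> \<Longrightarrow> k \<in> GLQ (\<epsilon> \<gamma>) \<Longrightarrow> k ** g \<noteq> mat c ** (h ** \<gamma>)" by metis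
  define e where "e = Min (insert (1/2) (\<epsilon> ` \<Gamma>))"
  have e: "0 < e" "e < 1" "\<And>\<gamma>. \<gamma> \<in> \<Gamma> \<Longrightarrow> e \<le> \<epsilon> \<gamma>"
  proof -
    show "0 < e" unfolding e_def using fin \<epsilon>(1) by (subst Min_gr_iff) auto
    have "e \<le> 1/2" unfolding e_def using fin by (intro Min_le) auto
    then show "e < 1" by simp
    show "e \<le> \<epsilon> \<gamma>" if "\<gamma> \<in> \<Gamma>" for \<gamma> unfolding e_def using fin that by (intro Min_le) auto
  qed
  have sep: "lat (k ** g) \<noteq> lat h" if k: "k \<in> GLQ e" for k
  proof
    assume eq: "lat (k ** g) = lat h"
    have kO: "k \<in> GLO" using k GLQ_subset_GLO[OF e(2)] by blast
    obtain c \<gamma> where c: "c \<noteq> 0" "\<gamma> \<in> GLR" "k ** g = mat c ** (h ** \<gamma>)"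
      using lat_eq_imp[OF invertible_mult_GLO[OF kO g(1)] h(1) eq] by blast
    have "av (det (k ** g)) = av (det (mat c ** (h ** \<gamma>)))" using c(3) by simp
    then have "av c ^ CARD('n) = r"
      using kO av_det_GLR[OF c(2)] dh by (simp add: det_mul av_mult GLO_def det_mat av_power r_def)
    have "c0 \<le> av c"
    proof (cases "av c \<le> 1")
      case True
      have "av c ^ CARD('n) \<le> av c ^ 1" using True by (intro power_decreasing) auto
      then show ?thesis using \<open>av c ^ CARD('n) = r\<close> by (simp add: c0_def)
    qed (simp add: c0_def)
    have "h' ** (k ** g) = h' ** (mat c ** (h ** \<gamma>))" using c(3) by simp
    also have "\<dots> = mat c ** ((h' ** h) ** \<gamma>)" by (metis mat_commute matrix_mul_assoc)
    also have "\<dots> = mat c ** \<gamma>" by (simp add: h')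
    finally have "mat (inverse c) ** (h' ** (k ** g)) = mat (inverse c) ** (mat c ** \<gamma>)" by simp
    also have "\<dots> = \<gamma>" using c(1) by (simp add: matrix_mul_assoc mat_mult_mat)
    finally have \<gamma>_eq: "\<gamma> = mat (inverse c) ** (h' ** (k ** g))" ..
    have "bnd (\<sigma> * (1 * \<rho>)) (h' ** (k ** g))"
      using kO by (intro bnd_mult \<sigma> \<rho>) (simp add: GLO_def)
    then have b: "av ((h' ** (k ** g)) $ i $ j) \<le> \<sigma> * \<rho>" for i j by (simp add: bnd_def)
    have "inverse (av c) \<le> inverse c0" using \<open>c0 \<le> av c\<close> c0 by (intro le_imp_inverse_le)
    then have "bnd (inverse c0 * (\<sigma> * \<rho>)) \<gamma>"
      unfolding \<gamma>_eq bnd_def mat_mult using b c0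
      by (auto simp: av_mult av_inverse intro!: mult_mono)
    then have \<gamma>: "\<gamma> \<in> \<Gamma>" using c(2) by (simp add: \<Gamma>_def)
    then have "k \<in> GLQ (\<epsilon> \<gamma>)" using k e(3) bnd_mono by (auto simp: GLQ_def)
    then show False using \<epsilon>(2) \<gamma> c(3) by blast
  qed
  let ?U = "\<lambda>g. (\<lambda>k. lat (k ** g)) ` GLQ e"
  have op: "openin (PX_top R) (?U g)" if "invertible g" for g :: "'c ^ 'n ^ 'n"
    using that e by (intro openin_PX_orbit[of _ _ e] GLQ_subset_GLO GLQ_mult) auto
  have mem: "lat g \<in> ?U g" for g :: "'c ^ 'n ^ 'n"
    using mat_1_in_GLQ[of e] e(1) by (intro image_eqI[of _ _ "mat 1"]) auto
  have disj: "disjnt (?U g) (?U h)"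
    unfolding disjnt_iff
  proof (intro allI notI, elim conjE imageE)
    fix z k l assume kl: "k \<in> GLQ e" "z = lat (k ** g)" "l \<in> GLQ e" "z = lat (l ** h)"
    obtain m where m: "m \<in> GLQ e" "m ** l = mat 1" using GLQ_inverse[OF e(2) kl(3)] by blast
    have "lat (m ** (k ** g)) = lat (m ** (l ** h))" using kl by (simp flip: pact_lat)
    then have "lat ((m ** k) ** g) = lat h" by (simp add: matrix_mul_assoc m)
    moreover have "m ** k \<in> GLQ e" using m(1) kl(1) e(2) by (intro GLQ_mult) auto
    ultimately show False using sep by blast
  qed
  show "\<exists>U V. openin (PX_top R) U \<and> openin (PX_top R) V \<and> x \<in> U \<and> y \<in> V \<and> disjnt U V"
    unfolding g(2) h(2) by (intro exI[of _ "?U g"] exI[of _ "?U h"] conjI op g(1) h(1) mem disj)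
qed

end

section \<open>Axial lattices\<close>

context valued_lattice begin

definition Lset :: "'c ^ 'n ^ 'n \<Rightarrow> ('c ^ 'n) set" where
  "Lset g = (\<lambda>x. g *v x) ` standard_lattice R"

lemma lat_Lset: "lat g = homothety_class (Lset g)"
  by (simp add: lat_def Lset_def)

lemma standard_latticeD: "x \<in> standard_lattice R \<Longrightarrow> x $ i \<in> R"
  by (simp add: standard_lattice_def)

lemma Lset_add: "x \<in> Lset g \<Longrightarrow> y \<in> Lset g \<Longrightarrow> x + y \<in> Lset g"
proof -
  assume "x \<in> Lset g" "y \<in> Lset g"
  then obtain r s where "r \<in> standard_lattice R" "x = g *v r" "s \<in> standard_lattice R" "y = g *v s"
    by (auto simp: Lset_def)
  then have "x + y = g *v (r + s)" "r + s \<in> standard_lattice R"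
    by (simp_all add: matrix_vector_right_distrib standard_lattice_def R_add)
  then show ?thesis by (simp add: Lset_def)
qed

lemma Lset_scale: "a \<in> R \<Longrightarrow> x \<in> Lset g \<Longrightarrow> a *s x \<in> Lset g"
proof -
  assume a: "a \<in> R" and "x \<in> Lset g"
  then obtain r where "r \<in> standard_lattice R" "x = g *v r" by (auto simp: Lset_def)
  then have "a *s x = g *v (a *s r)" "a *s r \<in> standard_lattice R"
    using a by (simp_all add: vec.scale standard_lattice_def R_mult)
  then show ?thesis by (simp add: Lset_def)
qed

lemma Lset_diff: "x \<in> Lset g \<Longrightarrow> y \<in> Lset g \<Longrightarrow> x - y \<in> Lset g"
  using Lset_add[of x g "(-1) *s y"] Lset_scale[of "-1" y g] R_uminus[OF R_1] by simp

lemma Lset_0: "0 \<in> Lset g"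
  unfolding Lset_def using R_0 by (intro image_eqI[of _ _ 0]) (auto simp: standard_lattice_def)

lemma finite_Lset_ball:
  assumes g: "invertible (g :: 'c ^ 'n::finite ^ 'n)"
  shows "finite {x \<in> Lset g. \<forall>i. av (x $ i) \<le> \<rho>}"
proof -
  obtain g' where g': "g' ** g = mat 1" using g by (auto simp: invertible_def)
  obtain \<sigma> where \<sigma>: "0 < \<sigma>" "bnd \<sigma> g'" using ex_bnd by blast
  let ?r = "\<sigma> * max \<rho> 0"
  have "{x \<in> Lset g. \<forall>i. av (x $ i) \<le> \<rho>} \<subseteq> (\<lambda>x. g *v x) ` {r. \<forall>i. r $ i \<in> {r\<in>R. av r \<le> ?r}}"
  proof
    fix x assume x: "x \<in> {x \<in> Lset g. \<forall>i. av (x $ i) \<le> \<rho>}"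
    then obtain r where r: "r \<in> standard_lattice R" "x = g *v r" by (auto simp: Lset_def)
    have "r = g' *v x" by (simp add: r(2) matrix_vector_mul_assoc g')
    then have "r $ i = (\<Sum>j\<in>UNIV. g' $ i $ j * x $ j)" for i by (simp add: matrix_vector_mult_def)
    moreover have "av (\<Sum>j\<in>UNIV. g' $ i $ j * x $ j) \<le> ?r" for i
      using \<sigma> x bndD[OF \<sigma>(2)]
      by (intro av_sum_le) (auto simp: av_mult le_max_iff_disj intro!: mult_mono)
    ultimately have "\<forall>i. r $ i \<in> {r\<in>R. av r \<le> ?r}" using standard_latticeD[OF r(1)] by simp
    then show "x \<in> (\<lambda>x. g *v x) ` {r. \<forall>i. r $ i \<in> {r\<in>R. av r \<le> ?r}}" using r(2) by blast
  qed
  moreover have "finite {r :: 'c ^ 'n. \<forall>i. r $ i \<in> {r\<in>R. av r \<le> ?r}}" by (intro finite_vec_in finite_R_ball)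
  ultimately show ?thesis using finite_surj by blast
qed

lemma Lset_cobounded:
  assumes g: "invertible (g :: 'c ^ 'n::finite ^ 'n)"
  shows "\<exists>C. \<forall>x. \<exists>l\<in>Lset g. \<forall>i. av ((x - l) $ i) \<le> C"
proof -
  obtain g' where g': "g ** g' = mat 1" using g by (auto simp: invertible_def)
  obtain \<sigma> where \<sigma>: "0 < \<sigma>" "bnd \<sigma> g" using ex_bnd by blast
  obtain C where C: "\<forall>x. \<exists>r\<in>R. dist x r \<le> C" using R_cocompact by blast
  show ?thesis
  proof (intro exI[of _ "\<sigma> * max C 0"] allI)
    fix x :: "'c ^ 'n"
    have "\<forall>i. \<exists>r. r \<in> R \<and> av ((g' *v x) $ i - r) \<le> C" using C by (auto simp: dist_av)
    then obtain r where r: "\<And>i. r i \<in> R" "\<And>i. av ((g' *v x) $ i - r i) \<le> C" by metis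
    let ?r = "\<chi> i. r i"
    have "x - g *v ?r = g *v (g' *v x - ?r)"
      by (simp add: matrix_vector_mult_diff_distrib matrix_vector_mul_assoc g')
    then have "(x - g *v ?r) $ i = (\<Sum>j\<in>UNIV. g $ i $ j * ((g' *v x) $ j - r j))" for i
      by (simp add: matrix_vector_mult_def)
    moreover have "av (\<Sum>j\<in>UNIV. g $ i $ j * ((g' *v x) $ j - r j)) \<le> \<sigma> * max C 0" for i
      using \<sigma> r(2) bndD[OF \<sigma>(2)]
      by (intro av_sum_le) (auto simp: av_mult le_max_iff_disj intro!: mult_mono)
    moreover have "g *v ?r \<in> Lset g" unfolding Lset_def using r(1) by (auto simp: standard_lattice_def)
    ultimately show "\<exists>l\<in>Lset g. \<forall>i. av ((x - l) $ i) \<le> \<sigma> * max C 0"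
      by (intro bexI[of _ "g *v ?r"]) simp_all
  qed
qed

definition axial :: "'c ^ 'n ^ 'n \<Rightarrow> bool" where
  "axial g \<longleftrightarrow> (\<forall>i. \<exists>c. c \<noteq> 0 \<and> c *s axis i 1 \<in> Lset g)"

text \<open>The signs are opposite to those in \<open>PD\<close>, so that \<open>dm t\<close>
  carries the box with exponents \<open>t\<close> in \<open>box_free\<close> onto the open unit
  ball.\<close>

definition dm :: "('n \<Rightarrow> int) \<Rightarrow> 'c ^ 'n ^ 'n" where
  "dm t = diag_matrix (\<lambda>i. p powi t i)"

lemma diag_mult_vec: "(diag_matrix a *v x) $ i = a i * (x :: 'c ^ 'n::finite) $ i"
proof -
  have "(diag_matrix a *v x) $ i = (\<Sum>j\<in>UNIV. if j = i then a i * x $ i else 0)"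
    unfolding matrix_vector_mult_def diag_matrix_def vec_lambda_beta by (intro sum.cong) auto
  then show ?thesis by simp
qed

lemma invertible_dm: "invertible (dm t :: 'c ^ 'n::finite ^ 'n)"
  unfolding dm_def using av_p by (intro invertible_diag_matrix) simp

lemma pclass_eq_imp:
  assumes "pclass g = pclass (h :: 'c ^ 'n::finite ^ 'n)" shows "\<exists>c. c \<noteq> 0 \<and> g = mat c ** h"
proof -
  have "g \<in> pclass g" unfolding pclass_def by (rule CollectI, rule exI[of _ 1]) simp
  then show ?thesis using assms by (auto simp: pclass_def)
qed

lemma PD_eq: "PD p = range (\<lambda>t. pclass (dm t :: 'c ^ 'n::finite ^ 'n))"
proof -
  have "pclass (diag_matrix (\<lambda>i. p powi (- k i))) \<in> range (\<lambda>t. pclass (dm t))" for k :: "'n \<Rightarrow> int"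
    by (intro range_eqI[of _ _ "\<lambda>i. - k i"]) (simp add: dm_def)
  moreover have "pclass (dm t) \<in> PD p" for t :: "'n \<Rightarrow> int"
    unfolding PD_def by (rule CollectI, intro exI[of _ "\<lambda>i. - t i"]) (simp add: dm_def)
  ultimately show ?thesis unfolding PD_def by blast
qed

lemma pclass_dm_shift: "pclass (dm (\<lambda>i. t i + s)) = pclass (dm t :: 'c ^ 'n::finite ^ 'n)"
proof -
  have "dm (\<lambda>i. t i + s) = mat (p powi s) ** (dm t :: 'c ^ 'n ^ 'n)"
    using av_p(3) by (simp add: dm_def diag_matrix_def mat_mult vec_eq_iff power_int_add)
  then show ?thesis using pclass_scale[of "p powi s" "dm t"] av_p(3) by simp
qed

lemma av_det_dm: "av (det (dm t :: 'c ^ 'n::finite ^ 'n)) = av p powi (\<Sum>i\<in>UNIV. t i)"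
proof -
  have "(\<Prod>i\<in>I. av p powi t i) = av p powi (\<Sum>i\<in>I. t i)" for I :: "'n set"
    using av_p by (induction I rule: infinite_finite_induct) (simp_all add: power_int_add)
  then show ?thesis by (simp add: dm_def det_diag_matrix av_prod av_powi)
qed

lemma av_powi_inj: "av p powi k = av p powi l \<Longrightarrow> k = l"
  using av_powi_le_iff by (metis order_antisym order_refl)

text \<open>The translate \<open>dm t L\<close> contains \<open>n\<close> vectors on the axes; if it is, up to homothety, in a
  fixed orbit of \<open>GLO\<close>, then these cannot be too short, and the covolume is prescribed.\<close>

lemma finite_PD_orbit:
  fixes g h :: "'c ^ 'n::finite ^ 'n"
  assumes g: "invertible g" and h: "invertible h" and ax: "axial g"
  shows "finite {P \<in> PD p. pact P (lat g) \<in> (\<lambda>k. lat (k ** h)) ` GLO}"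
proof -
  obtain D where D: "\<And>i. D i \<noteq> 0" "\<And>i. D i *s axis i 1 \<in> Lset g"
    using ax unfolding axial_def by metis
  obtain h' where h': "h' ** h = mat 1" using h by (auto simp: invertible_def)
  obtain \<sigma> where \<sigma>: "0 < \<sigma>" "bnd \<sigma> h'" using ex_bnd by blast
  \<comment> \<open>A nonzero vector of a lattice in the orbit of \<open>h\<close> has an entry of
    absolute value at least \<open>inverse \<sigma>\<close>; scaled by \<open>p powi B i\<close>,
    the i-th axis vector is shorter than that.\<close>
  have "\<forall>i. \<exists>k. 0 \<le> k \<and> av p powi k < inverse \<sigma> / av (D i)"
    using av_powi_small \<sigma>(1) D(1) av_pos by simp
  then obtain B where B: "\<And>i. 0 \<le> B i" "\<And>i. av p powi B i < inverse \<sigma> / av (D i)" by metis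
  define M where "M = (\<Sum>i\<in>UNIV. B i)"
  have BM: "B i \<le> M" for i unfolding M_def by (intro member_le_sum B) auto
  have M0: "0 \<le> M" unfolding M_def by (intro sum_nonneg B)
  have dg: "av (det g) \<noteq> 0" and dh: "av (det h) \<noteq> 0" using g h invertible_imp_det by auto
  have key: "\<exists>s. (\<forall>i. t i + s \<le> M) \<and> av p powi (\<Sum>i\<in>UNIV. t i + s) * av (det g) = av (det h)"
    if t: "lat (dm t ** g) \<in> (\<lambda>k. lat (k ** h)) ` GLO" for t
  proof -
    obtain k where k: "k \<in> GLO" "lat (dm t ** g) = lat (k ** h)" using t by blast
    obtain c \<gamma> where c: "c \<noteq> 0" "\<gamma> \<in> GLR" "dm t ** g = mat c ** (k ** h ** \<gamma>)"
      using lat_eq_imp[OF invertible_mult[OF invertible_dm g] invertible_mult_GLO[OF k(1) h] k(2)] by blast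
    obtain s where s: "av c = av p powi s" using av_eq_powi[OF c(1)] by blast
    obtain k' where k': "k' \<in> GLO" "k' ** k = mat 1" using GLO_inverse[OF k(1)] by blast
    have b: "bnd (\<sigma> * 1) (h' ** k')" using k'(1) \<sigma>(2) by (intro bnd_mult) (auto simp: GLO_def)
    have "t i - s \<le> M" for i
    proof (rule ccontr)
      assume "\<not> t i - s \<le> M"
      then have ti: "B i \<le> t i - s" using BM[of i] by linarith
      obtain r where r: "r \<in> standard_lattice R" "D i *s axis i 1 = g *v r" using D(2)[of i] by (auto simp: Lset_def)
      \<comment> \<open>\<open>y\<close> holds the coordinates, relative to \<open>k ** h\<close>
        and up to the scalar \<open>c\<close>, of the translated axis vector. They lie in R, and the
        assumption on \<open>t i - s\<close> makes them smaller than 1, hence zero.\<close>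
      define y where "y = \<gamma> *v r"
      have y: "y $ l \<in> R" for l
        unfolding y_def matrix_vector_mult_def vec_lambda_beta using c(2) standard_latticeD[OF r(1)]
        by (auto simp: GLR_def intro!: R_sum R_mult)
      have "dm t *v (D i *s axis i 1) = c *s ((k ** h) *v y)"
        unfolding r(2) y_def matrix_vector_mul_assoc c(3) scaled_mult_vec ..
      then have "(h' ** k') *v (dm t *v (D i *s axis i 1)) = c *s ((h' ** k') *v ((k ** h) *v y))"
        by (simp add: vec.scale)
      also have "(h' ** k') *v ((k ** h) *v y) = (h' ** (k' ** k) ** h) *v y"
        by (simp add: matrix_vector_mul_assoc matrix_mul_assoc)
      also have "\<dots> = y" by (simp add: k'(2) h')
      finally have cy: "c *s y = (h' ** k') *v (dm t *v (D i *s axis i 1))" ..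
      define z where "z = dm t *v (D i *s axis i 1)"
      define H where "H = h' ** k'"
      have zl: "z $ l = (if l = i then p powi t i * D i else 0)" for l
        unfolding z_def dm_def diag_mult_vec by (simp add: axis_def)
      have "c * y $ l = (\<Sum>j\<in>UNIV. H $ l $ j * z $ j)" for l
        using arg_cong[OF cy[folded z_def H_def], of "\<lambda>x. x $ l"] by (simp add: matrix_vector_mult_def)
      then have "c * y $ l = (h' ** k') $ l $ i * (p powi t i * D i)" for l
        by (simp add: zl H_def if_distrib cong: if_cong)
      then have "av c * av (y $ l) = av ((h' ** k') $ l $ i) * (av p powi t i * av (D i))" for l
        by (metis av_mult av_powi)
      then have "av c * av (y $ l) \<le> \<sigma> * (av p powi t i * av (D i))" for l
        using mult_right_mono[OF bndD[OF b, of l i], of "av p powi t i * av (D i)"] av_powi_pos[of "t i"] by simp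
      moreover have "\<sigma> * (av p powi t i * av (D i)) < av c"
      proof -
        have "av p powi t i = av p powi (t i - s) * av c" using s av_p(3) by (simp flip: power_int_add)
        moreover have "av p powi (t i - s) * (\<sigma> * av (D i)) < 1"
        proof -
          have pos: "0 < \<sigma> * av (D i)" using \<sigma>(1) av_pos[OF D(1), of i] by simp
          have "av p powi (t i - s) * (\<sigma> * av (D i)) \<le> av p powi B i * (\<sigma> * av (D i))"
            using ti pos by (intro mult_right_mono) (auto simp: av_powi_le_iff)
          also have "\<dots> < inverse \<sigma> / av (D i) * (\<sigma> * av (D i))"
            using B(2)[of i] pos by (rule mult_strict_right_mono)
          also have "\<dots> = 1" using \<sigma>(1) D(1)[of i] by simp
          finally show ?thesis .
        qed
        ultimately show ?thesis using av_pos[OF c(1)] by (simp add: ac_simps)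
      qed
      ultimately have "av c * av (y $ l) < av c * 1" for l by (metis mult.right_neutral order_le_less_trans)
      then have "av (y $ l) < 1" for l using av_pos[OF c(1)] by (metis mult_less_cancel_left_pos)
      then have "y $ l = 0" for l using R_av_ge_1[OF y] by (metis not_le)
      then have "y = 0" by (simp add: vec_eq_iff)
      then have "dm t *v (D i *s axis i 1) = 0" using \<open>dm t *v (D i *s axis i 1) = c *s ((k ** h) *v y)\<close> by simp
      then have "(dm t *v (D i *s axis i 1)) $ i = 0" by simp
      then show False using D(1) av_p(3) unfolding dm_def diag_mult_vec by (simp add: axis_def)
    qed
    moreover have "av p powi (\<Sum>i\<in>UNIV. t i + - s) * av (det g) = av (det h)"
    proof -
      have "av (det (dm t ** g)) = av (det (mat c ** (k ** h ** \<gamma>)))" using c(3) by simp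
      then have "av p powi (\<Sum>i\<in>UNIV. t i) * av (det g) = av c ^ CARD('n) * av (det h)"
        using k(1) av_det_GLR[OF c(2)] by (simp add: det_mul av_mult av_det_dm det_mat av_power GLO_def)
      moreover have "av c ^ CARD('n) = av p powi (s * int CARD('n))"
        unfolding s by (simp add: power_int_mult)
      ultimately have eq: "av p powi (\<Sum>i\<in>UNIV. t i) * av (det g) = av p powi (s * int CARD('n)) * av (det h)"
        by simp
      have "(\<Sum>i\<in>(UNIV :: 'n set). t i + - s) = - (s * int CARD('n)) + (\<Sum>i\<in>UNIV. t i)"
        by (simp add: sum.distrib sum_subtractf)
      then have "av p powi (\<Sum>i\<in>UNIV. t i + - s) * av (det g) =
          inverse (av p powi (s * int CARD('n))) * (av p powi (\<Sum>i\<in>UNIV. t i) * av (det g))"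
        using av_p by (simp only: power_int_add[OF disjI1] power_int_minus mult.assoc)
      also have "\<dots> = av (det h)"
      proof -
        have cancel: "inverse y * (y * z) = z" if "0 < y" for y z :: real using that by simp
        show ?thesis unfolding eq by (rule cancel[OF av_powi_pos])
      qed
      finally show ?thesis .
    qed
    ultimately show ?thesis by (intro exI[of _ "- s"]) simp
  qed
  show ?thesis
  proof (cases "\<exists>S. av p powi S * av (det g) = av (det h)")
    case True
    then obtain S where S: "av p powi S * av (det g) = av (det h)" by blast
    \<comment> \<open>Exponents bounded above by \<open>M\<close> and with prescribed sum
      \<open>S\<close> are bounded below as well.\<close>
    define T where "T = PiE UNIV (\<lambda>_ :: 'n. {S - int CARD('n) * M .. M})"
    have "finite T" unfolding T_def by (intro finite_PiE) auto
    moreover have "{P \<in> PD p. pact P (lat g) \<in> (\<lambda>k. lat (k ** h)) ` GLO} \<subseteq> (\<lambda>t. pclass (dm t)) ` T"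
    proof
      fix P assume "P \<in> {P \<in> PD p. pact P (lat g) \<in> (\<lambda>k. lat (k ** h)) ` GLO}"
      then obtain t where P: "P = pclass (dm t)" and "lat (dm t ** g) \<in> (\<lambda>k. lat (k ** h)) ` GLO"
        by (auto simp: PD_eq pact_lat)
      then obtain s where s: "\<And>i. t i + s \<le> M" "av p powi (\<Sum>i\<in>UNIV. t i + s) * av (det g) = av (det h)"
        using key by blast
      have "av p powi (\<Sum>i\<in>UNIV. t i + s) = av p powi S" using s(2) S dg by (metis mult_right_cancel)
      then have sum: "(\<Sum>i\<in>UNIV. t i + s) = S" by (rule av_powi_inj)
      have "S - int CARD('n) * M \<le> t i + s" for i
      proof -
        have "(\<Sum>i\<in>UNIV. t i + s) = (t i + s) + (\<Sum>j\<in>UNIV - {i}. t j + s)" by (intro sum.remove) auto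
        moreover have "(\<Sum>j\<in>UNIV - {i}. t j + s) \<le> (\<Sum>j\<in>UNIV - {i}. M)" by (intro sum_mono s)
        moreover have "(\<Sum>j\<in>UNIV - {i}. M) \<le> (\<Sum>j\<in>(UNIV :: 'n set). M)" using M0 by (intro sum_mono2) auto
        ultimately show ?thesis using sum by simp
      qed
      then have "(\<lambda>i. t i + s) \<in> T" using s(1) by (auto simp: T_def)
      then show "P \<in> (\<lambda>t. pclass (dm t)) ` T" unfolding P by (metis pclass_dm_shift image_eqI)
    qed
    ultimately show ?thesis using finite_surj by blast
  next
    case False
    then have "{P \<in> PD p. pact P (lat g) \<in> (\<lambda>k. lat (k ** h)) ` GLO} = {}"
      using key by (fastforce simp: PD_eq pact_lat)
    then show ?thesis by (simp only: finite.emptyI)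
  qed
qed

section \<open>Properness of the orbit maps of axial lattices\<close>

lemma PA_decomp:
  assumes "\<And>i. a i \<noteq> 0"
  shows "\<exists>u t. (\<forall>i. av (u i) = 1) \<and> diag_matrix a = diag_matrix u ** (dm t :: 'c ^ 'n::finite ^ 'n)"
proof -
  have "\<forall>i. \<exists>k. av (a i) = av p powi k" using av_eq_powi assms by blast
  then obtain t where t: "\<And>i. av (a i) = av p powi t i" by metis
  define u where "u i = a i / p powi t i" for i
  have "av (u i) = 1" for i unfolding u_def av_divide av_powi t using av_p(3) by simp
  moreover have "diag_matrix a = diag_matrix u ** dm t"
    unfolding dm_def diag_matrix_mult using av_p(3) by (simp add: u_def)
  ultimately show ?thesis by blast
qed

text \<open>Diagonal matrices with unit entries form a compact part of \<open>GLO\<close>, and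
  translation by them preserves the orbit of \<open>h\<close>. Modulo this part \<open>PA\<close>
  reduces to \<open>PD\<close>, where \<open>finite_PD_orbit\<close> applies.\<close>

lemma compactin_PA_orbit:
  fixes g h :: "'c ^ 'n::finite ^ 'n"
  assumes g: "invertible g" and h: "invertible h" and ax: "axial g"
  shows "compactin PG_top {P \<in> PA. pact P (lat g) \<in> (\<lambda>k. lat (k ** h)) ` GLO}"
proof -
  define F where "F = {P \<in> PD p. pact P (lat g) \<in> (\<lambda>k. lat (k ** h)) ` GLO}"
  have F: "finite F" unfolding F_def by (rule finite_PD_orbit[OF g h ax])
  let ?U = "{u :: 'n \<Rightarrow> 'c. \<forall>i. av (u i) = 1}"
  let ?O = "\<lambda>P. (\<lambda>u. pmult (pclass (diag_matrix u)) P) ` ?U"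
  have "{P \<in> PA. pact P (lat g) \<in> (\<lambda>k. lat (k ** h)) ` GLO} = (\<Union>P\<in>F. ?O P)"
  proof (intro set_eqI iffI)
    fix P assume "P \<in> {P \<in> PA. pact P (lat g) \<in> (\<lambda>k. lat (k ** h)) ` GLO}"
    then have "P \<in> PA" and Pg: "pact P (lat g) \<in> (\<lambda>k. lat (k ** h)) ` GLO" by blast+
    then obtain a where "\<forall>i. a i \<noteq> 0" and a2: "P = pclass (diag_matrix a)" by (auto simp: PA_def)
    then have a1: "a i \<noteq> 0" for i by blast
    obtain k where k: "k \<in> GLO" "lat (diag_matrix a ** g) = lat (k ** h)"
      using Pg unfolding a2 pact_lat by blast
    obtain u t where u: "\<And>i. av (u i) = 1" "diag_matrix a = diag_matrix u ** dm t" using PA_decomp[of a] a1 by blast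
    have "diag_matrix u \<in> GLO" using u(1) by (simp add: diag_matrix_in_GLO_iff)
    then obtain l where l: "l \<in> GLO" "l ** diag_matrix u = mat 1" using GLO_inverse by blast
    have "lat (dm t ** g) = lat ((l ** diag_matrix u) ** (dm t ** g))" by (simp add: l)
    also have "\<dots> = lat (l ** (diag_matrix a ** g))" by (simp add: u(2) matrix_mul_assoc)
    also have "\<dots> = lat (l ** (k ** h))" using k(2) by (metis pact_lat)
    also have "\<dots> = lat ((l ** k) ** h)" by (simp add: matrix_mul_assoc)
    finally have "pact (pclass (dm t)) (lat g) \<in> (\<lambda>k. lat (k ** h)) ` GLO"
      using GLO_mult[OF l(1) k(1)] by (auto simp: pact_lat)
    then have "pclass (dm t) \<in> F" by (simp add: F_def PD_eq)
    moreover have "P = pmult (pclass (diag_matrix u)) (pclass (dm t))" by (simp add: a2 u(2) pmult_class)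
    ultimately show "P \<in> (\<Union>P\<in>F. ?O P)" using u(1) by blast
  next
    fix P assume "P \<in> (\<Union>P\<in>F. ?O P)"
    then obtain u t where u: "\<forall>i. av (u i) = 1" "P = pmult (pclass (diag_matrix u)) (pclass (dm t))"
      and "pact (pclass (dm t)) (lat g) \<in> (\<lambda>k. lat (k ** h)) ` GLO"
      by (auto simp: F_def PD_eq)
    then obtain k where k: "k \<in> GLO" "lat (dm t ** g) = lat (k ** h)" by (auto simp: pact_lat)
    have P: "P = pclass (diag_matrix u ** dm t)" by (simp add: u(2) pmult_class)
    have uG: "diag_matrix u \<in> GLO" using u(1) by (simp add: diag_matrix_in_GLO_iff)
    have "pact P (lat g) = lat (diag_matrix u ** (dm t ** g))" unfolding P by (simp add: pact_lat matrix_mul_assoc)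
    also have "\<dots> = lat (diag_matrix u ** (k ** h))" using k(2) by (metis pact_lat)
    also have "\<dots> = lat ((diag_matrix u ** k) ** h)" by (simp add: matrix_mul_assoc)
    finally have "pact P (lat g) \<in> (\<lambda>k. lat (k ** h)) ` GLO" using GLO_mult[OF uG k(1)] by blast
    moreover have "u i * p powi t i \<noteq> 0" for i using u(1) av_p(3) av_0 by (metis mult_eq_0_iff power_int_not_zero zero_neq_one)
    then have "P \<in> PA" unfolding P dm_def diag_matrix_mult PA_def by blast
    ultimately show "P \<in> {P \<in> PA. pact P (lat g) \<in> (\<lambda>k. lat (k ** h)) ` GLO}" by blast
  qed
  moreover have "compactin PG_top (?O P)" if PF: "P \<in> F" for P
  proof -
    obtain t where P: "P = pclass (dm t)" using PF by (auto simp: F_def PD_eq)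
    show ?thesis unfolding P pmult_class by (rule compactin_PG_diag_orbit[OF invertible_dm])
  qed
  then have "compactin PG_top (\<Union>P\<in>F. ?O P)" using F by (intro compactin_Union) auto
  ultimately show ?thesis by simp
qed

lemma continuous_map_pact:
  fixes g :: "'c ^ 'n::finite ^ 'n"
  assumes g: "invertible g"
  shows "continuous_map PG_top (PX_top R) (\<lambda>P. pact P (lat g))"
  unfolding continuous_map_def
proof (intro conjI allI impI)
  show "(\<lambda>P. pact P (lat g)) \<in> topspace PG_top \<rightarrow> topspace (PX_top R)"
    using g by (auto simp: PG_def topspace_PX_lat pact_lat intro: invertible_mult)
  fix V :: "('c ^ 'n) set set set" assume V: "openin (PX_top R) V"
  show "openin PG_top {P \<in> topspace PG_top. pact P (lat g) \<in> V}"
    unfolding openin_PG_iff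
  proof (intro conjI allI impI)
    fix h :: "'c ^ 'n ^ 'n" assume h: "invertible h" "pclass h \<in> {P \<in> topspace PG_top. pact P (lat g) \<in> V}"
    then have "lat (h ** g) \<in> V" by (simp add: pact_lat)
    then have "\<exists>e>0. e < 1 \<and> (\<forall>k\<in>GLQ e. lat (k ** (h ** g)) \<in> V)"
      using conjunct2[OF V[unfolded openin_PX_iff]] invertible_mult[OF h(1) g] by (elim allE impE)
    then obtain e where e: "0 < e" "e < 1" "\<And>k. k \<in> GLQ e \<Longrightarrow> lat (k ** (h ** g)) \<in> V" by auto
    have "pclass (k ** h) \<in> {P \<in> topspace PG_top. pact P (lat g) \<in> V}" if "k \<in> GLQ e" for k
    proof -
      have "invertible (k ** h)" using that h(1) GLQ_subset_GLO[OF e(2)] by (intro invertible_mult_GLO) auto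
      then show ?thesis using e(3)[OF that] by (simp add: PG_def pact_lat matrix_mul_assoc)
    qed
    then show "\<exists>e>0. e < 1 \<and> (\<forall>k\<in>GLQ e. pclass (k ** h) \<in> {P \<in> topspace PG_top. pact P (lat g) \<in> V})"
      using e(1,2) by (intro exI[of _ e] conjI ballI)
  qed auto
qed

text \<open>The \<open>GLO\<close>-orbits are open, so they can be used to test closedness of the
  image of \<open>C\<close> locally. Over one orbit the relevant part of \<open>C\<close> is
  compact, and its image is closed by the Hausdorff property.\<close>

lemma proper_map_if_compact_preimages:
  fixes g :: "'c ^ 'n::finite ^ 'n"
  assumes g: "invertible g" and H: "H \<subseteq> PG"
    and comp: "\<And>h :: 'c ^ 'n ^ 'n. invertible h \<Longrightarrow>
      compactin PG_top {P \<in> H. pact P (lat g) \<in> (\<lambda>k. lat (k ** h)) ` GLO}"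
  shows "proper_map (subtopology PG_top H) (PX_top R) (\<lambda>P. pact P (lat g))"
proof -
  let ?f = "\<lambda>P. pact P (lat g)" and ?X = "subtopology PG_top H" and ?Y = "PX_top R :: ('c ^ 'n) set set topology"
  let ?U = "\<lambda>h :: 'c ^ 'n ^ 'n. (\<lambda>k. lat (k ** h)) ` GLO"
  have cont: "continuous_map ?X ?Y ?f"
    using continuous_map_pact[OF g] by (rule continuous_map_from_subtopology)
  have tX: "topspace ?X = H" using H by auto
  have K: "compactin ?X {P \<in> H. ?f P \<in> ?U h}" if "invertible h" for h
    using comp[OF that] by (auto simp: compactin_subtopology)
  have U: "openin ?Y (?U h)" "lat h \<in> ?U h" if "invertible h" for h
  proof -
    show "openin ?Y (?U h)"
      using that GLO_mult GLQ_subset_GLO[of "1/2"] by (intro openin_PX_orbit[where e = "1/2"]) auto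
    show "lat h \<in> ?U h"
      using mat_1_in_GLQ[of "1/2"] GLQ_subset_GLO[of "1/2"] by (intro image_eqI[of _ _ "mat 1"]) auto
  qed
  show ?thesis
    unfolding proper_map_def
  proof (intro conjI ballI)
    show "closed_map ?X ?Y ?f"
      unfolding closed_map_def
    proof (intro allI impI)
      fix C assume C: "closedin ?X C"
      then have CH: "C \<subseteq> H" using closedin_subset tX by blast
      have "openin ?Y (topspace ?Y - ?f ` C)"
      proof (subst openin_subopen, intro ballI)
        fix y assume y: "y \<in> topspace ?Y - ?f ` C"
        then obtain h where h: "invertible h" "y = lat h" by (auto simp: topspace_PX_lat)
        let ?K = "{P \<in> H. ?f P \<in> ?U h}"
        have "compactin ?X (C \<inter> ?K)" using C K[OF h(1)] by (rule closed_Int_compactin)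
        then have "compactin ?Y (?f ` (C \<inter> ?K))" using cont by (rule image_compactin)
        then have cl: "closedin ?Y (?f ` (C \<inter> ?K))" using Hausdorff_PX by (intro compactin_imp_closedin)
        have "openin ?Y (?U h - ?f ` (C \<inter> ?K))" using U(1)[OF h(1)] cl by (rule openin_diff)
        moreover have "y \<in> ?U h - ?f ` (C \<inter> ?K)" using U(2)[OF h(1)] h(2) y by auto
        moreover have "?U h - ?f ` (C \<inter> ?K) \<subseteq> topspace ?Y - ?f ` C"
          using openin_subset[OF U(1)[OF h(1)]] CH by blast
        ultimately show "\<exists>T. openin ?Y T \<and> y \<in> T \<and> T \<subseteq> topspace ?Y - ?f ` C" by blast
      qed
      moreover have "?f ` C \<subseteq> topspace ?Y"
        using continuous_map_image_subset_topspace[OF cont] CH tX by blast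
      ultimately show "closedin ?Y (?f ` C)" by (simp add: closedin_def)
    qed
    fix y assume y: "y \<in> topspace ?Y"
    then obtain h where h: "invertible h" "y = lat h" by (auto simp: topspace_PX_lat)
    have "closedin ?Y {y}" using Hausdorff_PX y by (intro closedin_Hausdorff_singleton)
    then have "closedin ?X {P \<in> topspace ?X. ?f P \<in> {y}}" by (rule closedin_continuous_map_preimage[OF cont])
    moreover have "{P \<in> topspace ?X. ?f P \<in> {y}} \<subseteq> {P \<in> H. ?f P \<in> ?U h}"
      using tX U(2)[OF h(1)] h(2) by auto
    ultimately show "compactin ?X {P \<in> topspace ?X. ?f P = y}"
      using closed_compactin[OF K[OF h(1)]] by simp
  qed
qed

end

section \<open>Non-axial lattices\<close>

context valued_lattice begin

lemma av_diff_less: "av x < e \<Longrightarrow> av y < e \<Longrightarrow> av (x - y) < e"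
  by (rule order_le_less_trans[OF av_diff]) simp

text \<open>K_v is unbounded, so a finite R could not be cocompact. The lemma supplies as many
  multipliers as the pigeonhole in \<open>finite_big_lattices\<close> requires.\<close>

lemma infinite_R: "infinite R"
proof
  assume fin: "finite R"
  obtain C where C: "\<forall>x. \<exists>r\<in>R. dist x r \<le> C" using R_cocompact by blast
  define M where "M = (\<Sum>r\<in>R. av r)"
  obtain k where k: "max M C < av p powi (- k)" using av_powi_large by blast
  obtain r where r: "r \<in> R" "av (p powi (- k) - r) \<le> C" using C by (auto simp: dist_av)
  have "av r \<le> M" unfolding M_def using fin r(1) by (intro member_le_sum) auto
  have "av (p powi (- k) - r + r) \<le> max (av (p powi (- k) - r)) (av r)" by (rule av_add)
  then have "av p powi (- k) \<le> max (av (p powi (- k) - r)) (av r)" by (simp add: av_powi)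
  moreover have "av (p powi (- k) - r) < av p powi (- k)" using k r(2) by linarith
  moreover have "av r < av p powi (- k)" using \<open>av r \<le> M\<close> k by linarith
  ultimately show False by linarith
qed

text \<open>As |p| < 1, larger \<open>t\<close> means a larger box. The strict inequalities turn the
  rescaled box into the open unit ball, where R has no nonzero element.\<close>

definition box_free :: "('c ^ 'n) set \<Rightarrow> ('n \<Rightarrow> int) \<Rightarrow> bool" where
  "box_free L t \<longleftrightarrow> (\<forall>x\<in>L. (\<forall>i. av (x $ i) < av p powi (- t i)) \<longrightarrow> x = 0)"

lemma box_free_antimono:
  assumes "box_free L t'" "\<And>i. t i \<le> t' i" shows "box_free L t"
  unfolding box_free_def
proof (intro ballI impI)
  fix x assume x: "x \<in> L" "\<forall>i. av (x $ i) < av p powi (- t i)"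
  have "av (x $ i) < av p powi (- t' i)" for i
  proof -
    have "av p powi (- t i) \<le> av p powi (- t' i)" using assms(2)[of i] by (simp add: av_powi_le_iff)
    then show ?thesis using x(2) by (meson order_less_le_trans)
  qed
  then show "x = 0" using assms(1) x(1) by (simp add: box_free_def)
qed

text \<open>A ball contains finitely many nonzero lattice points, and none of them lies on the axis
  \<open>i0\<close>. A box of exponent \<open>T\<close> along this axis avoids them all once it is
  thin enough in the other directions.\<close>

lemma ex_box_free:
  assumes g: "invertible (g :: 'c ^ 'n::finite ^ 'n)" and i0: "\<And>c. c *s axis i0 1 \<in> Lset g \<Longrightarrow> c = 0"
  shows "\<exists>t. box_free (Lset g) t \<and> t i0 = T"
proof -
  define \<rho> where "\<rho> = max 1 (av p powi (- T))"
  define X where "X = {x \<in> Lset g. \<forall>i. av (x $ i) \<le> \<rho>} - {0}"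
  have finX: "finite X" unfolding X_def using finite_Lset_ball[OF g] by simp
  have "\<exists>j. j \<noteq> i0 \<and> x $ j \<noteq> 0" if x: "x \<in> X" for x
  proof (rule ccontr)
    assume n: "\<not> ?thesis"
    then have "x = (x $ i0) *s axis i0 1" by (auto simp: vec_eq_iff axis_def)
    then show False using i0[of "x $ i0"] x by (auto simp: X_def)
  qed
  then obtain j where j: "\<And>x. x \<in> X \<Longrightarrow> j x \<noteq> i0 \<and> x $ j x \<noteq> 0" by metis
  have "\<forall>x\<in>X. \<exists>k. 0 \<le> k \<and> av p powi k < av (x $ j x)" using j av_powi_small av_pos by blast
  then obtain k where k: "\<And>x. x \<in> X \<Longrightarrow> 0 \<le> k x \<and> av p powi k x < av (x $ j x)" by metis
  define s where "s = (\<Sum>x\<in>X. k x)"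
  have s0: "0 \<le> s" unfolding s_def using k by (intro sum_nonneg) auto
  have s: "av p powi s < av (x $ j x)" if "x \<in> X" for x
  proof -
    have "k x \<le> s" unfolding s_def using finX k that by (intro member_le_sum) auto
    then have "av p powi s \<le> av p powi k x" by (simp add: av_powi_le_iff)
    then show ?thesis using k[OF that] by linarith
  qed
  define t where "t i = (if i = i0 then T else - s)" for i
  have "box_free (Lset g) t"
    unfolding box_free_def
  proof (intro ballI impI, rule ccontr)
    fix x assume x: "x \<in> Lset g" "\<forall>i. av (x $ i) < av p powi (- t i)" "x \<noteq> 0"
    have "av p powi (- t i) \<le> \<rho>" for i
    proof (cases "i = i0")
      case False
      have "av p powi s \<le> av p powi 0" using s0 by (subst av_powi_le_iff)
      then show ?thesis using False by (simp add: t_def \<rho>_def)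
    qed (simp add: t_def \<rho>_def)
    then have "\<forall>i. av (x $ i) \<le> \<rho>" using x(2) by (meson less_imp_le order_trans)
    then have "x \<in> X" using x by (simp add: X_def)
    then show False using s[of x] j[of x] spec[OF x(2), of "j x"] by (simp add: t_def)
  qed
  then show ?thesis by (intro exI[of _ t]) (simp add: t_def)
qed

text \<open>Minkowski: a box that is long in one direction meets the lattice, by the pigeonhole
  principle applied to \<open>p powi (- m) *s axis j 1\<close> modulo the lattice.\<close>

lemma box_free_bounded:
  assumes g: "invertible (g :: 'c ^ 'n::finite ^ 'n)"
  shows "\<exists>K. \<not> box_free (Lset g) (t(j := K))"
proof -
  obtain C where C: "\<forall>x. \<exists>l\<in>Lset g. \<forall>i. av ((x - l) $ i) \<le> C" using Lset_cobounded[OF g] by blast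
  \<comment> \<open>At most every side of the box, so that the vector found below fits in the
    directions other than \<open>j\<close>; at most 1, so that this vector is nonzero, since
    \<open>e m' - e m\<close> has length at least 1.\<close>
  define \<epsilon> where "\<epsilon> = Min (insert 1 (range (\<lambda>i. av p powi (- t i))))"
  have \<epsilon>: "0 < \<epsilon>" "\<epsilon> \<le> 1" "\<And>i. \<epsilon> \<le> av p powi (- t i)"
  proof -
    show "0 < \<epsilon>" unfolding \<epsilon>_def using av_powi_pos by (subst Min_gr_iff) auto
    show "\<epsilon> \<le> 1" unfolding \<epsilon>_def by (intro Min_le) auto
    show "\<epsilon> \<le> av p powi (- t i)" for i unfolding \<epsilon>_def by (intro Min_le) auto
  qed
  obtain F :: "'c set" where F: "finite F" "\<forall>x. dist x 0 \<le> C \<longrightarrow> (\<exists>y\<in>F. dist x y < \<epsilon>)"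
    using balls_totally_bounded[OF \<epsilon>(1)] by blast
  define e where "e m = p powi (- int m) *s (axis j 1 :: 'c ^ 'n)" for m
  have "\<forall>m. \<exists>l y. l \<in> Lset g \<and> (\<forall>i. y $ i \<in> F \<and> av ((e m - l) $ i - y $ i) < \<epsilon>)"
  proof
    fix m
    obtain l where l: "l \<in> Lset g" "\<forall>i. av ((e m - l) $ i) \<le> C" using C by blast
    then have "\<forall>i. \<exists>y. y \<in> F \<and> av ((e m - l) $ i - y) < \<epsilon>" using F(2) by (auto simp: dist_av)
    then obtain y where "\<And>i. y i \<in> F \<and> av ((e m - l) $ i - y i) < \<epsilon>" by metis
    then show "\<exists>l y. l \<in> Lset g \<and> (\<forall>i. y $ i \<in> F \<and> av ((e m - l) $ i - y $ i) < \<epsilon>)"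
      using l(1) by (intro exI[of _ l] exI[of _ "\<chi> i. y i"]) simp
  qed
  then obtain l y where l: "\<And>m. l m \<in> Lset g" and y: "\<And>m i. y m $ i \<in> F"
    and ly: "\<And>m i. av ((e m - l m) $ i - y m $ i) < \<epsilon>" by metis
  have "range y \<subseteq> {v. \<forall>i. v $ i \<in> F}" using y by auto
  then have "finite (range y)" using finite_vec_in[OF F(1)] by (rule finite_subset)
  then have "\<not> inj y" using finite_imageD infinite_UNIV_nat by blast
  then obtain m m' where mm: "m < m'" "y m = y m'" by (metis injI linorder_neqE_nat)
  define x where "x = l m' - l m"
  have xL: "x \<in> Lset g" unfolding x_def by (rule Lset_diff[OF l l])
  have near: "av (x $ i - (e m' - e m) $ i) < \<epsilon>" for i
  proof -
    have "x $ i - (e m' - e m) $ i = ((e m - l m) $ i - y m $ i) - ((e m' - l m') $ i - y m' $ i)"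
      using mm(2) by (simp add: x_def)
    then show ?thesis using av_diff_less[OF ly ly] by (simp only:)
  qed
  have ej: "e k $ i = (if i = j then p powi (- int k) else 0)" for k i
    by (simp add: e_def axis_def)
  have big: "av ((e m' - e m) $ j) = av p powi (- int m')"
  proof -
    have "av (- (p powi (- int m))) < av (p powi (- int m'))"
      using mm(1) by (simp add: av_powi av_powi_less_iff)
    from av_add_eq[OF this] show ?thesis by (simp add: ej av_powi)
  qed
  have "x \<noteq> 0"
  proof
    assume "x = 0"
    then have "av (- ((e m' - e m) $ j)) < \<epsilon>" using near[of j] by (simp only: zero_index diff_0)
    then have "av p powi (- int m') < \<epsilon>" by (simp only: av_uminus big)
    moreover have "av p powi 0 \<le> av p powi (- int m')" by (subst av_powi_le_iff) simp
    ultimately show False using \<epsilon>(2) by simp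
  qed
  obtain K where K: "av (x $ j) < av p powi (- K)" using av_powi_large by blast
  have "av (x $ i) < av p powi (- (t(j := K)) i)" for i
  proof (cases "i = j")
    case False
    then show ?thesis using near[of i] \<epsilon>(3)[of i] by (simp add: ej)
  qed (use K in simp)
  then have "\<not> box_free (Lset g) (t(j := K))" using xL \<open>x \<noteq> 0\<close> unfolding box_free_def by blast
  then show ?thesis by blast
qed

text \<open>The sides are pushed out one at a time. By \<open>box_free_antimono\<close>, a side once
  blocked stays blocked when the others grow.\<close>

lemma box_free_extend:
  assumes g: "invertible (g :: 'c ^ 'n::finite ^ 'n)" and t: "box_free (Lset g) t"
  shows "\<exists>t'. box_free (Lset g) t' \<and> (\<forall>i. t i \<le> t' i) \<and> (\<forall>j. \<not> box_free (Lset g) (t'(j := t' j + 1)))"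
proof -
  have step: "\<exists>k\<ge>t j. box_free (Lset g) (t(j := k)) \<and> \<not> box_free (Lset g) (t(j := k + 1))"
    if t: "box_free (Lset g) t" for t j
  proof -
    obtain K where K: "\<not> box_free (Lset g) (t(j := K))" using box_free_bounded[OF g] by blast
    have lt: "t j < K"
    proof (rule ccontr)
      assume "\<not> t j < K"
      then have "box_free (Lset g) (t(j := K))" using t by (rule_tac box_free_antimono) auto
      with K show False by simp
    qed
    let ?P = "\<lambda>m. \<not> box_free (Lset g) (t(j := t j + int m))"
    have "?P (nat (K - t j))" using K lt by simp
    moreover have "\<not> ?P 0" using t by simp
    ultimately have "\<exists>m<nat (K - t j). (\<forall>i\<le>m. \<not> ?P i) \<and> ?P (Suc m)" by (rule ex_least_nat_less)
    then obtain m where "box_free (Lset g) (t(j := t j + int m))" "?P (Suc m)" by auto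
    then show ?thesis by (intro exI[of _ "t j + int m"]) (simp add: ac_simps)
  qed
  have "\<exists>t'. box_free (Lset g) t' \<and> (\<forall>i. t i \<le> t' i) \<and> (\<forall>j\<in>J. \<not> box_free (Lset g) (t'(j := t' j + 1)))" for J
  proof (induction J rule: finite_induct[OF finite])
    case 1
    then show ?case using t by auto
  next
    case (2 j J)
    then obtain t' where t': "box_free (Lset g) t'" "\<forall>i. t i \<le> t' i"
      "\<forall>j\<in>J. \<not> box_free (Lset g) (t'(j := t' j + 1))" by blast
    obtain k where k: "t' j \<le> k" "box_free (Lset g) (t'(j := k))" "\<not> box_free (Lset g) (t'(j := k + 1))"
      using step[OF t'(1)] by blast
    let ?t = "t'(j := k)"
    have "\<not> box_free (Lset g) (?t(i := ?t i + 1))" if i: "i \<in> insert j J" for i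
    proof (cases "i = j")
      case True
      then show ?thesis using k(3) by simp
    next
      case False
      then have "\<not> box_free (Lset g) (t'(i := t' i + 1))" using i t'(3) by blast
      moreover have "(t'(i := t' i + 1)) l \<le> (?t(i := ?t i + 1)) l" for l using k(1) False by simp
      ultimately show ?thesis using box_free_antimono by blast
    qed
    moreover have "\<forall>i. t i \<le> ?t i" using t'(2) k(1) order_trans by auto
    ultimately show ?case using k(2) by blast
  qed
  from this[of UNIV] show ?thesis by simp
qed

text \<open>Each side of a maximal free box is blocked by a lattice vector in the interior of that
  face. After rescaling the box to the unit ball, these vectors form a matrix with unit
  diagonal entries and small off-diagonal entries, hence a matrix in \<open>GLO\<close>.\<close>

lemma maximal_box_matrix:
  assumes g: "invertible (g :: 'c ^ 'n::finite ^ 'n)" and t: "box_free (Lset g) t"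
    and max: "\<And>j. \<not> box_free (Lset g) (t(j := t j + 1))"
  shows "\<exists>u \<rho>. u \<in> GLO \<and> (\<forall>i j. \<rho> $ i $ j \<in> R) \<and> dm t ** g ** \<rho> = u"
proof -
  have "\<exists>r. (\<forall>i. r $ i \<in> R) \<and> (\<forall>i. i \<noteq> j \<longrightarrow> av ((g *v r) $ i) < av p powi (- t i)) \<and>
      av ((g *v r) $ j) = av p powi (- t j)" for j
  proof -
    obtain x where x: "x \<in> Lset g" "\<And>i. av (x $ i) < av p powi (- (t(j := t j + 1)) i)" "x \<noteq> 0"
      using max[of j] unfolding box_free_def by blast
    have off: "av (x $ i) < av p powi (- t i)" if "i \<noteq> j" for i using x(2)[of i] that by simp
    have "\<not> av (x $ j) < av p powi (- t j)"
    proof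
      assume "av (x $ j) < av p powi (- t j)"
      then have "av (x $ i) < av p powi (- t i)" for i using off by (cases "i = j") auto
      then show False using t x(1,3) unfolding box_free_def by blast
    qed
    then have xj: "x $ j \<noteq> 0" using av_powi_pos[of "- t j"] by auto
    obtain k where k: "av (x $ j) = av p powi k" using av_eq_powi[OF xj] by blast
    \<comment> \<open>The j-th coordinate is at least the old side and less than the next larger
      one. Absolute values being powers of |p|, it equals the old side.\<close>
    have "av p powi k < av p powi (- (t j + 1))" using x(2)[of j] k by simp
    then have "- (t j + 1) < k" by (simp only: av_powi_less_iff)
    moreover have "\<not> av p powi k < av p powi (- t j)" using \<open>\<not> av (x $ j) < _\<close> k by simp
    then have "\<not> - t j < k" unfolding av_powi_less_iff .
    ultimately have "k = - t j" by linarith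
    moreover obtain r where "r \<in> standard_lattice R" "x = g *v r" using x(1) by (auto simp: Lset_def)
    ultimately show ?thesis using off k by (intro exI[of _ r]) (auto simp: standard_lattice_def)
  qed
  then obtain r where r: "\<And>i j. r j $ i \<in> R" "\<And>i j. i \<noteq> j \<Longrightarrow> av ((g *v r j) $ i) < av p powi (- t i)"
    "\<And>j. av ((g *v r j) $ j) = av p powi (- t j)" by metis
  define \<rho> :: "'c ^ 'n ^ 'n" where "\<rho> = (\<chi> i j. r j $ i)"
  define u where "u = dm t ** g ** \<rho>"
  have u_eq: "u $ i $ j = p powi t i * (g *v r j) $ i" for i j
  proof -
    have "u $ i $ j = (dm t *v (g *v r j)) $ i"
      unfolding matrix_vector_mul_assoc by (simp add: u_def \<rho>_def matrix_matrix_mult_def[of "dm t ** g"] matrix_vector_mult_def)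
    then show ?thesis by (simp add: dm_def diag_mult_vec)
  qed
  have cancel: "av p powi t i * av p powi (- t i) = 1" for i using av_p(3) by (simp add: power_int_minus)
  have diag: "av (u $ i $ i) = 1" for i unfolding u_eq av_mult av_powi r(3) by (rule cancel)
  have off: "av (u $ i $ j) < 1" if "i \<noteq> j" for i j
    using mult_strict_left_mono[OF r(2)[OF that] av_powi_pos[of "t i"]] unfolding cancel u_eq av_mult av_powi .
  have "av (det u) = 1" using diag off by (rule av_det_dominant)
  moreover have "bnd 1 u" unfolding bnd_def
  proof (intro allI)
    show "av (u $ i $ j) \<le> 1" for i j using diag[of i] off[of i j] by (cases "i = j") auto
  qed
  ultimately have "u \<in> GLO" by (simp add: GLO_def)
  moreover have "\<rho> $ i $ j \<in> R" for i j using r(1) by (simp add: \<rho>_def)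
  ultimately show ?thesis unfolding u_def by blast
qed

text \<open>These lattices contain R^n with bounded denominators. For \<open>x\<close> in such a
  lattice, two of sufficiently many multiples r x and s x agree modulo R^n up to less than 1; the
  discrepancy is a short lattice vector, hence 0, so (r - s) x lies in R^n. The product
  \<open>D\<close> of all differences from a fixed finite subset of R is a denominator for all these
  lattices at once, and finitely many of them remain.\<close>

lemma finite_big_lattices:
  "finite {Lset \<rho>' | \<rho>' :: 'c ^ 'n::finite ^ 'n. (\<exists>\<rho>. (\<forall>i j. \<rho> $ i $ j \<in> R) \<and> \<rho>' ** \<rho> = mat 1) \<and>
     (\<forall>x\<in>Lset \<rho>'. (\<forall>i. av (x $ i) < 1) \<longrightarrow> x = 0)}" (is "finite ?N")
proof -
  obtain C where C: "\<forall>x. \<exists>r\<in>R. dist x r \<le> C" using R_cocompact by blast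
  obtain F :: "'c set" where F: "finite F" "\<forall>x. dist x 0 \<le> C \<longrightarrow> (\<exists>y\<in>F. dist x y < 1)"
    using balls_totally_bounded[OF zero_less_one] by blast
  let ?F = "{y :: 'c ^ 'n. \<forall>i. y $ i \<in> F}"
  have finF: "finite ?F" by (rule finite_vec_in[OF F(1)])
  obtain S where S: "S \<subseteq> R" "finite S" "card S = Suc (card ?F)"
    using infinite_arbitrarily_large[OF infinite_R] by metis
  define Z where "Z = {(r, s). r \<in> S \<and> s \<in> S \<and> r \<noteq> s}"
  define D where "D = (\<Prod>(r, s)\<in>Z. r - s)"
  have finZ: "finite Z" unfolding Z_def by (rule finite_subset[of _ "S \<times> S"]) (use S in auto)
  have D0: "D \<noteq> 0" unfolding D_def using finZ by (auto simp: Z_def)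
  \<comment> \<open>By cocompactness these vectors represent all classes of (1/D) R^n modulo R^n. A
    lattice in between is generated over R^n by those it contains.\<close>
  define B where "B = {b :: 'c ^ 'n. \<forall>i. b $ i \<in> (\<lambda>r. r / D) ` {r\<in>R. av r \<le> av D * C}}"
  have finB: "finite B" unfolding B_def by (intro finite_vec_in finite_imageI finite_R_ball)
  define gen where "gen Y = {x. \<exists>b\<in>Y. \<forall>i. (x - b) $ i \<in> R}" for Y :: "('c ^ 'n) set"
  have "N = gen (N \<inter> B)" if N: "N \<in> ?N" for N
  proof -
    obtain \<rho>' \<rho> where N_eq: "N = Lset \<rho>'" and \<rho>: "\<forall>i j. \<rho> $ i $ j \<in> R" "\<rho>' ** \<rho> = mat 1"
      and short: "\<forall>x\<in>Lset \<rho>'. (\<forall>i. av (x $ i) < 1) \<longrightarrow> x = 0" using N by blast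
    have RN: "x \<in> N" if x: "\<And>i. x $ i \<in> R" for x
    proof -
      have "x = \<rho>' *v (\<rho> *v x)" by (simp add: matrix_vector_mul_assoc \<rho>)
      moreover have "\<rho> *v x \<in> standard_lattice R"
        unfolding standard_lattice_def matrix_vector_mult_def using \<rho>(1) x
        by (auto intro!: R_sum R_mult)
      ultimately show ?thesis unfolding N_eq Lset_def by blast
    qed
    have DN: "D * x $ i \<in> R" if x: "x \<in> N" for x i
    proof -
      have "\<forall>r. \<exists>q y. (\<forall>i. q $ i \<in> R) \<and> (\<forall>i. y $ i \<in> F \<and> av (r * x $ i - q $ i - y $ i) < 1)"
      proof
        fix r
        have "\<forall>i. \<exists>q. q \<in> R \<and> dist (r * x $ i) q \<le> C" using C by blast
        then obtain q where q: "\<And>i. q i \<in> R" "\<And>i. dist (r * x $ i) (q i) \<le> C" by metis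
        have "\<exists>y. y \<in> F \<and> av (r * x $ i - q i - y) < 1" for i
          using F(2)[rule_format, of "r * x $ i - q i"] q(2)[of i] by (auto simp: dist_av)
        then have "\<forall>i. \<exists>y. y \<in> F \<and> av (r * x $ i - q i - y) < 1" by blast
        then obtain y where "\<And>i. y i \<in> F \<and> av (r * x $ i - q i - y i) < 1" by metis
        then show "\<exists>q y. (\<forall>i. q $ i \<in> R) \<and> (\<forall>i. y $ i \<in> F \<and> av (r * x $ i - q $ i - y $ i) < 1)"
          using q(1) by (intro exI[of _ "\<chi> i. q i"] exI[of _ "\<chi> i. y i"]) simp
      qed
      then obtain q y where q: "\<And>r i. q r $ i \<in> R" and y: "\<And>r i. y r $ i \<in> F"
        and qy: "\<And>r i. av (r * x $ i - q r $ i - y r $ i) < 1" by metis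
      have "y ` S \<subseteq> ?F" using y by auto
      then have "card (y ` S) < card S" using card_mono[OF finF] S(3) by (simp add: less_Suc_eq_le)
      then have "\<not> inj_on y S" using card_image by fastforce
      then obtain r s where rs: "r \<in> S" "s \<in> S" "r \<noteq> s" "y r = y s" by (auto simp: inj_on_def)
      define \<nu> where "\<nu> = (r - s) *s x - (q r - q s)"
      have rsR: "r - s \<in> R" using rs S(1) by (intro R_diff) auto
      have "q r - q s \<in> N" by (rule RN) (simp add: R_diff q)
      then have "\<nu> \<in> N"
        unfolding \<nu>_def N_eq by (rule Lset_diff[OF Lset_scale[OF rsR x[unfolded N_eq]]])
      moreover have "av (\<nu> $ i) < 1" for i
      proof -
        have "\<nu> $ i = (r * x $ i - q r $ i - y r $ i) - (s * x $ i - q s $ i - y s $ i)"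
          using rs(4) by (simp add: \<nu>_def algebra_simps)
        then show ?thesis using av_diff_less[OF qy qy] by (simp only:)
      qed
      ultimately have "\<nu> = 0" using short N_eq by blast
      then have "\<nu> $ i = 0" by simp
      then have "(r - s) * x $ i = q r $ i - q s $ i" by (simp add: \<nu>_def algebra_simps)
      then have rsx: "(r - s) * x $ i \<in> R" using R_diff[OF q q] by simp
      have "D = (r - s) * (\<Prod>(r, s)\<in>Z - {(r, s)}. r - s)"
        unfolding D_def using finZ rs by (subst prod.remove[of Z "(r, s)"]) (auto simp: Z_def)
      then have "D * x $ i = (\<Prod>(r, s)\<in>Z - {(r, s)}. r - s) * ((r - s) * x $ i)" by (simp add: ac_simps)
      also have "\<dots> \<in> R"
        by (rule R_mult[OF subring_prod[OF R_1 R_mult] rsx]) (use S(1) in \<open>auto simp: Z_def intro!: R_diff\<close>)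
      finally show ?thesis .
    qed
    show ?thesis
    proof (intro set_eqI iffI)
      fix x assume x: "x \<in> N"
      have "\<forall>i. \<exists>q. q \<in> R \<and> dist (x $ i) q \<le> C" using C by blast
      then obtain q where q: "\<And>i. q i \<in> R" "\<And>i. dist (x $ i) (q i) \<le> C" by metis
      define b where "b = x - (\<chi> i. q i)"
      have bN: "b \<in> N" unfolding b_def N_eq using x RN[of "\<chi> i. q i"] q(1) N_eq by (intro Lset_diff) auto
      have "b $ i \<in> (\<lambda>r. r / D) ` {r\<in>R. av r \<le> av D * C}" for i
      proof (rule image_eqI)
        show "b $ i = D * b $ i / D" using D0 by simp
        have "av (b $ i) \<le> C" using q(2)[of i] by (simp add: b_def dist_av)
        then show "D * b $ i \<in> {r\<in>R. av r \<le> av D * C}" using DN[OF bN] by (simp add: av_mult mult_left_mono)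
      qed
      then have "b \<in> N \<inter> B" using bN by (simp add: B_def)
      moreover have "(x - b) $ i \<in> R" for i using q(1) by (simp add: b_def)
      ultimately show "x \<in> gen (N \<inter> B)" unfolding gen_def by blast
    next
      fix x assume "x \<in> gen (N \<inter> B)"
      then obtain b where b: "b \<in> N" "\<forall>i. (x - b) $ i \<in> R" by (auto simp: gen_def)
      then have "x - b \<in> N" using RN[of "x - b"] by blast
      then have "x - b + b \<in> N" using b(1) unfolding N_eq by (rule Lset_add)
      then show "x \<in> N" by simp
    qed
  qed
  then have "?N \<subseteq> gen ` Pow B" by blast
  then show ?thesis using finB by (meson finite_Pow_iff finite_imageI finite_subset)
qed

text \<open>\<open>H\<close> ranges between \<open>PD\<close> and \<open>PG\<close>, so that one
  argument covers \<open>PA\<close> and \<open>PD\<close>. The preimage of the compact set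
  \<open>\<K>\<close> is covered by finitely many \<open>GLO\<close>-orbits in PG, each with at most
  one class from \<open>PD\<close>; this bounds how uneven the exponents can be. A non-axial lattice
  has maximal boxes that violate the bound.\<close>

lemma axial_if_proper:
  fixes g :: "'c ^ 'n::finite ^ 'n"
  assumes g: "invertible g" and H: "PD p \<subseteq> H" "H \<subseteq> PG"
    and pm: "proper_map (subtopology PG_top H) (PX_top R) (\<lambda>P. pact P (lat g))"
  shows "axial g"
proof (rule ccontr)
  assume "\<not> axial g"
  then obtain i0 where "\<not> (\<exists>c. c \<noteq> 0 \<and> c *s axis i0 1 \<in> Lset g)" unfolding axial_def by blast
  then have i0: "c = 0" if "c *s axis i0 1 \<in> Lset g" for c using that by blast
  define \<N> where "\<N> = {\<rho>' :: 'c ^ 'n ^ 'n. (\<exists>\<rho>. (\<forall>i j. \<rho> $ i $ j \<in> R) \<and> \<rho>' ** \<rho> = mat 1) \<and>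
     (\<forall>x\<in>Lset \<rho>'. (\<forall>i. av (x $ i) < 1) \<longrightarrow> x = 0)}"
  let ?orb = "\<lambda>X. (\<lambda>k. pact (pclass k) X) ` GLO"
  define \<K> where "\<K> = \<Union> (?orb ` (lat ` \<N>))"
  have inv\<N>: "invertible \<rho>'" if "\<rho>' \<in> \<N>" for \<rho>' using that
    by (auto simp: \<N>_def invertible_right_inverse)
  have "finite (Lset ` \<N>)"
  proof -
    have "Lset ` \<N> = {Lset \<rho>' | \<rho>' :: 'c ^ 'n ^ 'n. (\<exists>\<rho>. (\<forall>i j. \<rho> $ i $ j \<in> R) \<and> \<rho>' ** \<rho> = mat 1) \<and>
       (\<forall>x\<in>Lset \<rho>'. (\<forall>i. av (x $ i) < 1) \<longrightarrow> x = 0)}" by (simp only: \<N>_def setcompr_eq_image)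
    then show ?thesis using finite_big_lattices by (simp only:)
  qed
  then have "finite (homothety_class ` (Lset ` \<N>))" by (rule finite_imageI)
  then have fin: "finite (lat ` \<N>)" by (simp add: lat_Lset image_image)
  have "compactin (PX_top R) (?orb X)" if "X \<in> lat ` \<N>" for X
  proof -
    obtain \<rho>' where X: "\<rho>' \<in> \<N>" "X = lat \<rho>'" using \<open>X \<in> lat ` \<N>\<close> by blast
    show ?thesis unfolding X(2) pact_lat by (rule compactin_PX_orbit[OF inv\<N>[OF X(1)]])
  qed
  then have \<K>: "compactin (PX_top R) \<K>" unfolding \<K>_def using fin by (intro compactin_Union) auto
  define Z where "Z = {P \<in> H. pact P (lat g) \<in> \<K>}"
  have "compactin (subtopology PG_top H) {P \<in> topspace (subtopology PG_top H). pact P (lat g) \<in> \<K>}"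
    using pm \<K> by (rule compactin_proper_map_preimage)
  moreover have "topspace (subtopology PG_top H) = H" using H(2) by auto
  ultimately have "compactin (subtopology PG_top H) Z" by (simp only: Z_def)
  then have Z: "compactin PG_top Z" by (simp add: compactin_subtopology)
  let ?O = "\<lambda>h :: 'c ^ 'n ^ 'n. (\<lambda>k. pclass (k ** h)) ` GLO"
  have "\<exists>\<F>. finite \<F> \<and> \<F> \<subseteq> ?O ` {h. invertible h} \<and> Z \<subseteq> \<Union>\<F>"
  proof (rule compactinD[OF Z])
    show "openin PG_top U" if "U \<in> ?O ` {h. invertible h}" for U using that openin_PG_orbit by blast
    show "Z \<subseteq> \<Union> (?O ` {h. invertible h})"
    proof
      fix P assume "P \<in> Z"
      then have "P \<in> PG" using H(2) by (auto simp: Z_def)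
      then obtain h where "invertible h" "P = pclass h" by (auto simp: PG_def)
      moreover have "mat 1 \<in> GLO" by (simp add: GLO_def bnd_mat_1)
      then have "pclass h \<in> ?O h" by (intro image_eqI[of _ _ "mat 1"]) simp_all
      ultimately show "P \<in> \<Union> (?O ` {h. invertible h})" by blast
    qed
  qed
  then obtain \<F> where \<F>: "finite \<F>" "\<F> \<subseteq> ?O ` {h. invertible h}" "Z \<subseteq> \<Union>\<F>" by blast
  define \<Delta> where "\<Delta> t = (\<lambda>i. t i - t i0)" for t :: "'n \<Rightarrow> int"
  \<comment> \<open>Up to a scalar, two such matrices in one orbit differ by a diagonal matrix in
    \<open>GLO\<close>. Its entries are units, so the exponents agree up to a common shift.\<close>
  have same: "\<Delta> t = \<Delta> t'" if U: "U \<in> \<F>" "pclass (dm t) \<in> U" "pclass (dm t') \<in> U" for U t t'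
  proof -
    obtain h where h: "invertible h" "U = ?O h" using U(1) \<F>(2) by blast
    obtain k k' where k: "k \<in> GLO" "pclass (dm t) = pclass (k ** h)" "k' \<in> GLO" "pclass (dm t') = pclass (k' ** h)"
      using U(2,3) h(2) by blast
    obtain l where l: "l \<in> GLO" "l ** k = mat 1" using GLO_inverse[OF k(1)] by blast
    have "pmult (pclass (k' ** l)) (pclass (dm t)) = pclass ((k' ** l) ** (k ** h))"
      by (simp add: k(2) pmult_class)
    also have "(k' ** l) ** (k ** h) = k' ** (l ** k) ** h" by (simp add: matrix_mul_assoc)
    finally have "pclass (k' ** l ** dm t) = pclass (dm t')" by (simp add: l k(4) pmult_class)
    then obtain c where c: "c \<noteq> 0" "k' ** l ** dm t = mat c ** dm t'" using pclass_eq_imp by blast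
    have inv: "dm t ** dm (\<lambda>i. - t i) = (mat 1 :: 'c ^ 'n ^ 'n)"
      unfolding dm_def diag_matrix_mult using av_p(3)
      by (simp add: power_int_minus diag_matrix_def mat_def)
    have "k' ** l = (k' ** l ** dm t) ** dm (\<lambda>i. - t i)" by (simp add: inv flip: matrix_mul_assoc)
    also have "\<dots> = mat c ** (dm t' ** dm (\<lambda>i. - t i))" by (simp add: c(2) matrix_mul_assoc)
    also have "\<dots> = diag_matrix (\<lambda>i. c * p powi (t' i - t i))"
      unfolding dm_def diag_matrix_mult using av_p(3)
      by (simp add: mat_mult diag_matrix_def vec_eq_iff power_int_minus power_int_diff divide_inverse)
    finally have "diag_matrix (\<lambda>i. c * p powi (t' i - t i)) \<in> GLO" using GLO_mult[OF k(3) l(1)] by simp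
    then have "av c * av p powi (t' i - t i) = 1" for i
      unfolding diag_matrix_in_GLO_iff by (simp add: av_mult av_powi)
    then have "av p powi (t' i - t i) = av p powi (t' i0 - t i0)" for i
      using c(1) by (metis av_eq_0 mult_left_cancel)
    then have "t' i - t i = t' i0 - t i0" for i by (rule av_powi_inj)
    then show ?thesis unfolding \<Delta>_def by (intro ext) (metis add_diff_cancel_left' diff_add_eq diff_diff_eq2)
  qed
  define X where "X = {t. pclass (dm t) \<in> Z}"
  have "finite (\<Delta> ` X)"
  proof -
    have "\<Delta> ` X \<subseteq> (\<Union>U\<in>\<F>. \<Delta> ` {t. pclass (dm t) \<in> U})" using \<F>(3) by (auto simp: X_def)
    moreover have "finite (\<Delta> ` {t. pclass (dm t) \<in> U})" if "U \<in> \<F>" for U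
    proof (cases "\<exists>t. pclass (dm t) \<in> U")
      case True
      then obtain t where "pclass (dm t) \<in> U" by blast
      then have "\<Delta> ` {t. pclass (dm t) \<in> U} \<subseteq> {\<Delta> t}" using same[OF that] by blast
      then show ?thesis by (rule finite_subset) simp
    qed simp
    ultimately show ?thesis using \<F>(1) by (meson finite_UN_I finite_subset)
  qed
  then have finv: "finite (\<Union>i. (\<lambda>d. \<bar>d i\<bar>) ` (\<Delta> ` X))" by simp
  define b where "b = Max (insert 0 (\<Union>i. (\<lambda>d. \<bar>d i\<bar>) ` (\<Delta> ` X)))"
  have b: "\<bar>t i - t i0\<bar> \<le> b" if "t \<in> X" for t i
  proof -
    have "\<bar>\<Delta> t i\<bar> \<in> insert 0 (\<Union>i. (\<lambda>d. \<bar>d i\<bar>) ` (\<Delta> ` X))" using that by blast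
    then have "\<bar>\<Delta> t i\<bar> \<le> b" unfolding b_def using finv by (intro Max_ge) auto
    then show ?thesis by (simp add: \<Delta>_def)
  qed
  define x where "x = g *v axis i0 1"
  have xL: "x \<in> Lset g" unfolding x_def Lset_def using R_0 R_1 by (intro imageI) (simp add: standard_lattice_def axis_def)
  have x0: "x \<noteq> 0"
  proof
    assume "x = 0"
    obtain g' where "g' ** g = mat 1" using g by (auto simp: invertible_def)
    then have "axis i0 (1 :: 'c) = g' *v x" by (simp add: x_def matrix_vector_mul_assoc)
    then have "axis i0 (1 :: 'c) $ i0 = 0" using \<open>x = 0\<close> by simp
    then show False by (simp add: axis_def)
  qed
  \<comment> \<open>The cube with all exponents \<open>T\<close> contains the lattice vector
    \<open>x\<close>. The exponents of the maximal box will differ from the one at \<open>i0\<close>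
    by at most \<open>b\<close>, so starting at \<open>T + b\<close> in that direction makes the box
    contain this cube.\<close>
  obtain T where T: "(\<Sum>i\<in>UNIV. av (x $ i)) < av p powi (- T)" using av_powi_large by blast
  obtain t0 where t0: "box_free (Lset g) t0" "t0 i0 = T + b" using ex_box_free[OF g i0] by blast
  obtain t where t: "box_free (Lset g) t" "\<forall>i. t0 i \<le> t i" "\<forall>j. \<not> box_free (Lset g) (t(j := t j + 1))"
    using box_free_extend[OF g t0(1)] by blast
  obtain u \<rho> where u: "u \<in> GLO" "\<forall>i j. \<rho> $ i $ j \<in> R" "dm t ** g ** \<rho> = u"
    using maximal_box_matrix[OF g t(1)] t(3) by blast
  obtain u' where u': "u' \<in> GLO" "u' ** u = mat 1" "u ** u' = mat 1" using GLO_inverse[OF u(1)] by blast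
  define \<rho>' where "\<rho>' = u' ** (dm t ** g)"
  have u\<rho>': "u ** \<rho>' = dm t ** g" by (simp add: \<rho>'_def matrix_mul_assoc u')
  have "\<rho>' ** \<rho> = u' ** (dm t ** g ** \<rho>)" by (simp add: \<rho>'_def matrix_mul_assoc)
  then have "\<rho>' ** \<rho> = mat 1" by (simp only: u(3) u'(2))
  moreover have "y = 0" if y: "y \<in> Lset \<rho>'" "\<forall>i. av (y $ i) < 1" for y
  proof -
    obtain r where r: "r \<in> standard_lattice R" "y = \<rho>' *v r" using y(1) by (auto simp: Lset_def)
    have "dm t *v (g *v r) = u *v y" by (simp add: r(2) matrix_vector_mul_assoc u\<rho>')
    then have eq: "p powi t i * (g *v r) $ i = (\<Sum>j\<in>UNIV. u $ i $ j * y $ j)" for i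
      unfolding dm_def vec_eq_iff diag_mult_vec by (simp add: matrix_vector_mult_def)
    have "av ((g *v r) $ i) < av p powi (- t i)" for i
    proof -
      have "av (\<Sum>j\<in>UNIV. u $ i $ j * y $ j) < 1"
      proof (rule av_sum_less)
        fix j
        have "av (u $ i $ j) * av (y $ j) \<le> 1 * av (y $ j)"
          using u(1) by (intro mult_right_mono) (auto simp: GLO_def bnd_def)
        then show "av (u $ i $ j * y $ j) < 1" using y(2) by (simp add: av_mult order_le_less_trans)
      qed simp
      then have "av p powi t i * av ((g *v r) $ i) < 1" by (metis eq av_mult av_powi)
      then show ?thesis using av_powi_pos[of "t i"] by (simp add: power_int_minus field_simps)
    qed
    moreover have "g *v r \<in> Lset g" using r(1) by (simp add: Lset_def)
    ultimately have "g *v r = 0" using t(1) unfolding box_free_def by blast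
    then have "y = 0" by (simp add: r(2) \<rho>'_def flip: matrix_vector_mul_assoc)
    then show ?thesis .
  qed
  ultimately have "\<rho>' \<in> \<N>" using u(2) by (auto simp: \<N>_def)
  moreover have "pact (pclass (dm t)) (lat g) = pact (pclass u) (lat \<rho>')" by (simp add: pact_lat u\<rho>')
  ultimately have "pact (pclass (dm t)) (lat g) \<in> \<K>" unfolding \<K>_def using u(1) by blast
  moreover have "pclass (dm t) \<in> H" using H(1) by (auto simp: PD_eq)
  ultimately have "t \<in> X" by (simp add: X_def Z_def)
  have "av (x $ i) < av p powi (- t i)" for i
  proof -
    have "T \<le> t i" using b[OF \<open>t \<in> X\<close>, of i] t(2)[rule_format, of i0] t0(2) by linarith
    then have "av p powi (- T) \<le> av p powi (- t i)" by (simp add: av_powi_le_iff)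
    moreover have "av (x $ i) \<le> (\<Sum>i\<in>UNIV. av (x $ i))" by (intro member_le_sum) auto
    ultimately show ?thesis using T by linarith
  qed
  then show False using t(1) xL x0 unfolding box_free_def by blast
qed

end

section \<open>Completions and the main equivalences\<close>

lemma field_homD:
  assumes "field_hom f"
  shows "f (x + y) = f x + f y" "f (x * y) = f x * f y" "f 1 = 1" "f 0 = 0" "f (- x) = - f x"
    "f (x - y) = f x - f y" "f x = f y \<longleftrightarrow> x = y" "f x = 0 \<longleftrightarrow> x = 0"
proof -
  show add: "f (x + y) = f x + f y" for x y using assms by (simp add: field_hom_def)
  show mult: "f (x * y) = f x * f y" for x y using assms by (simp add: field_hom_def)
  show one: "f 1 = 1" using assms by (simp add: field_hom_def)
  show zero: "f 0 = 0" using add[of 0 0] by (metis add_0_right add_left_cancel)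
  show uminus: "f (- x) = - f x" for x using add[of x "- x"] zero by (simp add: eq_neg_iff_add_eq_0 add.commute)
  show diff: "f (x - y) = f x - f y" for x y using add[of x "- y"] uminus[of y] by simp
  show eq0: "f x = 0 \<longleftrightarrow> x = 0" for x
  proof
    assume "f x = 0"
    show "x = 0"
    proof (rule ccontr)
      assume "x \<noteq> 0"
      then have "f x * f (inverse x) = 1" using mult[of x "inverse x"] one by simp
      then show False using \<open>f x = 0\<close> by simp
    qed
  qed (simp add: zero)
  show "f x = f y \<longleftrightarrow> x = y" using diff[of x y] eq0[of "x - y"] by simp
qed

context
  fixes v :: "'k::field \<Rightarrow> int" and \<iota> :: "'k \<Rightarrow> 'c::{field,complete_space}"
    and w :: "'c \<Rightarrow> int" and \<beta> :: real and \<pi> :: 'k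
  assumes v: "normalized_valuation v" and comp: "completion_at v \<iota> w \<beta>" and \<pi>: "\<pi> \<noteq> 0" "v \<pi> = 1"
begin

lemma completionD:
  shows "field_hom \<iota>" "normalized_valuation w" "x \<noteq> 0 \<Longrightarrow> w (\<iota> x) = v x" "1 < \<beta>"
    "dist a b = (if a = b then 0 else \<beta> powi (- w (a - b)))" "closure (range \<iota>) = UNIV"
  using comp by (auto simp: completion_at_def)

lemmas hom_\<iota> = field_homD[OF completionD(1)]

lemma dist_eq: "x \<noteq> 0 \<Longrightarrow> dist x (0 :: 'c) = \<beta> powi (- w x)"
  by (simp add: completionD(5))

lemma powi_\<beta>_le_iff: "\<beta> powi k \<le> \<beta> powi l \<longleftrightarrow> k \<le> l"
  using power_int_strict_increasing[OF _ completionD(4), of l k] power_int_increasing[of k l \<beta>] completionD(4)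
  by (meson leD le_less_linear less_imp_le)

lemma dist_le_iff: "dist x (0 :: 'c) \<le> \<beta> powi k \<longleftrightarrow> val_ge w (- k) x"
proof (cases "x = 0")
  case True
  then show ?thesis using completionD(4) by simp
next
  case False
  then show ?thesis using powi_\<beta>_le_iff[of "- w x" k] by (auto simp: dist_eq val_ge_def)
qed

lemma dist_sub: "dist x y = dist (x - y) (0 :: 'c)"
  by (simp add: completionD(5))

lemma val_ge_\<iota>: "val_ge w m (\<iota> x) \<longleftrightarrow> val_ge v m x"
  by (cases "x = 0") (auto simp: val_ge_def hom_\<iota> completionD(3))

lemma approximation: "\<exists>y. val_ge w m (x - \<iota> y)"
proof -
  have "x \<in> closure (range \<iota>)" using completionD(6) by simp
  moreover have "0 < \<beta> powi (- m)" using completionD(4) by simp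
  ultimately obtain y where "dist (\<iota> y) x < \<beta> powi (- m)"
    unfolding closure_approachable by blast
  then have "dist x (\<iota> y) \<le> \<beta> powi (- m)" by (simp add: dist_commute)
  then have "val_ge w m (x - \<iota> y)" using dist_le_iff[of "x - \<iota> y" "- m"] dist_sub[of x "\<iota> y"] by simp
  then show ?thesis by blast
qed

text \<open>Truncated \<pi>-adic expansions: \<open>E\<close> contains representatives of the
  residues, and density of K gives the next digit.\<close>

lemma totally_bounded_integers:
  assumes E: "finite E" "\<And>x. val_ge v 0 x \<Longrightarrow> \<exists>e\<in>E. \<exists>w. val_ge v 0 w \<and> x = e + \<pi> * w"
  shows "\<exists>F. finite F \<and> (\<forall>x. val_ge w 0 x \<longrightarrow> (\<exists>y\<in>F. val_ge w (int k) (x - y)))"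
proof (induction k)
  case 0
  show ?case by (intro exI[of _ "{0}"]) simp
next
  case (Suc k)
  note w = completionD(2)
  obtain F where F: "finite F" "\<And>x. val_ge w 0 x \<Longrightarrow> \<exists>y\<in>F. val_ge w (int k) (x - y)" using Suc by blast
  let ?p = "\<iota> \<pi>"
  have p: "?p \<noteq> 0" "w ?p = 1" using \<pi> by (simp_all add: hom_\<iota> completionD(3))
  let ?g = "\<lambda>(y, e). y + ?p ^ k * \<iota> e"
  have "\<exists>z\<in>?g ` (F \<times> E). val_ge w (int (Suc k)) (x - z)" if x: "val_ge w 0 x" for x
  proof -
    obtain y where y: "y \<in> F" "val_ge w (int k) (x - y)" using F(2)[OF x] by blast
    define z where "z = (x - y) / ?p ^ k"
    have z: "val_ge w 0 z"
      using y(2) p by (cases "x = y") (simp_all add: z_def val_ge_def val_divide[OF w] val_power[OF w])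
    have xy: "x = y + ?p ^ k * z" using p by (simp add: z_def)
    obtain a where a: "val_ge w 1 (z - \<iota> a)" using approximation by blast
    have "val_ge w 0 (z - (z - \<iota> a))" by (rule val_ge_diff[OF w z val_ge_mono[OF a]]) simp
    then have "val_ge v 0 a" by (simp add: val_ge_\<iota>)
    then obtain e b where e: "e \<in> E" "val_ge v 0 b" "a = e + \<pi> * b" using E(2) by blast
    have "val_ge w 1 ?p" "val_ge w 0 (\<iota> b)" using p e(2) by (simp add: val_ge_def, simp only: val_ge_\<iota>)
    then have "val_ge w (1 + 0) (?p * \<iota> b)" by (rule val_ge_mult[OF w])
    then have "val_ge w 1 (z - \<iota> a + ?p * \<iota> b)" using a by (intro val_ge_add[OF w]) simp_all
    moreover have "z - \<iota> a + ?p * \<iota> b = z - \<iota> e" by (simp add: e(3) hom_\<iota>)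
    ultimately have "val_ge w (int k + 1) (?p ^ k * (z - \<iota> e))"
      using p by (intro val_ge_mult[OF w]) (auto simp: val_ge_def val_power[OF w])
    moreover have "x - ?g (y, e) = ?p ^ k * (z - \<iota> e)" by (simp add: xy algebra_simps)
    ultimately show ?thesis using y(1) e(1) by (intro bexI[of _ "?g (y, e)"]) (auto simp: add.commute)
  qed
  moreover have "finite (?g ` (F \<times> E))" using F(1) E(1) by simp
  ultimately show ?case by blast
qed

lemma totally_bounded_balls:
  assumes E: "finite E" "\<And>x. val_ge v 0 x \<Longrightarrow> \<exists>e\<in>E. \<exists>w. val_ge v 0 w \<and> x = e + \<pi> * w" and e: "0 < e"
  shows "\<exists>F. finite F \<and> (\<forall>x :: 'c. dist x 0 \<le> \<rho> \<longrightarrow> (\<exists>y\<in>F. dist x y < e))"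
proof -
  note w = completionD(2)
  let ?p = "\<iota> \<pi>"
  have p: "?p \<noteq> 0" "w ?p = 1" using \<pi> by (simp_all add: hom_\<iota> completionD(3))
  obtain n where n: "\<rho> < \<beta> ^ n" using real_arch_pow[OF completionD(4)] by blast
  obtain m where m: "inverse e < \<beta> ^ m" using real_arch_pow[OF completionD(4)] by blast
  have me: "\<beta> powi (- int m) < e"
    using m e completionD(4) by (simp add: power_int_minus field_simps)
  obtain F where F: "finite F" "\<And>x. val_ge w 0 x \<Longrightarrow> \<exists>y\<in>F. val_ge w (int (n + m)) (x - y)"
    using totally_bounded_integers[OF E] by blast
  have "\<exists>y\<in>(\<lambda>y. y / ?p ^ n) ` F. dist x y < e" if x: "dist x 0 \<le> \<rho>" for x
  proof -
    have "dist x 0 \<le> \<beta> powi int n" using x n by simp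
    then have "val_ge w (- int n) x" by (simp only: dist_le_iff)
    then have "val_ge w 0 (x * ?p ^ n)"
      using p by (cases "x = 0") (simp_all add: val_ge_def val_mult[OF w] val_power[OF w])
    then obtain y where y: "y \<in> F" "val_ge w (int (n + m)) (x * ?p ^ n - y)" using F(2) by blast
    have "x * ?p ^ n - y = (x - y / ?p ^ n) * ?p ^ n" using p by (simp add: field_simps)
    then have "val_ge w (int m) (x - y / ?p ^ n)"
      using y(2) p by (cases "x = y / ?p ^ n") (simp_all add: val_ge_def val_mult[OF w] val_power[OF w])
    then have "dist (x - y / ?p ^ n) 0 \<le> \<beta> powi (- int m)" by (simp only: dist_le_iff minus_minus)
    then have "dist x (y / ?p ^ n) < e" using me dist_sub[of x "y / ?p ^ n"] by simp
    then show ?thesis using y(1) by blast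
  qed
  then show ?thesis using F(1) by (intro exI[of _ "(\<lambda>y. y / ?p ^ n) ` F"]) simp
qed

lemma valued_lattice_completion:
  assumes ff: "function_field_over (\<kappa> :: 'f::{field,finite} \<Rightarrow> 'k)"
  shows "valued_lattice (\<iota> ` affine_ring v) (\<iota> \<pi>)"
proof -
  interpret function_field_over \<kappa> by (rule ff)
  note w = completionD(2)
  have \<beta>: "0 < \<beta>" "\<beta> \<noteq> 0" using completionD(4) by auto
  have dp: "dist (\<iota> \<pi>) 0 = inverse \<beta>"
    using \<pi> by (simp add: dist_eq hom_\<iota> completionD(3) power_int_minus)
  show ?thesis
  proof
    fix x y :: 'c
    show "dist (x * y) 0 = dist x 0 * dist y 0"
    proof (cases "x = 0 \<or> y = 0")
      case False
      then show ?thesis using \<beta> by (simp add: dist_eq val_mult[OF w] flip: power_int_add)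
    qed auto
    show "dist x y = dist (x - y) 0" by (rule dist_sub)
    show "dist (x + y) 0 \<le> max (dist x 0) (dist y 0)"
    proof (cases "x = 0 \<or> y = 0 \<or> x + y = 0")
      case False
      then have "- w (x + y) \<le> max (- w x) (- w y)" using val_add[OF w, of x y] by linarith
      then have "- w (x + y) \<le> - w x \<or> - w (x + y) \<le> - w y" by linarith
      then show ?thesis using False by (auto simp: dist_eq le_max_iff_disj powi_\<beta>_le_iff)
    qed (auto simp: le_max_iff_disj)
    show "0 < dist (\<iota> \<pi>) 0" "dist (\<iota> \<pi>) 0 < 1"
      unfolding dp using completionD(4) by (auto simp: inverse_less_1_iff)
    show "\<exists>k. dist x 0 = dist (\<iota> \<pi>) 0 powi k" if "x \<noteq> 0"
      using that by (intro exI[of _ "w x"]) (simp add: dp dist_eq power_int_minus power_int_inverse)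
  next
    show "0 \<in> \<iota> ` affine_ring v" "1 \<in> \<iota> ` affine_ring v"
      using affine_ring_closed(1,2)[of v] hom_\<iota>(3,4) by (metis image_eqI)+
    fix x y assume xy: "x \<in> \<iota> ` affine_ring v" "y \<in> \<iota> ` affine_ring v"
    then obtain a b where ab: "a \<in> affine_ring v" "x = \<iota> a" "b \<in> affine_ring v" "y = \<iota> b" by blast
    show "x + y \<in> \<iota> ` affine_ring v" "x * y \<in> \<iota> ` affine_ring v"
      using affine_ring_closed(3,4)[OF ab(1,3)] by (simp_all add: ab hom_\<iota> flip: hom_\<iota>(1,2))
  next
    fix x assume x: "x \<in> \<iota> ` affine_ring v"
    then obtain a where a: "a \<in> affine_ring v" "x = \<iota> a" by blast
    have "- a \<in> affine_ring v" using a(1) unfolding affine_ring_iff by simp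
    then show "- x \<in> \<iota> ` affine_ring v" by (simp add: a(2) flip: hom_\<iota>(5))
    show "1 \<le> dist x 0" if "x \<noteq> 0"
    proof -
      have "a \<noteq> 0" using that a(2) hom_\<iota>(4) by auto
      then have "w x \<le> 0" using affine_val_nonpos[OF v a(1)] by (simp add: a(2) completionD(3))
      then show ?thesis using powi_\<beta>_le_iff[of 0 "- w x"] that by (simp add: dist_eq)
    qed
  next
    obtain m where m: "\<And>y. \<exists>r\<in>affine_ring v. val_ge v m (y - r)" using affine_cocompact[OF v] by blast
    have "\<exists>r\<in>\<iota> ` affine_ring v. dist x r \<le> \<beta> powi (- m)" for x
    proof -
      obtain y where y: "val_ge w m (x - \<iota> y)" using approximation by blast
      obtain r where r: "r \<in> affine_ring v" "val_ge v m (y - r)" using m by blast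
      have "val_ge w m (\<iota> (y - r))" using r(2) by (simp only: val_ge_\<iota>)
      then have "val_ge w m (x - \<iota> y + \<iota> (y - r))" by (rule val_ge_add[OF w y])
      then have "val_ge w m (x - \<iota> r)" by (simp add: hom_\<iota>)
      then have "dist (x - \<iota> r) 0 \<le> \<beta> powi (- m)" by (simp add: dist_le_iff)
      then have "dist x (\<iota> r) \<le> \<beta> powi (- m)" using dist_sub[of x "\<iota> r"] by simp
      then show ?thesis using r(1) by blast
    qed
    then show "\<exists>C. \<forall>x. \<exists>r\<in>\<iota> ` affine_ring v. dist x r \<le> C" by blast
  next
    fix e \<rho> :: real assume e: "0 < e"
    obtain E where "finite E" "\<forall>x. val_ge v 0 x \<longrightarrow> (\<exists>e\<in>E. \<exists>w. val_ge v 0 w \<and> x = e + \<pi> * w)"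
      using finite_residues[OF v \<pi>] by blast
    then show "\<exists>F :: 'c set. finite F \<and> (\<forall>x. dist x 0 \<le> \<rho> \<longrightarrow> (\<exists>y\<in>F. dist x y < e))"
      by (intro totally_bounded_balls[OF _ _ e]) blast+
  qed
qed

end

section \<open>The six conditions compared with axiality\<close>

context valued_lattice begin

lemma Lset_scale_mult: "Lset (mat c ** g) = (\<lambda>x. c *s x) ` Lset g"
  by (simp add: Lset_def image_image scaled_mult_vec)

lemma axial_if_lat_eq:
  assumes "invertible g" "invertible h" "lat g = lat (h :: 'c ^ 'n::finite ^ 'n)" "axial g"
  shows "axial h"
proof -
  obtain c where c: "c \<noteq> 0" "Lset g = (\<lambda>x. c *s x) ` Lset h"
    using assms(3) unfolding lat_Lset homothety_class_eq_iff by blast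
  show ?thesis unfolding axial_def
  proof
    fix i
    obtain d where d: "d \<noteq> 0" "d *s axis i 1 \<in> Lset g" using assms(4) unfolding axial_def by blast
    then obtain x where x: "x \<in> Lset h" "d *s axis i 1 = c *s x" using c(2) by auto
    then have "inverse c *s (d *s axis i 1) = x" using c(1) by simp
    then have "(d / c) *s axis i 1 = x" by (simp add: divide_inverse mult.commute)
    then show "\<exists>e. e \<noteq> 0 \<and> e *s axis i 1 \<in> Lset h" using x(1) c(1) d(1) by (intro exI[of _ "d / c"]) simp
  qed
qed

lemma diag_mult_axis: "diag_matrix a *v (c *s axis i 1) = (a i * c) *s (axis i 1 :: 'c ^ 'n::finite)"
  unfolding vec_eq_iff diag_mult_vec by (simp add: axis_def)

lemma axial_diag_mult:
  assumes "\<And>i. a i \<noteq> 0" "axial g" shows "axial (diag_matrix a ** (g :: 'c ^ 'n::finite ^ 'n))"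
  unfolding axial_def
proof
  fix i
  obtain d where d: "d \<noteq> 0" "d *s axis i 1 \<in> Lset g" using assms(2) unfolding axial_def by blast
  have "Lset (diag_matrix a ** g) = (\<lambda>x. diag_matrix a *v x) ` Lset g"
    by (simp add: Lset_def image_image matrix_vector_mul_assoc)
  then have "(a i * d) *s axis i 1 \<in> Lset (diag_matrix a ** g)"
    using d(2) by (simp flip: diag_mult_axis)
  then show "\<exists>c. c \<noteq> 0 \<and> c *s axis i 1 \<in> Lset (diag_matrix a ** g)"
    using d(1) assms(1) by (intro exI[of _ "a i * d"]) simp
qed

lemma diag_inverse: "(\<And>i. a i \<noteq> 0) \<Longrightarrow> diag_matrix (\<lambda>i. inverse (a i)) ** diag_matrix a = (mat 1 :: 'c ^ 'n::finite ^ 'n)"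
  unfolding diag_matrix_mult by (simp add: diag_matrix_def mat_def)

lemma axial_diag_mult_iff:
  assumes "\<And>i. a i \<noteq> 0" shows "axial (diag_matrix a ** (g :: 'c ^ 'n::finite ^ 'n)) \<longleftrightarrow> axial g"
proof
  assume "axial (diag_matrix a ** g)"
  then have "axial (diag_matrix (\<lambda>i. inverse (a i)) ** (diag_matrix a ** g))"
    by (rule axial_diag_mult[rotated]) (simp add: assms)
  then show "axial g" by (simp only: matrix_mul_assoc diag_inverse[OF assms] matrix_mul_lid)
qed (use axial_diag_mult assms in blast)

lemma axial_lattice_iff:
  assumes "invertible (g :: 'c ^ 'n::finite ^ 'n)" shows "axial_lattice R (Lset g) \<longleftrightarrow> axial g"
proof -
  have "is_lattice R (Lset g)" using is_lattice_iff[OF R_0 R_1] assms unfolding Lset_def by blast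
  moreover have "Lset g \<inter> range (\<lambda>c. c *s axis i 1) \<noteq> {0} \<longleftrightarrow> (\<exists>c. c \<noteq> 0 \<and> c *s axis i 1 \<in> Lset g)" for i
  proof
    have "0 = 0 *s (axis i 1 :: 'c ^ 'n)" by simp
    then have "0 \<in> Lset g \<inter> range (\<lambda>c. c *s axis i 1)" using Lset_0 by blast
    moreover assume "Lset g \<inter> range (\<lambda>c. c *s axis i 1) \<noteq> {0}"
    ultimately obtain x where "x \<in> Lset g \<inter> range (\<lambda>c. c *s axis i 1)" "x \<noteq> 0" by blast
    then show "\<exists>c. c \<noteq> 0 \<and> c *s axis i 1 \<in> Lset g" by auto
  next
    assume "\<exists>c. c \<noteq> 0 \<and> c *s axis i 1 \<in> Lset g"
    then obtain c where c: "c \<noteq> 0" "c *s axis i 1 \<in> Lset g" by blast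
    have "c *s axis i (1 :: 'c) \<noteq> (0 :: 'c ^ 'n)"
    proof
      assume "c *s axis i (1 :: 'c) = (0 :: 'c ^ 'n)"
      then have "(c *s axis i (1 :: 'c)) $ i = (0 :: 'c ^ 'n) $ i" by simp
      then show False using c(1) by (simp add: axis_def)
    qed
    then show "Lset g \<inter> range (\<lambda>c. c *s axis i 1) \<noteq> {0}" using c(2) by blast
  qed
  ultimately show ?thesis by (simp add: axial_lattice_def axial_def)
qed

lemma lattice_eq_Lset:
  assumes "is_lattice R (L :: ('c ^ 'n::finite) set)"
  obtains g :: "'c ^ 'n ^ 'n" where "invertible g" "L = Lset g"
  using assms is_lattice_iff[OF R_0 R_1] unfolding Lset_def by metis

lemma Lset_subset_iff: "Lset g \<subseteq> standard_lattice R \<longleftrightarrow> (\<forall>i j. g $ i $ j \<in> R)" for g :: "'c ^ 'n::finite ^ 'n"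
  unfolding Lset_def using entries_in_iff[OF R_0 R_1 R_add R_mult] by blast

text \<open>The columns of \<open>h\<close> are the R-coordinates of multiples of the basis vectors.
  Integral lattices use this with an adjugate, rational ones with the inverse times a common
  denominator.\<close>

lemma axial_if_entries:
  assumes "invertible (g :: 'c ^ 'n::finite ^ 'n)" "\<forall>i j. h $ i $ j \<in> R" "g ** h = mat c" "c \<noteq> 0"
  shows "axial g"
  unfolding axial_def
proof
  fix i
  have "column i h \<in> standard_lattice R" using assms(2) by (simp add: standard_lattice_def column_def)
  moreover have "c *s axis i 1 = g *v column i h"
    by (simp flip: mult_axis mat_mult_vec assms(3) add: matrix_vector_mul_assoc)
  ultimately have "c *s axis i 1 \<in> Lset g" unfolding Lset_def by blast
  then show "\<exists>c. c \<noteq> 0 \<and> c *s axis i 1 \<in> Lset g" using assms(4) by blast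
qed

text \<open>The columns of \<rho> are coordinates of axis vectors in the lattice, and
  \<open>a\<close> rescales these vectors to the standard basis.\<close>

lemma axial_normal_form:
  assumes "invertible (g :: 'c ^ 'n::finite ^ 'n)" "axial g"
  shows "\<exists>a \<rho>. (\<forall>i. a i \<noteq> 0) \<and> (\<forall>i j. \<rho> $ i $ j \<in> R) \<and> diag_matrix a ** g ** \<rho> = mat 1"
proof -
  obtain d where d: "\<And>i. d i \<noteq> 0" "\<And>i. d i *s axis i 1 \<in> Lset g"
    using assms(2) unfolding axial_def by metis
  then have "\<forall>i. \<exists>r. r \<in> standard_lattice R \<and> d i *s axis i 1 = g *v r" by (auto simp: Lset_def)
  then obtain r where r: "\<And>i. r i \<in> standard_lattice R" "\<And>i. d i *s axis i 1 = g *v r i" by metis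
  define \<rho> :: "'c ^ 'n ^ 'n" where "\<rho> = (\<chi> i j. r j $ i)"
  define a where "a i = inverse (d i)" for i
  have "diag_matrix a ** g ** \<rho> = mat 1"
  proof -
    have "(diag_matrix a ** g ** \<rho>) $ i $ j = (mat 1 :: 'c ^ 'n ^ 'n) $ i $ j" for i j
    proof -
      have "(diag_matrix a ** g ** \<rho>) $ i $ j = (diag_matrix a *v (g *v r j)) $ i"
        unfolding matrix_vector_mul_assoc
        by (simp add: \<rho>_def matrix_matrix_mult_def[of "diag_matrix a ** g"] matrix_vector_mult_def)
      also have "\<dots> = (mat 1 :: 'c ^ 'n ^ 'n) $ i $ j"
        unfolding r(2)[symmetric] diag_mult_axis using d(1) by (simp add: a_def axis_def mat_def)
      finally show ?thesis .
    qed
    then show ?thesis by (simp add: vec_eq_iff)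
  qed
  moreover have "\<rho> $ i $ j \<in> R" for i j using standard_latticeD[OF r(1)] by (simp add: \<rho>_def)
  ultimately show ?thesis using d(1) by (intro exI[of _ a] exI[of _ \<rho>]) (simp add: a_def)
qed

lemma PA_subset_PG: "(PA :: ('c, 'n::finite) pmat set) \<subseteq> PG"
  by (auto simp: PA_def PG_def intro!: imageI invertible_diag_matrix)

lemma PD_subset_PA: "PD p \<subseteq> (PA :: ('c, 'n::finite) pmat set)"
  using av_p(3) by (auto simp: PA_def PD_def)

lemma proper_PA_iff_axial:
  assumes g: "invertible (g :: 'c ^ 'n::finite ^ 'n)"
  shows "proper_map (subtopology PG_top PA) (PX_top R) (\<lambda>P. pact P (lat g)) \<longleftrightarrow> axial g"
  using axial_if_proper[OF g PD_subset_PA PA_subset_PG]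
    proper_map_if_compact_preimages[OF g PA_subset_PG compactin_PA_orbit[OF g]] by blast

lemma proper_PD_iff_axial:
  assumes g: "invertible (g :: 'c ^ 'n::finite ^ 'n)"
  shows "proper_map (subtopology PG_top (PD p)) (PX_top R) (\<lambda>P. pact P (lat g)) \<longleftrightarrow> axial g"
proof
  have PD: "PD p \<subseteq> (PG :: ('c, 'n) pmat set)" using PD_subset_PA PA_subset_PG by blast
  show "axial g" if "proper_map (subtopology PG_top (PD p)) (PX_top R) (\<lambda>P. pact P (lat g))"
    by (rule axial_if_proper[OF g order_refl PD that])
  show "proper_map (subtopology PG_top (PD p)) (PX_top R) (\<lambda>P. pact P (lat g))" if ax: "axial g"
  proof (rule proper_map_if_compact_preimages[OF g PD])
    fix h :: "'c ^ 'n ^ 'n" assume h: "invertible h"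
    show "compactin PG_top {P \<in> PD p. pact P (lat g) \<in> (\<lambda>k. lat (k ** h)) ` GLO}"
      using PD by (intro finite_imp_compactin finite_PD_orbit[OF g h ax]) auto
  qed
qed

lemma orbit_axial_iff:
  assumes g: "invertible (g :: 'c ^ 'n::finite ^ 'n)" and m: "invertible m" and mem: "lat m \<in> PX_orbit PA (lat g)"
  shows "axial m \<longleftrightarrow> axial g"
proof -
  obtain a where a: "\<forall>i. a i \<noteq> 0" "lat m = lat (diag_matrix a ** g)"
    using mem unfolding PX_orbit_def PA_def by (auto simp: pact_lat)
  have inv: "invertible (diag_matrix a ** g)" using invertible_mult[OF invertible_diag_matrix g] a(1) by blast
  have "axial m \<longleftrightarrow> axial (diag_matrix a ** g)"
    using axial_if_lat_eq[OF m inv a(2)] axial_if_lat_eq[OF inv m a(2)[symmetric]] by blast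
  then show ?thesis using axial_diag_mult_iff[of a g] a(1) by blast
qed

lemma lat_in_orbit: "lat g \<in> PX_orbit PA (lat (g :: 'c ^ 'n::finite ^ 'n))"
proof -
  have "diag_matrix (\<lambda>_. 1) = (mat 1 :: 'c ^ 'n ^ 'n)" by (simp add: diag_matrix_def mat_def)
  then have "lat g = pact (pclass (diag_matrix (\<lambda>_. 1))) (lat g)" by (simp add: pact_lat)
  moreover have "pclass (diag_matrix (\<lambda>_. 1)) \<in> (PA :: ('c, 'n) pmat set)" unfolding PA_def by force
  ultimately show ?thesis unfolding PX_orbit_def by blast
qed

lemma diag_mult_in_orbit:
  "(\<And>i. a i \<noteq> 0) \<Longrightarrow> lat (diag_matrix a ** g) \<in> PX_orbit PA (lat (g :: 'c ^ 'n::finite ^ 'n))"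
  unfolding PX_orbit_def PA_def by (auto simp flip: pact_lat)

lemma ex_axial_iff:
  assumes g: "invertible (g :: 'c ^ 'n::finite ^ 'n)"
  shows "(\<exists>M. axial_lattice R M \<and> homothety_class M \<in> PX_orbit PA (lat g)) \<longleftrightarrow> axial g"
proof
  assume "\<exists>M. axial_lattice R M \<and> homothety_class M \<in> PX_orbit PA (lat g)"
  then obtain M where M: "axial_lattice R M" "homothety_class M \<in> PX_orbit PA (lat g)" by blast
  then obtain m :: "'c ^ 'n ^ 'n" where m: "invertible m" "M = Lset m"
    using lattice_eq_Lset[of M] by (auto simp: axial_lattice_def)
  then have "axial m" using M(1) axial_lattice_iff by blast
  then show "axial g" using orbit_axial_iff[OF g m(1)] M(2) m(2) by (simp add: lat_Lset)
next
  assume "axial g"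
  then show "\<exists>M. axial_lattice R M \<and> homothety_class M \<in> PX_orbit PA (lat g)"
    using axial_lattice_iff[OF g] lat_in_orbit[of g] by (auto simp: lat_Lset)
qed

lemma all_axial_iff:
  assumes g: "invertible (g :: 'c ^ 'n::finite ^ 'n)"
  shows "(\<forall>y\<in>PX_orbit PA (lat g). \<exists>M. axial_lattice R M \<and> y = homothety_class M) \<longleftrightarrow> axial g"
proof
  assume *: "\<forall>y\<in>PX_orbit PA (lat g). \<exists>M. axial_lattice R M \<and> y = homothety_class M"
  then have "\<exists>M. axial_lattice R M \<and> lat g = homothety_class M" using lat_in_orbit by blast
  then have "\<exists>M. axial_lattice R M \<and> homothety_class M \<in> PX_orbit PA (lat g)" using lat_in_orbit by metis
  then show "axial g" using ex_axial_iff[OF g] by blast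
next
  assume ax: "axial g"
  show "\<forall>y\<in>PX_orbit PA (lat g). \<exists>M. axial_lattice R M \<and> y = homothety_class M"
  proof
    fix y assume "y \<in> PX_orbit PA (lat g)"
    then obtain a where "\<forall>i. a i \<noteq> 0" and y: "y = lat (diag_matrix a ** g)"
      unfolding PX_orbit_def PA_def by (auto simp: pact_lat)
    then have a: "a i \<noteq> 0" for i by blast
    have inv: "invertible (diag_matrix a ** g)" by (rule invertible_mult[OF invertible_diag_matrix g]) (rule a)
    have "axial (diag_matrix a ** g)" by (rule axial_diag_mult[OF a ax])
    then show "\<exists>M. axial_lattice R M \<and> y = homothety_class M"
      using axial_lattice_iff[OF inv] y by (auto simp: lat_Lset)
  qed
qed

lemma ex_integral_iff:
  assumes g: "invertible (g :: 'c ^ 'n::finite ^ 'n)"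
  shows "(\<exists>M. integral_lattice R M \<and> homothety_class M \<in> PX_orbit PA (lat g)) \<longleftrightarrow> axial g"
proof
  assume "\<exists>M. integral_lattice R M \<and> homothety_class M \<in> PX_orbit PA (lat g)"
  then obtain M where M: "integral_lattice R M" "homothety_class M \<in> PX_orbit PA (lat g)" by blast
  then obtain m :: "'c ^ 'n ^ 'n" where m: "invertible m" "M = Lset m"
    using lattice_eq_Lset[of M] by (auto simp: integral_lattice_def)
  then have "\<forall>i j. m $ i $ j \<in> R" using M(1) Lset_subset_iff by (auto simp: integral_lattice_def)
  then obtain b where "\<forall>i j. b $ i $ j \<in> R" "m ** b = mat (det m)"
    using R_adjugate[of m] invertible_imp_det[OF m(1)] by blast
  then have "axial m" by (rule axial_if_entries[OF m(1) _ _ invertible_imp_det[OF m(1)]])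
  then show "axial g" using orbit_axial_iff[OF g m(1)] M(2) m(2) by (simp add: lat_Lset)
next
  assume "axial g"
  then obtain a \<rho> where "\<forall>i. a i \<noteq> 0" and \<rho>: "\<forall>i j. \<rho> $ i $ j \<in> R" "diag_matrix a ** g ** \<rho> = mat 1"
    using axial_normal_form[OF g] by blast
  then have a: "a i \<noteq> 0" for i by blast
  let ?g = "diag_matrix a ** g"
  have \<rho>': "\<rho> ** ?g = mat 1" using \<rho>(2) by (rule matrix_left_right_inverse[THEN iffD1])
  have "invertible \<rho>" using \<rho>(2) \<rho>' unfolding invertible_def by blast
  then have d: "det \<rho> \<noteq> 0" by (rule invertible_imp_det)
  \<comment> \<open>\<open>b\<close> is the adjugate of \<rho>, hence det \<rho> times
    \<open>?g\<close>, the inverse of \<rho>: an integral lattice homothetic to that of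
    \<open>?g\<close>.\<close>
  obtain b where b: "\<forall>i j. b $ i $ j \<in> R" "\<rho> ** b = mat (det \<rho>)" using R_adjugate[of \<rho>] \<rho>(1) d by blast
  have "b = ?g ** \<rho> ** b" by (simp add: \<rho>(2))
  also have "\<dots> = mat (det \<rho>) ** ?g" by (metis b(2) mat_commute matrix_mul_assoc)
  finally have b_eq: "b = mat (det \<rho>) ** ?g" .
  have "invertible ?g" using \<rho>(2) \<rho>' unfolding invertible_def by blast
  then have "det b \<noteq> 0" using invertible_imp_det d by (simp add: b_eq det_mul[of "mat _"] det_mat)
  then have "invertible b" by (simp add: invertible_det_nz)
  then have "is_lattice R (Lset b)" using is_lattice_iff[OF R_0 R_1] unfolding Lset_def by blast
  then have "integral_lattice R (Lset b)" using b(1) Lset_subset_iff[of b] by (simp add: integral_lattice_def)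
  moreover have "homothety_class (Lset b) = lat ?g"
    unfolding lat_Lset homothety_class_eq_iff b_eq Lset_scale_mult using d by blast
  ultimately show "\<exists>M. integral_lattice R M \<and> homothety_class M \<in> PX_orbit PA (lat g)"
    using diag_mult_in_orbit[of a g] a by metis
qed

end

lemma map_matrix_mult:
  assumes "field_hom f"
  shows "map_matrix f (A ** B) = map_matrix f A ** (map_matrix f B :: 'c::field ^ 'n ^ 'n)"
proof -
  have "f (sum g I) = (\<Sum>i\<in>I. f (g i))" for g and I :: "'n set"
    by (induction I rule: infinite_finite_induct) (simp_all add: field_homD[OF assms])
  then show ?thesis by (simp add: map_matrix_def matrix_matrix_mult_def vec_eq_iff field_homD[OF assms])
qed

lemma det_map_matrix:
  assumes "field_hom f" shows "det (map_matrix f A) = f (det (A :: 'a::field ^ 'n ^ 'n))"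
proof -
  have sum: "f (sum g I) = (\<Sum>i\<in>I. f (g i))" for g and I :: "('n \<Rightarrow> 'n) set"
    by (induction I rule: infinite_finite_induct) (simp_all add: field_homD[OF assms])
  have prod: "f (prod g I) = (\<Prod>i\<in>I. f (g i))" for g and I :: "'n set"
    by (induction I rule: infinite_finite_induct) (simp_all add: field_homD[OF assms])
  show ?thesis unfolding det_def sum
    by (intro sum.cong refl) (simp add: map_matrix_def sign_def prod field_homD[OF assms])
qed

lemma map_matrix_mat:
  assumes "field_hom f" shows "map_matrix f (mat c) = mat (f c)"
  by (simp add: map_matrix_def mat_def vec_eq_iff field_homD[OF assms])

theorem theorem3p1:
  fixes j :: "'f::{field,finite} poly fract \<Rightarrow> 'k::field"
    and v :: "'k \<Rightarrow> int"
    and \<iota> :: "'k \<Rightarrow> 'c::{field,complete_space}"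
    and w :: "'c \<Rightarrow> int"
    and \<beta> :: real
    and \<pi> :: 'k
    and R :: "'c set"
    and L :: "('c ^ 'n::finite) set"
    and x :: "('c ^ 'n) set set"
  assumes "function_field j"
    and "normalized_valuation v"
    and "completion_at v \<iota> w \<beta>"
    and "\<pi> \<noteq> 0" and "v \<pi> = 1"
    and "R = \<iota> ` affine_ring v"
    and "2 \<le> CARD('n)"
    and "is_lattice R L"
    and "x = homothety_class L"
  shows "all_equivalent
    [proper_map (subtopology PG_top PA) (PX_top R) (\<lambda>a. pact a x),
     proper_map (subtopology PG_top (PD (\<iota> \<pi>))) (PX_top R) (\<lambda>d. pact d x),
     \<exists>a\<in>PA. \<exists>h\<in>PGL_sub \<iota>. x = pact (pmult a h) (homothety_class (standard_lattice R)),
     \<exists>M. integral_lattice R M \<and> homothety_class M \<in> PX_orbit PA x,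
     \<exists>M. axial_lattice R M \<and> homothety_class M \<in> PX_orbit PA x,
     \<forall>y\<in>PX_orbit PA x. \<exists>M. axial_lattice R M \<and> y = homothety_class M]"
proof -
  note hom_\<iota> = field_homD[OF completionD(1)[OF assms(2,3,4,5)]]
  have hom: "field_hom \<iota>" by (rule completionD(1)[OF assms(2,3,4,5)])
  interpret valued_lattice R "\<iota> \<pi>"
    unfolding \<open>R = _\<close>
    by (rule valued_lattice_completion[OF assms(2,3,4,5) function_field_over_j[OF assms(1)]])
  interpret ff: function_field_over "\<lambda>a. jp j [:a:]" by (rule function_field_over_j[OF assms(1)])
  obtain g :: "'c ^ 'n ^ 'n" where g: "invertible g" and L: "L = Lset g"
    using lattice_eq_Lset[OF \<open>is_lattice R L\<close>] .
  have x: "x = lat g" using \<open>x = _\<close> L by (simp add: lat_Lset)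
  have "(\<exists>a\<in>PA. \<exists>h\<in>PGL_sub \<iota>. x = pact (pmult a h) (homothety_class (standard_lattice R))) \<longleftrightarrow> axial g"
  proof
    assume "\<exists>a\<in>PA. \<exists>h\<in>PGL_sub \<iota>. x = pact (pmult a h) (homothety_class (standard_lattice R))"
    then obtain a and h :: "'k ^ 'n ^ 'n" where "\<forall>i. a i \<noteq> 0" and h: "invertible h"
      and x_eq: "x = pact (pmult (pclass (diag_matrix a)) (pclass (map_matrix \<iota> h))) (homothety_class (standard_lattice R))"
      unfolding PA_def PGL_sub_def by blast
    then have a: "a i \<noteq> 0" for i by blast
    obtain h' where h': "h ** h' = mat 1" "h' ** h = mat 1" using h by (auto simp: invertible_def)
    have \<iota>h: "map_matrix \<iota> h ** map_matrix \<iota> h' = mat 1" "map_matrix \<iota> h' ** map_matrix \<iota> h = mat 1"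
      by (simp_all add: h' map_matrix_mat[OF hom] hom_\<iota>(3) flip: map_matrix_mult[OF hom])
    then have inv: "invertible (map_matrix \<iota> h)" unfolding invertible_def by blast
    \<comment> \<open>A common denominator of the entries of the inverse of \<open>h\<close>; it
      puts the multiples of the basis vectors by \<open>\<iota> d\<close> into the lattice of
      \<open>h\<close>.\<close>
    obtain d where d: "d \<noteq> 0" "d \<in> affine_ring v" "\<And>i j. d * h' $ i $ j \<in> affine_ring v"
      using ff.affine_common_denominator[OF assms(2), of "range (\<lambda>(i, j). h' $ i $ j)"] by auto
    let ?k = "map_matrix \<iota> (mat d ** h')"
    have "axial (map_matrix \<iota> h)"
    proof (rule axial_if_entries[OF inv, of ?k "\<iota> d"])
      show "\<forall>i j. ?k $ i $ j \<in> R" using d(3) assms(6) by (simp add: map_matrix_def mat_mult)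
      have "map_matrix \<iota> h ** ?k = map_matrix \<iota> (mat d ** (h ** h'))"
        by (metis map_matrix_mult[OF hom] mat_commute matrix_mul_assoc)
      then show "map_matrix \<iota> h ** ?k = mat (\<iota> d)" by (simp add: h' map_matrix_mat[OF hom])
      show "\<iota> d \<noteq> 0" using d(1) by (simp add: hom_\<iota>)
    qed
    then have "axial (diag_matrix a ** map_matrix \<iota> h)" by (intro axial_diag_mult a)
    moreover have "lat (diag_matrix a ** map_matrix \<iota> h) = lat g"
      using x_eq x by (simp only: pmult_class pact_standard)
    moreover have "invertible (diag_matrix a ** map_matrix \<iota> h)"
      by (rule invertible_mult[OF invertible_diag_matrix inv]) (rule a)
    ultimately show "axial g" using axial_if_lat_eq[OF _ g] by blast
  next
    assume "axial g"
    then obtain a \<rho> where "\<forall>i. a i \<noteq> 0" and \<rho>: "\<forall>i j. \<rho> $ i $ j \<in> R" "diag_matrix a ** g ** \<rho> = mat 1"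
      using axial_normal_form[OF g] by blast
    then have a: "a i \<noteq> 0" for i by blast
    have \<rho>': "\<rho> ** (diag_matrix a ** g) = mat 1" using \<rho>(2) by (rule matrix_left_right_inverse[THEN iffD1])
    have "\<forall>i j. \<exists>y. \<rho> $ i $ j = \<iota> y" using \<rho>(1) assms(6) by blast
    then obtain y where y: "\<And>i j. \<rho> $ i $ j = \<iota> (y i j)" by metis
    \<comment> \<open>\<rho> has entries in the image of R, so it comes from a matrix over K; the
      inverse of that matrix is the rational element sought in (3).\<close>
    define k :: "'k ^ 'n ^ 'n" where "k = (\<chi> i j. y i j)"
    have \<rho>k: "\<rho> = map_matrix \<iota> k" by (simp add: k_def map_matrix_def vec_eq_iff y)
    have "det k \<noteq> 0"
    proof
      assume "det k = 0"
      have "det \<rho> = \<iota> (det k)" unfolding \<rho>k by (rule det_map_matrix[OF hom])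
      then have "det \<rho> = 0" using \<open>det k = 0\<close> by (simp add: hom_\<iota>)
      moreover have "invertible \<rho>" using \<rho>(2) \<rho>' unfolding invertible_def by blast
      ultimately show False by (simp add: invertible_det_nz)
    qed
    then obtain h where h: "k ** h = mat 1" "h ** k = mat 1"
      using invertible_det_nz[of k] by (auto simp: invertible_def)
    have "\<rho> ** map_matrix \<iota> h = mat 1"
      unfolding \<rho>k by (simp add: h map_matrix_mat[OF hom] hom_\<iota>(3) flip: map_matrix_mult[OF hom])
    then have "diag_matrix a ** g = (diag_matrix a ** g) ** (\<rho> ** map_matrix \<iota> h)" by simp
    also have "\<dots> = map_matrix \<iota> h" by (simp only: matrix_mul_assoc \<rho>(2) matrix_mul_lid)
    finally have "diag_matrix (\<lambda>i. inverse (a i)) ** map_matrix \<iota> h = diag_matrix (\<lambda>i. inverse (a i)) ** (diag_matrix a ** g)"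
      by simp
    also have "\<dots> = g" by (simp only: matrix_mul_assoc diag_inverse[OF a] matrix_mul_lid)
    finally have "x = pact (pmult (pclass (diag_matrix (\<lambda>i. inverse (a i)))) (pclass (map_matrix \<iota> h)))
        (homothety_class (standard_lattice R))"
      by (simp add: x pmult_class pact_standard)
    moreover have "pclass (diag_matrix (\<lambda>i. inverse (a i))) \<in> PA" unfolding PA_def using a by force
    moreover have "pclass (map_matrix \<iota> h) \<in> PGL_sub \<iota>" unfolding PGL_sub_def invertible_def using h by blast
    ultimately show "\<exists>a\<in>PA. \<exists>h\<in>PGL_sub \<iota>. x = pact (pmult a h) (homothety_class (standard_lattice R))" by blast
  qed
  then show ?thesis
    using proper_PA_iff_axial[OF g] proper_PD_iff_axial[OF g] ex_integral_iff[OF g] ex_axial_iff[OF g] all_axial_iff[OF g]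
    unfolding all_equivalent_def x by simp
qed

end
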